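(* Let $f(\tau)\equiv f_0(|\tau|)$ be a locally integrable radial function on $G(n,j)$ satisfying $$\int_{|\tau|>a}|f(\tau)|\,|\tau|^{k+j-n}\,d\tau<\infty$$ for some $a>0$. Then, for all $j+k<n$, $f_0$ can be recovered from the Radon transform $(\mathcal R_{j,k}f)(\zeta)\equiv(I_{j,k}f_0)(|\zeta|)$ by the formula $$f_0(t)=\tilde c_1^{\,-1}\,\bigl(\mathcal D^{k/2}_{-,2}\,r^{2-n+j+k}\,\mathcal D^{j/2}_{+,2}\,s^{n-k-2}\,I_{j,k}f_0\bigr)(t)\quad\text{for almost all } t>0,$$ where $\tilde c_1=\pi^{k/2}\,\Gamma((n-k)/2)/\Gamma((n-j-k)/2)$.
   Context: Throughout, $n,j,k$ are integers with $j>0$, $k>0$, $j+k<n$. $G_{n,j}$ is the Grassmannian of $j$-dimensional linear subspaces of $\mathbb R^n$; $G(n,j)$ is the manifold of $j$-dimensional unoriented affine planes in $\mathbb R^n$. Every $\tau\in G(n,j)$ is written uniquely as $\tau=\xi+u$ with $\xi\in G_{n,j}$, $u\in\xi^\perp$; $|\tau|=|u|$ is the distance from $\tau$ to the origin. $G(n,j)$ carries the measure $d\tau=d\xi\,du$, with $d\xi$ the $O(n)$-invariant probability measure on $G_{n,j}$ and $du$ Lebesgue measure on $\xi^\perp$. Similarly $\zeta=\eta+v\in G(n,k)$, $\eta\in G_{n,k}$, $v\in\eta^\perp$, $|\zeta|=|v|$. The mixed Radon transform $\mathcal R_{j,k}$ takes $f$ on $G(n,j)$ to the function on $G(n,k)$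 $$(\mathcal R_{j,k}f)(\eta+v)=\int_{G_j(\eta^\perp)}d\xi\int_\eta f(\xi+u+v)\,du,$$ where $G_j(\eta^\perp)$ is the Grassmannian of $j$-dimensional linear subspaces of $\eta^\perp$ with its invariant probability measure and $du$ is Lebesgue measure on $\eta$. If $f$ is radial, so is $\mathcal R_{j,k}f$, and $I_{j,k}f_0$ denotes the function on $(0,\infty)$ with $(\mathcal R_{j,k}f)(\zeta)=(I_{j,k}f_0)(|\zeta|)$; explicitly, $(I_{j,k}f_0)(s)=\tilde c_1 s^{k+2-n}(I^{j/2}_{+,2}\,r^{n-j-k-2}\,I^{k/2}_{-,2}f_0)(s)$. Erdélyi–Kober integrals for $\alpha>0$: $$(I^\alpha_{+,2}f)(t)=\frac{2}{\Gamma(\alpha)}\int_0^t (t^2-r^2)^{\alpha-1}f(r)\,r\,dr,\qquad (I^\alpha_{-,2}f)(t)=\frac{2}{\Gamma(\alpha)}\int_t^\infty (r^2-t^2)^{\alpha-1}f(r)\,r\,dr.$$ Erdélyi–Kober derivatives (left inverses of these), with $D=\frac1{2t}\frac{d}{dt}$: for $\alpha=m+\alpha_0$, $m=[\alpha]$, $0\le\alpha_0<1$, $\mathcal D^\alpha_{+,2}\varphi=D^{m+1}I^{1-\alpha_0}_{+,2}\varphi$; and $$\mathcal D^{k/2}_{-,2}\varphi=(-D)^{k/2}\varphi\ \ (k\text{ even}),\qquad \mathcal D^{k/2}_{-,2}\varphi=t\,(-D)^{(k+1)/2}\,t^{k}\,I^{1/2}_{-,2}\,t^{-k-1}\varphi\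 \ (k\text{ odd}).$$ In compositions, powers such as $r^{2-n+j+k}$, $s^{n-k-2}$, $t^k$ denote multiplication by the corresponding power of the variable. *)

theory Defs
  imports "HOL-Probability.Probability_Measure"
begin

section \<open>Linear and affine Grassmannians\<close>

text \<open>Planes are represented as subsets of the ambient Euclidean space. The distance of a plane
  \<open>\<tau>\<close> to the origin is the library notion \<open>infdist 0 \<tau>\<close>.\<close>

definition grassmannian :: "'a::euclidean_space set \<Rightarrow> nat \<Rightarrow> 'a set set" where
  "grassmannian W j = {\<xi>. subspace \<xi> \<and> dim \<xi> = j \<and> \<xi> \<subseteq> W}"

definition affine_grassmannian :: "nat \<Rightarrow> 'a::euclidean_space set set" where
  "affine_grassmannian j = {\<tau>. affine \<tau> \<and> aff_dim \<tau> = int j}"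

text \<open>The manifold topology on a set \<open>X\<close> of planes of one fixed dimension (linear or affine) is
  the topology of pointwise convergence of the distance functions \<open>x \<mapsto> infdist x \<tau>\<close>;
  the function space carries the product topology.\<close>

definition plane_topology :: "'a::euclidean_space set set \<Rightarrow> 'a set topology" where
  "plane_topology X = pullback_topology X (\<lambda>\<tau> x. infdist x \<tau>) euclidean"

definition plane_borel :: "'a::euclidean_space set set \<Rightarrow> 'a set measure" where
  "plane_borel X = sigma X {U. openin (plane_topology X) U}"

text \<open>The orthogonal group of a subspace \<open>W\<close> consists of the restrictions to \<open>W\<close> of the orthogonal
  transformations of the ambient space that map \<open>W\<close> onto itself.\<close>

definition invariant_prob :: "'a::euclidean_space set \<Rightarrow> nat \<Rightarrow> 'a set measure \<Rightarrow> bool" where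
  "invariant_prob W j \<mu> \<longleftrightarrow>
     prob_space \<mu> \<and>
     space \<mu> = grassmannian W j \<and>
     sets \<mu> = sets (plane_borel (grassmannian W j)) \<and>
     (\<forall>T. orthogonal_transformation T \<and> T ` W = W \<longrightarrow> distr \<mu> \<mu> (\<lambda>\<xi>. T ` \<xi>) = \<mu>)"

text \<open>For a subspace \<open>W\<close> and \<open>j \<le> dim W\<close> there is exactly one such measure, because the orthogonal
  group of \<open>W\<close> is compact and acts transitively on the \<open>j\<close>-dimensional subspaces of \<open>W\<close>.\<close>

definition grassmann_measure :: "'a::euclidean_space set \<Rightarrow> nat \<Rightarrow> 'a set measure" where
  "grassmann_measure W j = (SOME \<mu>. invariant_prob W j \<mu>)"

definition orthonormal_basis_of :: "'a::euclidean_space set \<Rightarrow> 'a set" where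
  "orthonormal_basis_of W =
     (SOME B. B \<subseteq> W \<and> pairwise orthogonal B \<and> (\<forall>b\<in>B. norm b = 1) \<and> span B = W)"

text \<open>Lebesgue measure on a subspace \<open>W\<close>, as a measure on the ambient space that is concentrated
  on \<open>W\<close>. It does not depend on the choice of the orthonormal basis.\<close>

definition subspace_lebesgue :: "'a::euclidean_space set \<Rightarrow> 'a measure" where
  "subspace_lebesgue W =
     (let B = orthonormal_basis_of W
      in completion (distr (PiM B (\<lambda>_. lborel)) borel (\<lambda>c. \<Sum>b\<in>B. c b *\<^sub>R b)))"

text \<open>The measure \<open>d\<tau> = d\<xi> du\<close> for \<open>\<tau> = \<xi> + u\<close>, first on the Borel sets and then completed.\<close>

definition affine_measure :: "nat \<Rightarrow> 'a::euclidean_space set measure" where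
  "affine_measure j =
     completion (measure_of (affine_grassmannian j) (sets (plane_borel (affine_grassmannian j)))
       (\<lambda>A. \<integral>\<^sup>+\<xi>. (\<integral>\<^sup>+u. indicator A ((+) u ` \<xi>) \<partial>subspace_lebesgue (\<xi>\<^sup>\<bottom>))
              \<partial>grassmann_measure UNIV j))"

definition plane_locally_integrable :: "nat \<Rightarrow> ('a::euclidean_space set \<Rightarrow> real) \<Rightarrow> bool" where
  "plane_locally_integrable j f \<longleftrightarrow>
     (\<forall>K. compactin (plane_topology (affine_grassmannian j)) K \<longrightarrow>
        set_integrable (affine_measure j) K f)"

section \<open>The mixed Radon transform\<close>

text \<open>An affine plane \<open>\<zeta>\<close> is decomposed as \<open>\<zeta> = \<eta> + v\<close> with \<open>v = plane_foot \<zeta>\<close>, the point of \<open>\<zeta>\<close>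
  nearest to the origin, and \<open>\<eta> = plane_direction \<zeta>\<close>.\<close>

definition plane_foot :: "'a::euclidean_space set \<Rightarrow> 'a" where
  "plane_foot \<zeta> = closest_point \<zeta> 0"

definition plane_direction :: "'a::euclidean_space set \<Rightarrow> 'a set" where
  "plane_direction \<zeta> = (\<lambda>x. x - plane_foot \<zeta>) ` \<zeta>"

text \<open>The number \<open>k\<close> of the transform from \<open>j\<close>-planes to \<open>k\<close>-planes is the dimension of the
  argument \<open>\<zeta>\<close>.\<close>

definition mixed_radon ::
  "nat \<Rightarrow> ('a::euclidean_space set \<Rightarrow> real) \<Rightarrow> 'a set \<Rightarrow> real" where
  "mixed_radon j f \<zeta> =
     (let \<eta> = plane_direction \<zeta>; v = plane_foot \<zeta>
      in \<integral>\<xi>. (\<integral>u. f ((+) (u + v) ` \<xi>) \<partial>subspace_lebesgue \<eta>)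
           \<partial>completion (grassmann_measure (\<eta>\<^sup>\<bottom>) j))"

text \<open>For a radial function \<open>g\<close> on the affine \<open>k\<close>-planes, the function \<open>g\<^sub>0\<close> on the positive reals
  with \<open>g \<zeta> = g\<^sub>0 (infdist 0 \<zeta>)\<close>. Applied to the Radon transform of \<open>f\<close> it is \<open>I\<^sub>j\<^sub>,\<^sub>k f\<^sub>0\<close>.\<close>

definition radial_profile :: "nat \<Rightarrow> ('a::euclidean_space set \<Rightarrow> real) \<Rightarrow> real \<Rightarrow> real" where
  "radial_profile k g s = g (SOME \<zeta>. \<zeta> \<in> affine_grassmannian k \<and> infdist 0 \<zeta> = s)"

definition radon_const :: "nat \<Rightarrow> nat \<Rightarrow> nat \<Rightarrow> real" where
  "radon_const n j k =
     pi powr (real k / 2) * Gamma ((real n - real k) / 2) / Gamma ((real n - real j - real k) / 2)"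

section \<open>Erdelyi--Kober integrals and derivatives\<close>

definition ek_int_plus :: "real \<Rightarrow> (real \<Rightarrow> real) \<Rightarrow> real \<Rightarrow> real" where
  "ek_int_plus \<alpha> \<phi> t =
     2 / Gamma \<alpha> * (LINT r:{0<..<t}|lebesgue. (t\<^sup>2 - r\<^sup>2) powr (\<alpha> - 1) * \<phi> r * r)"

definition ek_int_minus :: "real \<Rightarrow> (real \<Rightarrow> real) \<Rightarrow> real \<Rightarrow> real" where
  "ek_int_minus \<alpha> \<phi> t =
     2 / Gamma \<alpha> * (LINT r:{t<..}|lebesgue. (r\<^sup>2 - t\<^sup>2) powr (\<alpha> - 1) * \<phi> r * r)"

definition ek_D :: "(real \<Rightarrow> real) \<Rightarrow> real \<Rightarrow> real" where
  "ek_D \<phi> t = deriv \<phi> t / (2 * t)"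

definition ek_neg_D :: "(real \<Rightarrow> real) \<Rightarrow> real \<Rightarrow> real" where
  "ek_neg_D \<phi> t = - ek_D \<phi> t"

definition ek_deriv_plus :: "real \<Rightarrow> (real \<Rightarrow> real) \<Rightarrow> real \<Rightarrow> real" where
  "ek_deriv_plus \<alpha> \<phi> = (ek_D ^^ (nat \<lfloor>\<alpha>\<rfloor> + 1)) (ek_int_plus (1 - frac \<alpha>) \<phi>)"

definition ek_odd_kernel :: "nat \<Rightarrow> (real \<Rightarrow> real) \<Rightarrow> real \<Rightarrow> real" where
  "ek_odd_kernel k \<phi> s = s ^ k * ek_int_minus (1 / 2) (\<lambda>r. r powi (- int k - 1) * \<phi> r) s"

text \<open>\<open>ek_deriv_minus k\<close> is the right-sided Erdelyi--Kober derivative of order \<open>k/2\<close>, not \<open>k\<close>.\<close>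

definition ek_deriv_minus :: "nat \<Rightarrow> (real \<Rightarrow> real) \<Rightarrow> real \<Rightarrow> real" where
  "ek_deriv_minus k \<phi> t =
     (if even k then (ek_neg_D ^^ (k div 2)) \<phi> t
      else t * (ek_neg_D ^^ ((k + 1) div 2)) (ek_odd_kernel k \<phi>) t)"

text \<open>Integrals that do not converge and derivatives that do not exist have conventional values
  in HOL. The following predicates state that the Erdelyi--Kober derivatives exist at \<open>t\<close>:
  the integrals converge absolutely near \<open>t\<close> and the iterated derivatives exist.\<close>

primrec ek_differentiable :: "nat \<Rightarrow> (real \<Rightarrow> real) \<Rightarrow> real \<Rightarrow> bool" where
  "ek_differentiable 0 \<phi> t \<longleftrightarrow> True"
| "ek_differentiable (Suc m) \<phi> t \<longleftrightarrow>
     (\<forall>\<^sub>F r in nhds t. ek_differentiable m \<phi> r) \<and> (ek_D ^^ m) \<phi> differentiable (at t)"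

definition ek_deriv_plus_exists :: "real \<Rightarrow> (real \<Rightarrow> real) \<Rightarrow> real \<Rightarrow> bool" where
  "ek_deriv_plus_exists \<alpha> \<phi> t \<longleftrightarrow>
     (\<forall>\<^sub>F s in nhds t.
        set_integrable lebesgue {0<..<s} (\<lambda>r. (s\<^sup>2 - r\<^sup>2) powr (- frac \<alpha>) * \<phi> r * r)) \<and>
     ek_differentiable (nat \<lfloor>\<alpha>\<rfloor> + 1) (ek_int_plus (1 - frac \<alpha>) \<phi>) t"

definition ek_deriv_minus_exists :: "nat \<Rightarrow> (real \<Rightarrow> real) \<Rightarrow> real \<Rightarrow> bool" where
  "ek_deriv_minus_exists k \<phi> t \<longleftrightarrow>
     (if even k then ek_differentiable (k div 2) \<phi> t
      else (\<forall>\<^sub>F s in nhds t. set_integrable lebesgue {s<..}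
              (\<lambda>r. (r\<^sup>2 - s\<^sup>2) powr (- 1 / 2) * (r powi (- int k - 1) * \<phi> r) * r)) \<and>
           ek_differentiable ((k + 1) div 2) (ek_odd_kernel k \<phi>) t)"

end

theory Submission
  imports Defs
begin

text \<open>On a \<open>k\<close>-dimensional \<open>\<eta>\<close> the map \<open>u \<mapsto> \<surd>(|u|\<^sup>2 + x\<^sup>2)\<close> pushes Lebesgue measure to a multiple of
  the kernel of \<open>I\<^bsup>k/2\<^esup>\<^sub>-\<close>. If \<open>\<xi>\<close> is random under an invariant probability, the law of the distance from
  \<open>v\<close> to \<open>\<xi>\<close> depends only on \<open>|v|\<close>, because reflections act transitively on spheres; integrating over \<open>v\<close>
  in a ball and exchanging the integrals reduces it to a fixed \<open>\<xi>\<close>, where it is the kernel of \<open>I\<^bsup>j/2\<^esup>\<^sub>+\<close> with a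
  power weight; so every invariant probability yields the same law. Hence the transform is a weighted
  composition of the two integrals. The semigroup property turns the outer fractional integrals into integrals
  of integer order, which are iterated primitives with respect to \<open>2 t dt\<close>, and these are differentiated almost
  everywhere by Lebesgue's theorem (Vitali covering).

  The profile \<open>f0\<close> is not assumed to be measurable: slicing along the planes \<open>t v + \<xi>\<close> for a generic pair
  \<open>(v, \<xi>)\<close> shows that it agrees almost everywhere with a Borel function.\<close>

section \<open>Lebesgue differentiation of integrals\<close>

text \<open>The delicate point is where equality holds everywhere and where only almost everywhere.
  Undoing the left-sided integral yields c times r^(n-j-k-2) times the right-sided integral of order
  k/2 of the profile, in general only for almost every r. If k is odd, the next operator starts with
  an integral, which ignores null sets. If k is even, it differentiates at once and needs the values
  on whole neighbourhoods; but then k/2 is a positive integer, the right-sided integral is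
  continuous, and the first inversion holds at every point. Only the last differentiation is left to
  Lebesgue's theorem.

  The two integrability assumptions become the weights r^(n-j-1) near 0 and r^(k-1) at infinity, the
  growth rates of the composed kernel in these regions.

  The constant is a product of two normalizations: pi^(k/2) from Lebesgue measure on \<eta> in polar
  form, and Gamma((n-k)/2) / Gamma((n-j-k)/2) from the law of the distance to a random j-plane in
  the orthogonal complement of \<eta>.\<close>

lemma integrable_indicator_times:
  fixes f :: "real \<Rightarrow> real"
  assumes "A \<in> sets borel" "integrable lborel f"
  shows "integrable lborel (\<lambda>x. indicator A x * f x)"
  using integrable_mult_indicator[of A lborel f] assms by simp

lemma set_lborel_integral_diff:
  fixes g :: "real \<Rightarrow> real"
  assumes g: "integrable lborel g" and "a \<le> b"
  shows "(LINT r:{..b}|lborel. g r) - (LINT r:{..a}|lborel. g r) = (LINT t:{a<..b}|lborel. g t)"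
proof -
  have "(LINT t:{..a} \<union> {a<..b}|lborel. g t) = (LINT t:{..a}|lborel. g t) + (LINT t:{a<..b}|lborel. g t)"
    by (rule set_integral_Un) (use g in \<open>auto simp: set_integrable_def intro!: integrable_indicator_times\<close>)
  moreover have "{..a} \<union> {a<..b} = {..b}" using \<open>a \<le> b\<close> by auto
  ultimately show ?thesis by simp
qed

text \<open>One half of Lebesgue's theorem. Vitali covers the set, up to a null set, by disjoint
  short intervals on each of which the integral of g - c is positive. On them the negative mass of g
  - c is at most the positive mass, which lies in a thin open neighbourhood of {g < c} outside that
  set and is arbitrarily small. The points a, b need only enclose t, since difference quotients use
  intervals with t as an endpoint.\<close>

lemma negligible_upper_average:
  fixes g :: "real \<Rightarrow> real"
  assumes g: "integrable lborel g"
  defines "F \<equiv> \<lambda>x. LINT r:{..x}|lborel. g r"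
  shows "negligible {t. \<bar>t\<bar> < N \<and> g t < c \<and>
     (\<forall>d>0. \<exists>a b. a \<le> t \<and> t \<le> b \<and> 0 < b - a \<and> b - a < d \<and> F b - F a > c * (b - a))}"
    (is "negligible ?E")
proof -
  define E where "E = ?E"
  \<comment> \<open>Cutting off to a bounded window makes the constant c integrable; outer
    regularity below needs the finite measure with density |h|.\<close>
  define h where "h = (\<lambda>t. indicator {-N<..<N} t * (g t - c))"
  have gm[measurable]: "g \<in> borel_measurable borel" using g by auto
  have h: "integrable lborel h"
  proof -
    have "integrable lborel (\<lambda>t. indicator {-N<..<N} t * g t - c * indicator {-N<..<N} t)"
      using emeasure_bounded_finite[of "{-N<..<N}"]
      by (intro Bochner_Integration.integrable_diff integrable_indicator_times g
          integrable_mult_right integrable_real_indicator) auto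
    then show ?thesis by (simp add: h_def algebra_simps)
  qed
  have hm[measurable]: "h \<in> borel_measurable borel" using h by auto
  \<comment> \<open>Total, positive and negative mass of \<open>h\<close>: \<open>ennreal\<close>
    sends negative numbers to 0, so \<open>p\<close> and \<open>m\<close> are the two parts of the
    Jordan decomposition.\<close>
  define \<nu> where "\<nu> = density lborel (\<lambda>t. ennreal \<bar>h t\<bar>)"
  define p where "p = density lborel (\<lambda>t. ennreal (h t))"
  define m where "m = density lborel (\<lambda>t. ennreal (- h t))"
  have sn[measurable_cong]: "sets \<nu> = sets borel" "sets p = sets borel" "sets m = sets borel" by (simp_all add: \<nu>_def p_def m_def)
  have fin: "emeasure \<nu> (space \<nu>) \<noteq> \<infinity>"
    using h by (auto simp add: \<nu>_def emeasure_density integrable_iff_bounded)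
  define M where "M = {t. \<bar>t\<bar> < N \<and> g t < c}"
  have M[measurable]: "M \<in> sets borel" unfolding M_def by measurable
  have EM: "E \<subseteq> M" by (auto simp: E_def M_def)
  have key: "\<exists>V. V \<in> sets borel \<and> V \<subseteq> M \<and> negligible (E - V) \<and> emeasure \<nu> V \<le> ennreal e" if e: "0 < e" for e
  proof -
    have inf: "emeasure \<nu> M = (INF U\<in>{U. M \<subseteq> U \<and> open U}. emeasure \<nu> U)"
      by (rule outer_regular[OF sn(1) fin]) simp
    have Mfin: "emeasure \<nu> M < \<infinity>"
      using emeasure_space[of \<nu> M] fin by (simp add: less_top[symmetric] top_unique) (metis top_unique)
    then have "emeasure \<nu> M < emeasure \<nu> M + ennreal e"
      using e by (simp add: ennreal_add_left_cancel_less)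
    with inf have "(INF U\<in>{U. M \<subseteq> U \<and> open U}. emeasure \<nu> U) < emeasure \<nu> M + ennreal e"
      by simp
    then obtain U0 where U0: "M \<subseteq> U0" "open U0" "emeasure \<nu> U0 < emeasure \<nu> M + ennreal e"
      by (auto simp: INF_less_iff)
    \<comment> \<open>Intersecting with the window keeps every chosen interval in the region where
      \<open>h\<close> is g - c.\<close>
    define U where "U = U0 \<inter> {-N<..<N}"
    have U: "M \<subseteq> U" "open U"
      using U0 by (auto simp: U_def M_def)
    have U3: "emeasure \<nu> U < emeasure \<nu> M + ennreal e"
      by (rule le_less_trans[OF emeasure_mono U0(3)]) (use U0(2) in \<open>auto simp: U_def\<close>)
    have [measurable]: "U \<in> sets borel" using U by auto
    have Ud: "emeasure \<nu> (U - M) \<le> ennreal e"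
    proof -
      have "emeasure \<nu> (U - M) = emeasure \<nu> U - emeasure \<nu> M"
        using Mfin U by (intro emeasure_Diff) auto
      also have "\<dots> \<le> emeasure \<nu> M + ennreal e - emeasure \<nu> M"
        using U3 by (intro ennreal_minus_mono) auto
      also have "\<dots> = ennreal e" using Mfin by simp
      finally show ?thesis .
    qed
    define B where "B = (\<lambda>i::real\<times>real. cball (fst i) (snd i))"
    define K where "K = {i. 0 < snd i \<and> B i \<subseteq> U \<and> (F (fst i + snd i) - F (fst i - snd i) > c * (2 * snd i))}"
    obtain C where C: "countable C" "C \<subseteq> K"
     "pairwise (\<lambda>i j. disjnt (cball (fst i) (snd i)) (cball (fst j) (snd j))) C"
     "negligible (E - (\<Union>i \<in> C. cball (fst i) (snd i)))"
    proof (rule Vitali_covering_theorem_cballs[of K snd E fst])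
      show "\<And>i. i \<in> K \<Longrightarrow> 0 < snd i" by (auto simp: K_def)
      fix t d :: real assume t: "t \<in> E" and d: "0 < d"
      with EM U obtain e' where e': "e' > 0" "ball t e' \<subseteq> U" by (meson open_contains_ball subset_iff)
      have "min d (e') > 0" using d e' by simp
      then obtain a b where ab: "a \<le> t" "t \<le> b" "0 < b - a" "b - a < min d e'" "F b - F a > c * (b - a)"
        using t unfolding E_def by blast
      have cb: "B ((a+b)/2, (b-a)/2) = {a..b}" using ab by (auto simp: B_def cball_eq_atLeastAtMost field_simps)
      have sum1: "(a+b)/2 + (b-a)/2 = b" "(a+b)/2 - (b-a)/2 = a" "2 * ((b-a)/2) = b - a" by (auto simp: field_simps)
      have "{a..b} \<subseteq> ball t e'" using ab by (auto simp: dist_real_def)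
      then have "((a+b)/2, (b-a)/2) \<in> K" using ab e' unfolding K_def mem_Collect_eq cb fst_conv snd_conv sum1 by auto
      then show "\<exists>i. i \<in> K \<and> t \<in> cball (fst i) (snd i) \<and> snd i < d"
        using ab cb by (intro exI[of _ "((a+b)/2, (b-a)/2)"]) (auto simp: B_def)
    qed
    define W where "W = (\<Union>i\<in>C. B i)"
    have WU: "W \<subseteq> U" using C(2) by (auto simp: W_def K_def)
    have Bm[measurable]: "B i \<in> sets borel" for i by (simp add: B_def)
    have Wm[measurable]: "W \<in> sets borel" unfolding W_def using C(1) by (intro sets.countable_UN') auto
    have dj: "disjoint_family_on B C"
      using C(3) unfolding disjoint_family_on_def pairwise_def disjnt_def B_def by blast
    \<comment> \<open>F b - F a > c (b - a) says that the integral of \<open>h\<close> over the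
      interval is positive, so its negative mass there is at most its positive mass.\<close>
    have pos: "emeasure m (B i) \<le> emeasure p (B i)" if "i \<in> C" for i
    proof -
      obtain x r where i: "i = (x, r)" by (cases i)
      have Bi: "B i = {x-r..x+r}" by (auto simp: B_def i cball_eq_atLeastAtMost)
      have K: "0 < r" "{x-r..x+r} \<subseteq> U" "F (x + r) - F (x - r) > c * (2 * r)"
        using that C(2) Bi by (auto simp: K_def i)
      have sub: "{x-r..x+r} \<subseteq> {-N<..<N}" using K(2) by (auto simp: U_def)
      have "(LINT t:B i|lborel. h t) = (LINT t:{x-r<..x+r}|lborel. g t - c)"
        unfolding set_lebesgue_integral_def
      proof (rule integral_cong_AE)
        have "AE t in lborel. t \<noteq> x - r" by (rule AE_lborel_singleton)
        then show "AE t in lborel. indicat_real (B i) t *\<^sub>R h t = indicat_real {x - r<..x + r} t *\<^sub>R (g t - c)"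
          by eventually_elim (use sub in \<open>auto simp: Bi h_def indicator_def subset_iff\<close>)
      qed (auto simp: Bi)
      also have "\<dots> = (LINT t:{x-r<..x+r}|lborel. g t) - (LINT t:{x-r<..x+r}|lborel. c)"
        by (rule set_integral_diff) (use g K in \<open>auto simp: set_integrable_def intro!: integrable_indicator_times integrable_real_mult_indicator\<close>)
      also have "\<dots> = F (x + r) - F (x - r) - c * (2 * r)" using K set_lborel_integral_diff[OF g, of "x-r" "x+r"] by (simp add: F_def set_lebesgue_integral_def)
      finally have I: "0 \<le> (LINT t|lborel. indicator (B i) t * h t)" using K by (simp add: set_lebesgue_integral_def)
      have ih: "integrable lborel (\<lambda>t. indicator (B i) t * h t)" by (intro integrable_indicator_times h) auto
      have f: "(\<integral>\<^sup>+t. ennreal (indicator (B i) t * h t) \<partial>lborel) \<noteq> \<infinity>" "(\<integral>\<^sup>+t. ennreal (- (indicator (B i) t * h t)) \<partial>lborel) \<noteq> \<infinity>"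
        using ih unfolding real_integrable_def by auto
      have "enn2real (\<integral>\<^sup>+t. ennreal (- (indicator (B i) t * h t)) \<partial>lborel) \<le> enn2real (\<integral>\<^sup>+t. ennreal (indicator (B i) t * h t) \<partial>lborel)"
        using I unfolding real_lebesgue_integral_def[OF ih] by simp
      then have le: "(\<integral>\<^sup>+t. ennreal (- (indicator (B i) t * h t)) \<partial>lborel) \<le> (\<integral>\<^sup>+t. ennreal (indicator (B i) t * h t) \<partial>lborel)"
        using f by (metis ennreal_enn2real ennreal_leI less_top infinity_ennreal_def)
      have "emeasure m (B i) = (\<integral>\<^sup>+t. ennreal (- (indicator (B i) t * h t)) \<partial>lborel)"
        unfolding m_def by (subst emeasure_density) (auto intro!: nn_integral_cong simp: indicator_def)
      moreover have "emeasure p (B i) = (\<integral>\<^sup>+t. ennreal (indicator (B i) t * h t) \<partial>lborel)"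
        unfolding p_def by (subst emeasure_density) (auto intro!: nn_integral_cong simp: indicator_def)
      ultimately show ?thesis using le by simp
    qed
    \<comment> \<open>On \<open>M\<close> all mass of \<open>h\<close> is negative. Comparing
      interval by interval exchanges it for positive mass inside \<open>U\<close>, and that sits
      outside \<open>M\<close>.\<close>
    have "emeasure \<nu> (W \<inter> M) \<le> emeasure m W"
      unfolding \<nu>_def m_def
      by (subst (1 2) emeasure_density) (auto intro!: nn_integral_mono simp: indicator_def M_def h_def)
    also have "\<dots> = (\<integral>\<^sup>+i. emeasure m (B i) \<partial>count_space C)"
      unfolding W_def by (rule emeasure_UN_countable) (use C dj in auto)
    also have "\<dots> \<le> (\<integral>\<^sup>+i. emeasure p (B i) \<partial>count_space C)"
      using pos by (intro nn_integral_mono) auto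
    also have "\<dots> = emeasure p W"
      unfolding W_def by (rule emeasure_UN_countable[symmetric]) (use C dj in auto)
    also have "\<dots> \<le> emeasure \<nu> (U - M)"
      unfolding \<nu>_def p_def using WU
      by (subst (1 2) emeasure_density) (auto intro!: nn_integral_mono ennreal_leI simp: indicator_def M_def h_def ennreal_neg)
    also note Ud
    finally have "emeasure \<nu> (W \<inter> M) \<le> ennreal e" .
    moreover have "E - (W \<inter> M) = E - (\<Union>i \<in> C. cball (fst i) (snd i))" using EM by (auto simp: W_def B_def)
    ultimately show ?thesis using C(4) by (intro exI[of _ "W \<inter> M"]) auto
  qed
  have "\<exists>V. \<forall>n::nat. V n \<in> sets borel \<and> V n \<subseteq> M \<and> negligible (E - V n) \<and> emeasure \<nu> (V n) \<le> ennreal (1 / Suc n)"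
    by (intro choice allI key) auto
  then obtain V where V: "\<And>n::nat. V n \<in> sets borel" "\<And>n. V n \<subseteq> M" "\<And>n. negligible (E - V n)" "\<And>n. emeasure \<nu> (V n) \<le> ennreal (1 / Suc n)"
    by blast
  \<comment> \<open>\<open>E\<close> is covered by \<open>V0\<close> and the null sets E - V n. The
    set \<open>V0\<close> carries no mass of |h|, yet \<open>h\<close> does not vanish on it, so it
    is null.\<close>
  define V0 where "V0 = (\<Inter>n. V n)"
  have V0m[measurable]: "V0 \<in> sets borel" unfolding V0_def using V(1) by auto
  have small: "emeasure \<nu> V0 \<le> ennreal e" if e: "e > 0" for e
  proof -
    obtain n where "1 / Suc n < e" using nat_approx_posE[OF e] by blast
    moreover have "emeasure \<nu> V0 \<le> emeasure \<nu> (V n)" by (rule emeasure_mono) (use V in \<open>auto simp: V0_def sn\<close>)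
    ultimately show ?thesis using V(4)[of n] by (meson ennreal_leI less_imp_le order_trans)
  qed
  have "emeasure \<nu> V0 \<le> 0"
  proof (rule ennreal_le_epsilon)
    show "emeasure \<nu> V0 \<le> 0 + ennreal e" if "0 < e" for e using small[OF that] by simp
  qed
  then have "emeasure \<nu> V0 = 0" by simp
  then have "AE t in lborel. t \<in> V0 \<longrightarrow> h t = 0"
    unfolding \<nu>_def by (simp add: emeasure_density nn_integral_0_iff_AE) (auto elim!: eventually_mono simp: indicator_def split: if_splits)
  moreover have "t \<in> V0 \<Longrightarrow> h t \<noteq> 0" for t
    using V(2)[of 0] by (auto simp: V0_def M_def h_def abs_less_iff subset_iff)
  ultimately have "AE t in lborel. t \<notin> V0" by auto
  then have "negligible V0" by (simp add: AE_iff_null_sets[of V0 lborel, simplified] negligible_iff_null_sets null_sets_completionI)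
  moreover have "negligible (\<Union>n. E - V n)" using V(3) by (intro negligible_countable_Union) auto
  ultimately have "negligible (V0 \<union> (\<Union>n. E - V n))" by (rule negligible_Un)
  then have "negligible E" by (rule negligible_subset) (auto simp: V0_def)
  then show ?thesis by (simp add: E_def)
qed

text \<open>Off a countable union of exceptional sets, rational levels just above and below g t trap
  the averages over all short intervals with t as an endpoint, and these averages are the difference
  quotients.\<close>

theorem lebesgue_differentiation:
  fixes g :: "real \<Rightarrow> real"
  assumes g: "integrable lborel g"
  defines "F \<equiv> \<lambda>x. LINT r:{..x}|lborel. g r"
  shows "AE t in lebesgue. (F has_real_derivative g t) (at t)"
proof -
  define P where "P = (\<lambda>(N::nat, c::real). {t. \<bar>t\<bar> < real N \<and> g t < c \<and>
     (\<forall>d>0. \<exists>a b. a \<le> t \<and> t \<le> b \<and> 0 < b - a \<and> b - a < d \<and> F b - F a > c * (b - a))})"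
  define Q where "Q = (\<lambda>(N::nat, c::real). {t. \<bar>t\<bar> < real N \<and> g t > c \<and>
     (\<forall>d>0. \<exists>a b. a \<le> t \<and> t \<le> b \<and> 0 < b - a \<and> b - a < d \<and> F b - F a < c * (b - a))})"
  have P: "negligible (P x)" for x
    using negligible_upper_average[OF g] by (cases x) (auto simp: P_def F_def)
  have Q: "negligible (Q x)" for x
  proof -
    obtain N c where x: "x = (N, c)" by (cases x)
    \<comment> \<open>The lower bound is the upper one applied to -g and -c.\<close>
    have "integrable lborel (\<lambda>t. - g t)" using g by simp
    from negligible_upper_average[OF this, of "real N" "-c"]
    show ?thesis by (simp add: x Q_def F_def set_lebesgue_integral_def algebra_simps)
  qed
  define Z where "Z = (\<Union>x\<in>UNIV \<times> \<rat>. P x \<union> Q x)"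
  have c: "countable ((UNIV :: nat set) \<times> (\<rat> :: real set))" by (intro countable_SIGMA countable_rat) auto
  have "negligible Z"
    unfolding Z_def using P Q c
    by (intro negligible_countable_Union) (auto intro: countable_image)
  then have "Z \<in> null_sets lebesgue" by (simp add: negligible_iff_null_sets)
  moreover have "(F has_real_derivative g t) (at t)" if tZ: "t \<notin> Z" for t
  proof -
    obtain N :: nat where N: "\<bar>t\<bar> < real N" using reals_Archimedean2 by blast
    have "\<exists>d>0. \<forall>y. y \<noteq> t \<and> dist y t < d \<longrightarrow> dist ((F y - F t) / (y - t)) (g t) < e" if e: "e > 0" for e
    proof -
      obtain c1 where c1: "c1 \<in> \<rat>" "g t < c1" "c1 < g t + e" using Rats_dense_in_real[of "g t" "g t + e"] e by auto
      obtain c2 where c2: "c2 \<in> \<rat>" "g t - e < c2" "c2 < g t" using Rats_dense_in_real[of "g t - e" "g t"] e by auto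
      have "t \<notin> P (N, c1)" "t \<notin> Q (N, c2)" using tZ c1 c2 by (auto simp: Z_def)
      then have "\<not> (\<forall>d>0. \<exists>a b. a \<le> t \<and> t \<le> b \<and> 0 < b - a \<and> b - a < d \<and> F b - F a > c1 * (b - a))"
        and "\<not> (\<forall>d>0. \<exists>a b. a \<le> t \<and> t \<le> b \<and> 0 < b - a \<and> b - a < d \<and> F b - F a < c2 * (b - a))"
        using N c1(2) c2(3) unfolding P_def Q_def by simp_all
      then obtain d1 d2 where d: "d1 > 0" "d2 > 0"
        and n: "\<not> (\<exists>a b. a \<le> t \<and> t \<le> b \<and> 0 < b - a \<and> b - a < d1 \<and> F b - F a > c1 * (b - a))"
          "\<not> (\<exists>a b. a \<le> t \<and> t \<le> b \<and> 0 < b - a \<and> b - a < d2 \<and> F b - F a < c2 * (b - a))"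
        unfolding not_all not_imp by (elim exE conjE) (rule that)
      have 1: "F b - F a \<le> c1 * (b - a)" if "a \<le> t" "t \<le> b" "0 < b - a" "b - a < d1" for a b
        using n(1) that by (meson not_less)
      have 2: "F b - F a \<ge> c2 * (b - a)" if "a \<le> t" "t \<le> b" "0 < b - a" "b - a < d2" for a b
        using n(2) that by (meson not_less)
      have "dist ((F y - F t) / (y - t)) (g t) < e" if y: "y \<noteq> t" "dist y t < min d1 d2" for y
      proof -
        have "c2 \<le> (F y - F t) / (y - t) \<and> (F y - F t) / (y - t) \<le> c1"
        proof (cases "y > t")
          case True
          then have "y - t < d1" "y - t < d2" using y by (simp_all add: dist_real_def)
          then have "F y - F t \<le> c1 * (y - t)" "F y - F t \<ge> c2 * (y - t)"
            using 1[of t y] 2[of t y] True by simp_all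
          then show ?thesis using True by (simp add: pos_le_divide_eq pos_divide_le_eq)
        next
          case False
          then have lt: "y < t" using y by simp
          then have "t - y < d1" "t - y < d2" using y by (simp_all add: dist_real_def)
          then have "F t - F y \<le> c1 * (t - y)" "F t - F y \<ge> c2 * (t - y)"
            using 1[of y t] 2[of y t] lt by simp_all
          then have "c2 \<le> (F t - F y) / (t - y) \<and> (F t - F y) / (t - y) \<le> c1"
            using lt by (simp add: pos_le_divide_eq pos_divide_le_eq)
          then show ?thesis using minus_divide_divide[of "F y - F t" "y - t"] by simp
        qed
        then show ?thesis using c1 c2 unfolding dist_real_def abs_less_iff by linarith
      qed
      moreover have "min d1 d2 > 0" using d by simp
      ultimately show ?thesis by blast
    qed
    then have "((\<lambda>y. (F y - F t) / (y - t)) \<longlongrightarrow> g t) (at t)"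
      by (simp add: Lim_at)
    then show ?thesis by (simp only: has_field_derivative_iff)
  qed
  ultimately show ?thesis by (intro AE_I'[of Z]) auto
qed

section \<open>Erdelyi-Kober kernels\<close>

text \<open>Subsets of null sets are measurable in the completion. This admits integrands built from
  the profile, which is not known to be Borel.\<close>

lemma measurable_completion_cong_AE:
  assumes f: "f \<in> completion M \<rightarrow>\<^sub>M N" and eq: "AE x in M. f x = g x"
    and g: "g \<in> space M \<rightarrow> space N"
  shows "g \<in> completion M \<rightarrow>\<^sub>M N"
proof (rule measurableI)
  show "\<And>x. x \<in> space (completion M) \<Longrightarrow> g x \<in> space N" using g by auto
  fix A assume A: "A \<in> sets N"
  obtain Z where Z: "Z \<in> null_sets M" "{x \<in> space M. f x \<noteq> g x} \<subseteq> Z"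
    using eq by (auto elim!: AE_E simp: null_sets_def)
  have "g -` A \<inter> space M = (f -` A \<inter> space M - Z) \<union> (g -` A \<inter> space M \<inter> Z)"
    using Z(2) by auto
  moreover have "f -` A \<inter> space M \<in> sets (completion M)"
    using measurable_sets[OF f A] by simp
  moreover have "Z \<in> sets (completion M)" using Z by auto
  moreover have "g -` A \<inter> space M \<inter> Z \<in> sets (completion M)"
    using null_sets_completion_subset[of "g -` A \<inter> space M \<inter> Z" Z M] Z(1) by (auto simp: null_sets_completionI)
  ultimately show "g -` A \<inter> space (completion M) \<in> sets (completion M)"
    by (metis sets.Un sets.Diff space_completion)
qed

text \<open>Euler's Beta integral after the substitution t = (r^2 - x^2) / (s^2 - x^2).\<close>

lemma beta_integral_squares:
  assumes ab: "0 < a" "0 < b" and x: "0 \<le> x" "x < s"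
  shows "(\<integral>\<^sup>+r. ennreal ((s\<^sup>2 - r\<^sup>2) powr (a - 1) * (r\<^sup>2 - x\<^sup>2) powr (b - 1) * (2 * r) * indicator {x..s} r) \<partial>lborel)
    = ennreal (Beta a b * (s\<^sup>2 - x\<^sup>2) powr (a + b - 1))"
proof -
  define L where "L = s\<^sup>2 - x\<^sup>2"
  have L: "L > 0" using x by (simp add: L_def power_strict_mono)
  have "((\<lambda>t. t powr (b - 1) * (1 - t) powr (a - 1)) has_integral Beta b a) {0..1}"
    using has_integral_Beta_real[of b a] ab by simp
  from nn_integral_has_integral_lebesgue[OF _ this]
  have "ennreal (Beta b a) = (\<integral>\<^sup>+t. ennreal (t powr (b - 1) * (1 - t) powr (a - 1) * indicator {0..1} t) \<partial>lborel)"
    by (simp add: mult_ac ennreal_mult' ennreal_indicator)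
  also have "\<dots> = (\<integral>\<^sup>+t. ennreal (t powr (b - 1) * (1 - t) powr (a - 1) * indicator {(x\<^sup>2 - x\<^sup>2) / L..(s\<^sup>2 - x\<^sup>2) / L} t) \<partial>lborel)"
    using L by (simp add: L_def)
  also have "\<dots> = (\<integral>\<^sup>+r. ennreal (((r\<^sup>2 - x\<^sup>2) / L) powr (b - 1) * (1 - (r\<^sup>2 - x\<^sup>2) / L) powr (a - 1) * (2 * r / L) * indicator {x..s} r) \<partial>lborel)"
    by (rule nn_integral_substitution[where g = "\<lambda>r. (r\<^sup>2 - x\<^sup>2) / L" and g' = "\<lambda>r. 2 * r / L"])
       (use x L in \<open>auto simp: set_borel_measurable_def intro!: derivative_eq_intros continuous_intros\<close>)
  finally have B: "ennreal (Beta b a) = \<dots>" .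
  have "(\<integral>\<^sup>+r. ennreal ((s\<^sup>2 - r\<^sup>2) powr (a - 1) * (r\<^sup>2 - x\<^sup>2) powr (b - 1) * (2 * r) * indicator {x..s} r) \<partial>lborel)
    = (\<integral>\<^sup>+r. ennreal (L powr (a + b - 1)) * ennreal (((r\<^sup>2 - x\<^sup>2) / L) powr (b - 1) * (1 - (r\<^sup>2 - x\<^sup>2) / L) powr (a - 1) * (2 * r / L) * indicator {x..s} r) \<partial>lborel)"
  proof (rule nn_integral_cong)
    fix r
    show "ennreal ((s\<^sup>2 - r\<^sup>2) powr (a - 1) * (r\<^sup>2 - x\<^sup>2) powr (b - 1) * (2 * r) * indicator {x..s} r)
      = ennreal (L powr (a + b - 1)) * ennreal (((r\<^sup>2 - x\<^sup>2) / L) powr (b - 1) * (1 - (r\<^sup>2 - x\<^sup>2) / L) powr (a - 1) * (2 * r / L) * indicator {x..s} r)"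
    proof (cases "r \<in> {x..s}")
      case True
      then have r: "x\<^sup>2 \<le> r\<^sup>2" "r\<^sup>2 \<le> s\<^sup>2" using x by (auto intro!: power_mono)
      have "1 - (r\<^sup>2 - x\<^sup>2) / L = (s\<^sup>2 - r\<^sup>2) / L" using L by (simp add: L_def field_simps)
      then have "((r\<^sup>2 - x\<^sup>2) / L) powr (b - 1) * (1 - (r\<^sup>2 - x\<^sup>2) / L) powr (a - 1)
        = (r\<^sup>2 - x\<^sup>2) powr (b - 1) * (s\<^sup>2 - r\<^sup>2) powr (a - 1) / (L powr (b - 1) * L powr (a - 1))"
        using r L by (simp add: powr_divide)
      also have "L powr (b - 1) * L powr (a - 1) = L powr (a + b - 1) / L"
        using L by (simp add: powr_add[symmetric] powr_diff field_simps)
      finally show ?thesis using L True by (simp add: ennreal_mult'[symmetric] field_simps)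
    qed simp
  qed
  also have "\<dots> = ennreal (L powr (a + b - 1)) * ennreal (Beta b a)"
    unfolding B by (rule nn_integral_cmult) simp
  also have "\<dots> = ennreal (Beta a b * L powr (a + b - 1))"
    by (simp add: ennreal_mult''[symmetric] Beta_commute mult.commute[of "ennreal (L powr _)"])
  finally show ?thesis by (simp add: L_def)
qed

text \<open>The exponent -2a - 2b is the one for which w = 1/r^2 becomes the natural variable: in w
  the integrand is a product of two powers of linear factors, again a Beta integral.\<close>

lemma beta_integral_inverted:
  assumes ab: "0 < a" "0 < b" and x: "0 < s" "s < x"
  shows "(\<integral>\<^sup>+r. ennreal ((r\<^sup>2 - s\<^sup>2) powr (a - 1) * (x\<^sup>2 - r\<^sup>2) powr (b - 1) * r powr (- 2 * a - 2 * b) * (2 * r) * indicator {s..x} r) \<partial>lborel)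
    = ennreal (Beta a b * (x\<^sup>2 - s\<^sup>2) powr (a + b - 1) * s powr (- 2 * b) * x powr (- 2 * a))"
proof -
  define L where "L = x\<^sup>2 - s\<^sup>2"
  have L: "L > 0" using x by (simp add: L_def power_strict_mono)
  have x0: "x > 0" using x by simp
  \<comment> \<open>Affine in 1/r^2 and normalized so that s goes to 0 and x to 1.\<close>
  define g where "g = (\<lambda>r. x\<^sup>2 / L * (1 - s\<^sup>2 / r\<^sup>2))"
  define g' where "g' = (\<lambda>r. x\<^sup>2 / L * (2 * s\<^sup>2 / r^3))"
  have gs: "g s = 0" "g x = 1" using x L by (auto simp: g_def L_def field_simps)
  have "((\<lambda>t. t powr (a - 1) * (1 - t) powr (b - 1)) has_integral Beta a b) {0..1}"
    using has_integral_Beta_real[of a b] ab by simp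
  from nn_integral_has_integral_lebesgue[OF _ this]
  have "ennreal (Beta a b) = (\<integral>\<^sup>+t. ennreal (t powr (a - 1) * (1 - t) powr (b - 1) * indicator {g s..g x} t) \<partial>lborel)"
    by (simp add: mult_ac ennreal_mult' ennreal_indicator gs)
  also have "\<dots> = (\<integral>\<^sup>+r. ennreal ((g r) powr (a - 1) * (1 - g r) powr (b - 1) * g' r * indicator {s..x} r) \<partial>lborel)"
  proof (rule nn_integral_substitution)
    show "(g has_real_derivative g' r) (at r)" if "r \<in> {s..x}" for r
      using that x L unfolding g_def g'_def
      by (auto intro!: derivative_eq_intros simp: field_simps power2_eq_square power3_eq_cube)
    show "continuous_on {s..x} g'"
      using x L unfolding g'_def by (auto intro!: continuous_intros)
    show "0 \<le> g' r" if "r \<in> {s..x}" for r using that x L by (auto simp: g'_def)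
  qed (use x in \<open>auto simp: set_borel_measurable_def gs\<close>)
  finally have B: "ennreal (Beta a b) = \<dots>" .
  \<comment> \<open>The ratio of the two integrands; it is free of r because the weight absorbs
    every power of r.\<close>
  define c where "c = L powr (a + b - 1) * s powr (- 2 * b) * x powr (- 2 * a)"
  have c0: "c \<ge> 0" by (simp add: c_def)
  have "(\<integral>\<^sup>+r. ennreal ((r\<^sup>2 - s\<^sup>2) powr (a - 1) * (x\<^sup>2 - r\<^sup>2) powr (b - 1) * r powr (- 2 * a - 2 * b) * (2 * r) * indicator {s..x} r) \<partial>lborel)
    = (\<integral>\<^sup>+r. ennreal c * ennreal ((g r) powr (a - 1) * (1 - g r) powr (b - 1) * g' r * indicator {s..x} r) \<partial>lborel)"
  proof (rule nn_integral_cong)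
    fix r
    show "ennreal ((r\<^sup>2 - s\<^sup>2) powr (a - 1) * (x\<^sup>2 - r\<^sup>2) powr (b - 1) * r powr (- 2 * a - 2 * b) * (2 * r) * indicator {s..x} r)
      = ennreal c * ennreal ((g r) powr (a - 1) * (1 - g r) powr (b - 1) * g' r * indicator {s..x} r)"
    proof (cases "r \<in> {s..x}")
      case True
      then have r: "s\<^sup>2 \<le> r\<^sup>2" "r\<^sup>2 \<le> x\<^sup>2" "r > 0" using x by (auto intro!: power_mono)
      have sq: "y\<^sup>2 powr z = y powr (2 * z)" if "y > 0" for y z :: real
      proof -
        have "y\<^sup>2 = y powr 2" using that by (simp add: powr_numeral)
        then show ?thesis by (simp only: powr_powr)
      qed
      have 1: "g r = x\<^sup>2 * (r\<^sup>2 - s\<^sup>2) / (r\<^sup>2 * L)" using r L by (simp add: g_def field_simps)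
      have 2: "1 - g r = s\<^sup>2 * (x\<^sup>2 - r\<^sup>2) / (r\<^sup>2 * L)" using r L by (simp add: g_def L_def field_simps)
      define A where "A = 2 * (a - 1)"
      define B where "B = 2 * (b - 1)"
      have "g r powr (a - 1) = (x\<^sup>2 * (r\<^sup>2 - s\<^sup>2)) powr (a - 1) / (r\<^sup>2 * L) powr (a - 1)"
        unfolding 1 using r L by (simp add: powr_divide)
      also have "(x\<^sup>2 * (r\<^sup>2 - s\<^sup>2)) powr (a - 1) = x powr A * (r\<^sup>2 - s\<^sup>2) powr (a - 1)"
        using r x0 by (subst powr_mult) (auto simp: sq A_def)
      also have "(r\<^sup>2 * L) powr (a - 1) = r powr A * L powr (a - 1)"
        using r L by (subst powr_mult) (auto simp: sq A_def)
      finally have 3: "g r powr (a - 1) = x powr A * (r\<^sup>2 - s\<^sup>2) powr (a - 1) * r powr (- A) * L powr (- (a - 1))"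
        unfolding powr_minus by (simp add: divide_inverse)
      have "(1 - g r) powr (b - 1) = (s\<^sup>2 * (x\<^sup>2 - r\<^sup>2)) powr (b - 1) / (r\<^sup>2 * L) powr (b - 1)"
        unfolding 2 using r L by (simp add: powr_divide)
      also have "(s\<^sup>2 * (x\<^sup>2 - r\<^sup>2)) powr (b - 1) = s powr B * (x\<^sup>2 - r\<^sup>2) powr (b - 1)"
        using r x by (subst powr_mult) (auto simp: sq B_def)
      also have "(r\<^sup>2 * L) powr (b - 1) = r powr B * L powr (b - 1)"
        using r L by (subst powr_mult) (auto simp: sq B_def)
      finally have 4: "(1 - g r) powr (b - 1) = s powr B * (x\<^sup>2 - r\<^sup>2) powr (b - 1) * r powr (- B) * L powr (- (b - 1))"
        unfolding powr_minus by (simp add: divide_inverse)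
      have 5: "g' r = x powr 2 * L powr (-1) * 2 * s powr 2 * r powr (-3)"
        using r L x x0 by (simp add: g'_def powr_minus powr_numeral field_simps)
      have "c * (g r powr (a - 1) * (1 - g r) powr (b - 1) * g' r) =
         (r\<^sup>2 - s\<^sup>2) powr (a - 1) * (x\<^sup>2 - r\<^sup>2) powr (b - 1) * 2 *
         (L powr (a + b - 1) * L powr (- (a - 1)) * L powr (- (b - 1)) * L powr (- 1)) *
         (s powr (- 2 * b) * s powr B * s powr 2) *
         (x powr (- 2 * a) * x powr A * x powr 2) *
         (r powr (- A) * r powr (- B) * r powr (- 3))"
        unfolding 3 4 5 c_def by (simp only: mult_ac)
      also have "L powr (a + b - 1) * L powr (- (a - 1)) * L powr (- (b - 1)) * L powr (- 1) = 1"
        unfolding powr_add[symmetric] using L by simp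
      also have "s powr (- 2 * b) * s powr B * s powr 2 = 1"
        unfolding powr_add[symmetric] B_def using x by simp
      also have "x powr (- 2 * a) * x powr A * x powr 2 = 1"
        unfolding powr_add[symmetric] A_def using x0 by simp
      also have "r powr (- A) * r powr (- B) * r powr (- 3) = r powr (- 2 * a - 2 * b) * r powr 1"
        unfolding powr_add[symmetric] A_def B_def by (rule arg_cong[of _ _ "\<lambda>z. r powr z"]) simp
      finally have "c * (g r powr (a - 1) * (1 - g r) powr (b - 1) * g' r) =
        (r\<^sup>2 - s\<^sup>2) powr (a - 1) * (x\<^sup>2 - r\<^sup>2) powr (b - 1) * r powr (- 2 * a - 2 * b) * (2 * r)"
        using r by simp
      then show ?thesis using True by (simp add: ennreal_mult'[symmetric] c_def)
    qed simp
  qed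
  also have "\<dots> = ennreal c * ennreal (Beta a b)"
    unfolding B by (rule nn_integral_cmult) (simp add: g_def g'_def)
  also have "\<dots> = ennreal (Beta a b * L powr (a + b - 1) * s powr (- 2 * b) * x powr (- 2 * a))"
    by (simp add: ennreal_mult''[symmetric] mult.commute[of "ennreal c"] c0) (simp add: c_def mult_ac)
  finally show ?thesis by (simp add: L_def)
qed

text \<open>Kernels of \<open>I\<^sup>\<alpha>\<^sub>+\<^sub>,\<^sub>2\<close> and \<open>I\<^sup>\<alpha>\<^sub>-\<^sub>,\<^sub>2\<close>, extended by zero so that both become
  integral operators over \<open>lborel\<close>.\<close>

definition ekp :: "real \<Rightarrow> real \<Rightarrow> real \<Rightarrow> real" where
  "ekp a s r = (if 0 < r \<and> r < s then 2 / Gamma a * (s\<^sup>2 - r\<^sup>2) powr (a - 1) * r else 0)"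

definition ekm :: "real \<Rightarrow> real \<Rightarrow> real \<Rightarrow> real" where
  "ekm a t r = (if 0 \<le> t \<and> t < r then 2 / Gamma a * (r\<^sup>2 - t\<^sup>2) powr (a - 1) * r else 0)"

lemma ekm_measurable[measurable]: "(\<lambda>(s, r). ekm a s r) \<in> borel_measurable (borel \<Otimes>\<^sub>M borel)"
  unfolding ekm_def by measurable

lemma ekp_measurable'[measurable]:
  assumes [measurable]: "f \<in> borel_measurable M" "h \<in> borel_measurable M"
  shows "(\<lambda>x. ekp a (f x) (h x)) \<in> borel_measurable M"
  unfolding ekp_def by measurable

lemma ekm_measurable'[measurable]:
  assumes [measurable]: "f \<in> borel_measurable M" "h \<in> borel_measurable M"
  shows "(\<lambda>x. ekm a (f x) (h x)) \<in> borel_measurable M"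
  unfolding ekm_def by measurable

lemma borel_measurable_power_int[measurable]:
  fixes f :: "'a \<Rightarrow> real"
  assumes [measurable]: "f \<in> borel_measurable M"
  shows "(\<lambda>x. f x powi m) \<in> borel_measurable M"
  unfolding power_int_def by measurable

lemma ekp_nonneg[simp]: "0 < a \<Longrightarrow> 0 \<le> ekp a s r"
  by (simp add: ekp_def Gamma_real_pos less_imp_le)

lemma ekm_nonneg[simp]: "0 < a \<Longrightarrow> 0 \<le> ekm a s r"
  by (simp add: ekm_def Gamma_real_pos less_imp_le)

text \<open>The identity Beta a b = Gamma a Gamma b / Gamma (a + b) cancels the normalizations. In
  the form of a nonnegative integral the law is free of convergence conditions and can feed
  Tonelli's theorem.\<close>

lemma ekp_semigroup:
  assumes ab: "0 < a" "0 < b"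
  shows "(\<integral>\<^sup>+r. ennreal (ekp a s r * ekp b r x) \<partial>lborel) = ennreal (ekp (a + b) s x)"
proof (cases "0 < x \<and> x < s")
  case True
  have G: "Gamma a > 0" "Gamma b > 0" "Gamma (a + b) > 0" using ab by (auto intro!: Gamma_real_pos)
  have "(\<integral>\<^sup>+r. ennreal (ekp a s r * ekp b r x) \<partial>lborel) =
    (\<integral>\<^sup>+r. ennreal (2 / Gamma a / Gamma b * x) * ennreal ((s\<^sup>2 - r\<^sup>2) powr (a - 1) * (r\<^sup>2 - x\<^sup>2) powr (b - 1) * (2 * r) * indicator {x..s} r) \<partial>lborel)"
  proof (rule nn_integral_cong_AE)
    have "AE r in lborel. r \<noteq> x" "AE r in lborel. r \<noteq> s" by (rule AE_lborel_singleton)+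
    then show "AE r in lborel. ennreal (ekp a s r * ekp b r x) = ennreal (2 / Gamma a / Gamma b * x) * ennreal ((s\<^sup>2 - r\<^sup>2) powr (a - 1) * (r\<^sup>2 - x\<^sup>2) powr (b - 1) * (2 * r) * indicator {x..s} r)"
      by eventually_elim (use True G in \<open>auto simp: ekp_def indicator_def ennreal_mult'[symmetric] ac_simps\<close>)
  qed
  also have "\<dots> = ennreal (2 / Gamma a / Gamma b * x) * ennreal (Beta a b * (s\<^sup>2 - x\<^sup>2) powr (a + b - 1))"
    by (subst nn_integral_cmult) (use True ab in \<open>auto simp: beta_integral_squares\<close>)
  also have "\<dots> = ennreal (ekp (a + b) s x)"
    using True G by (simp add: ennreal_mult'[symmetric] ekp_def Beta_def)
  finally show ?thesis .
next
  case False
  then have z: "ennreal (ekp a s r * ekp b r x) = 0" for r by (auto simp: ekp_def)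
  have "ekp (a + b) s x = 0" using False by (auto simp: ekp_def)
  then show ?thesis by (simp only: z) simp
qed

lemma ekm_semigroup:
  assumes ab: "0 < a" "0 < b"
  shows "(\<integral>\<^sup>+r. ennreal (ekm a t r * ekm b r x) \<partial>lborel) = ennreal (ekm (a + b) t x)"
proof (cases "0 \<le> t \<and> t < x")
  case True
  have G: "Gamma a > 0" "Gamma b > 0" "Gamma (a + b) > 0" using ab by (auto intro!: Gamma_real_pos)
  have "(\<integral>\<^sup>+r. ennreal (ekm a t r * ekm b r x) \<partial>lborel) =
    (\<integral>\<^sup>+r. ennreal (2 / Gamma a / Gamma b * x) * ennreal ((x\<^sup>2 - r\<^sup>2) powr (b - 1) * (r\<^sup>2 - t\<^sup>2) powr (a - 1) * (2 * r) * indicator {t..x} r) \<partial>lborel)"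
  proof (rule nn_integral_cong_AE)
    have "AE r in lborel. r \<noteq> x" "AE r in lborel. r \<noteq> t" by (rule AE_lborel_singleton)+
    then show "AE r in lborel. ennreal (ekm a t r * ekm b r x) = ennreal (2 / Gamma a / Gamma b * x) * ennreal ((x\<^sup>2 - r\<^sup>2) powr (b - 1) * (r\<^sup>2 - t\<^sup>2) powr (a - 1) * (2 * r) * indicator {t..x} r)"
      by eventually_elim (use True G in \<open>auto simp: ekm_def indicator_def ennreal_mult'[symmetric] ac_simps\<close>)
  qed
  also have "\<dots> = ennreal (2 / Gamma a / Gamma b * x) * ennreal (Beta b a * (x\<^sup>2 - t\<^sup>2) powr (b + a - 1))"
    by (subst nn_integral_cmult) (use True ab in \<open>auto simp: beta_integral_squares\<close>)
  also have "\<dots> = ennreal (ekm (a + b) t x)"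
    using True G by (simp add: ennreal_mult'[symmetric] ekm_def Beta_def ac_simps)
  finally show ?thesis .
next
  case False
  then have z: "ennreal (ekm a t r * ekm b r x) = 0" for r by (auto simp: ekm_def)
  have "ekm (a + b) t x = 0" using False by (auto simp: ekm_def)
  then show ?thesis by (simp only: z) simp
qed

text \<open>With a = 1/2 and b = k/2 the weight is r^(-k-1), the one in the derivative for odd k.
  The weighted composition is again a fractional integral, of the integer order (k+1)/2, between the
  powers t^(-k) and x^(-1).\<close>

lemma ekm_weighted_semigroup:
  assumes ab: "0 < a" "0 < b" and t: "0 < t"
  shows "(\<integral>\<^sup>+r. ennreal (ekm a t r * r powr (- 2 * a - 2 * b) * ekm b r x) \<partial>lborel)
    = ennreal (t powr (- 2 * b) * x powr (- 2 * a) * ekm (a + b) t x)"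
proof (cases "t < x")
  case True
  have G: "Gamma a > 0" "Gamma b > 0" "Gamma (a + b) > 0" using ab by (auto intro!: Gamma_real_pos)
  have "(\<integral>\<^sup>+r. ennreal (ekm a t r * r powr (- 2 * a - 2 * b) * ekm b r x) \<partial>lborel) =
    (\<integral>\<^sup>+r. ennreal (2 / Gamma a / Gamma b * x) * ennreal ((r\<^sup>2 - t\<^sup>2) powr (a - 1) * (x\<^sup>2 - r\<^sup>2) powr (b - 1) * r powr (- 2 * a - 2 * b) * (2 * r) * indicator {t..x} r) \<partial>lborel)"
  proof (rule nn_integral_cong_AE)
    have "AE r in lborel. r \<noteq> x" "AE r in lborel. r \<noteq> t" by (rule AE_lborel_singleton)+
    then show "AE r in lborel. ennreal (ekm a t r * r powr (- 2 * a - 2 * b) * ekm b r x) = ennreal (2 / Gamma a / Gamma b * x) * ennreal ((r\<^sup>2 - t\<^sup>2) powr (a - 1) * (x\<^sup>2 - r\<^sup>2) powr (b - 1) * r powr (- 2 * a - 2 * b) * (2 * r) * indicator {t..x} r)"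
      by eventually_elim (use True G t in \<open>auto simp: ekm_def indicator_def ennreal_mult'[symmetric] ac_simps\<close>)
  qed
  also have "\<dots> = ennreal (2 / Gamma a / Gamma b * x) * ennreal (Beta a b * (x\<^sup>2 - t\<^sup>2) powr (a + b - 1) * t powr (- 2 * b) * x powr (- 2 * a))"
    by (subst nn_integral_cmult, simp, subst beta_integral_inverted[OF ab t True], rule refl)
  also have "\<dots> = ennreal (t powr (- 2 * b) * x powr (- 2 * a) * ekm (a + b) t x)"
    using True G t by (simp add: ennreal_mult'[symmetric] ekm_def Beta_def ac_simps)
  finally show ?thesis .
next
  case False
  then have z: "ennreal (ekm a t r * r powr (- 2 * a - 2 * b) * ekm b r x) = 0" for r by (auto simp: ekm_def)
  have "ekm (a + b) t x = 0" using False by (auto simp: ekm_def)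
  then show ?thesis by (simp only: z) simp
qed

text \<open>Composition of integral operators. The kernels are nonnegative, so finiteness of the
  single integral of k3 |g| is absolute integrability of the double integral; the inner integral may
  still diverge for a null set of r.\<close>

lemma kernel_fubini:
  fixes k1 k3 g :: "real \<Rightarrow> real" and k2 :: "real \<Rightarrow> real \<Rightarrow> real"
  assumes [measurable]: "k1 \<in> borel_measurable borel" "(\<lambda>(r, x). k2 r x) \<in> borel_measurable (borel \<Otimes>\<^sub>M borel)"
      "g \<in> borel_measurable borel" "k3 \<in> borel_measurable borel"
    and nn: "\<And>r. 0 \<le> k1 r" "\<And>r x. 0 \<le> k2 r x" "\<And>x. 0 \<le> k3 x"
    and comp: "\<And>x. (\<integral>\<^sup>+r. ennreal (k1 r * k2 r x) \<partial>lborel) = ennreal (k3 x)"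
    and fin: "(\<integral>\<^sup>+x. ennreal (k3 x * \<bar>g x\<bar>) \<partial>lborel) < \<infinity>"
  shows "integrable lborel (\<lambda>r. k1 r * (LINT x|lborel. k2 r x * g x))"
    and "integrable lborel (\<lambda>x. k3 x * g x)"
    and "(LINT r|lborel. k1 r * (LINT x|lborel. k2 r x * g x)) = (LINT x|lborel. k3 x * g x)"
proof -
  let ?h = "\<lambda>(r, x). k1 r * k2 r x * g x"
  have m[measurable]: "?h \<in> borel_measurable (lborel \<Otimes>\<^sub>M lborel)" by measurable
  have k3: "(LINT r|lborel. k1 r * k2 r x * g x) = k3 x * g x" for x
  proof -
    have "(LINT r|lborel. k1 r * k2 r x) = k3 x"
      by (rule integral_eq_nn_integral[THEN trans]) (use nn comp in auto)
    then show ?thesis by simp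
  qed
  have I: "integrable (lborel \<Otimes>\<^sub>M lborel) ?h"
  proof (rule integrableI_bounded)
    have "(\<integral>\<^sup>+z. ennreal (norm (?h z)) \<partial>(lborel \<Otimes>\<^sub>M lborel)) =
      (\<integral>\<^sup>+x. \<integral>\<^sup>+r. ennreal (norm (?h (r, x))) \<partial>lborel \<partial>lborel)"
      by (subst lborel_pair.nn_integral_snd[symmetric]) auto
    also have "\<dots> = (\<integral>\<^sup>+x. ennreal (k3 x * \<bar>g x\<bar>) \<partial>lborel)"
    proof (rule nn_integral_cong)
      fix x
      have "(\<integral>\<^sup>+r. ennreal (norm (?h (r, x))) \<partial>lborel) = (\<integral>\<^sup>+r. ennreal (k1 r * k2 r x) * ennreal \<bar>g x\<bar> \<partial>lborel)"
        using nn by (intro nn_integral_cong) (simp add: abs_mult ennreal_mult'[symmetric])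
      also have "\<dots> = ennreal (k3 x * \<bar>g x\<bar>)"
        by (subst nn_integral_multc, simp, unfold comp, simp add: ennreal_mult' nn)
      finally show "(\<integral>\<^sup>+r. ennreal (norm (?h (r, x))) \<partial>lborel) = ennreal (k3 x * \<bar>g x\<bar>)" .
    qed
    finally show "(\<integral>\<^sup>+z. ennreal (norm (?h z)) \<partial>(lborel \<Otimes>\<^sub>M lborel)) < \<infinity>" using fin by simp
  qed (rule m)
  show "integrable lborel (\<lambda>x. k3 x * g x)"
    using lborel_pair.integrable_snd[OF I] unfolding prod.case k3 .
  have "integrable lborel (\<lambda>r. LINT x|lborel. k1 r * k2 r x * g x)"
    using lborel_pair.integrable_fst'[OF I] by simp
  then show "integrable lborel (\<lambda>r. k1 r * (LINT x|lborel. k2 r x * g x))"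
    by (simp add: mult.assoc)
  have "(LINT r|lborel. LINT x|lborel. k1 r * k2 r x * g x) = (LINT x|lborel. LINT r|lborel. k1 r * k2 r x * g x)"
    using lborel_pair.Fubini_integral[OF I] by simp
  then show "(LINT r|lborel. k1 r * (LINT x|lborel. k2 r x * g x)) = (LINT x|lborel. k3 x * g x)"
    unfolding k3 by (simp add: mult.assoc)
qed

section \<open>Derivatives of Erdelyi-Kober integrals\<close>

text \<open>Carries integrals from a Borel function to one that agrees with it almost everywhere but
  need not be Borel, as happens when the profile or a derivative enters the integrand.\<close>

lemma lebesgue_integral_cong_AE_lborel:
  fixes f h :: "real \<Rightarrow> real"
  assumes f: "integrable lborel f" and eq: "AE x in lborel. f x = h x"
  shows "integrable lebesgue h" "integral\<^sup>L lebesgue h = integral\<^sup>L lborel f"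
proof -
  have fm: "f \<in> borel_measurable borel" using f by auto
  have fl: "integrable lebesgue f" using f fm by (simp add: integrable_completion)
  then have fm': "f \<in> borel_measurable lebesgue" by auto
  have hm: "h \<in> borel_measurable lebesgue"
    by (rule measurable_completion_cong_AE[OF fm' eq]) simp
  have eq': "AE x in lebesgue. f x = h x" using eq by (rule AE_completion)
  show "integrable lebesgue h"
    using fl by (rule integrable_cong_AE_imp) (use hm eq' in \<open>auto elim: eventually_mono\<close>)
  have "integral\<^sup>L lebesgue h = integral\<^sup>L lebesgue f"
    by (rule integral_cong_AE) (use hm fm' eq' in \<open>auto elim: eventually_mono\<close>)
  also have "\<dots> = integral\<^sup>L lborel f" using fm by (simp add: integral_completion)
  finally show "integral\<^sup>L lebesgue h = integral\<^sup>L lborel f" .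
qed

section \<open>Primitives on the positive half line\<close>

context
  fixes H \<psi> :: "real \<Rightarrow> real"
  assumes int: "\<And>c t. 0 < c \<Longrightarrow> c \<le> t \<Longrightarrow> set_integrable lborel {c..t} \<psi>"
    and H: "\<And>c t. 0 < c \<Longrightarrow> c \<le> t \<Longrightarrow> H t - H c = (LINT r:{c..t}|lborel. \<psi> r)"
begin

lemma primitive_eq: "0 < c \<Longrightarrow> c \<le> t \<Longrightarrow> H t = H c + integral {c..t} \<psi>"
  using H[of c t] set_borel_integral_eq_integral(2)[OF int[of c t]] by simp

lemma primitive_continuous: "continuous_on {0<..} H"
proof -
  have "isCont H t" if t: "0 < t" for t
  proof -
    have "continuous_on {t/2..t+1} (\<lambda>x. H (t/2) + integral {t/2..x} \<psi>)"
      using t by (intro continuous_intros indefinite_integral_continuous_1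
          set_borel_integral_eq_integral(1) int) auto
    then have "continuous_on {t/2..t+1} H"
      using t by (subst continuous_on_cong[OF refl primitive_eq[of "t/2"]]) auto
    then show ?thesis using t by (intro continuous_on_interior[of "{t/2..t+1}"]) auto
  qed
  then show ?thesis by (intro continuous_at_imp_continuous_on) auto
qed

lemma primitive_has_derivative:
  assumes cont: "continuous_on {0<..} \<psi>" and t: "0 < t"
  shows "(H has_real_derivative \<psi> t) (at t)"
proof -
  have "((\<lambda>x. integral {t/2..x} \<psi>) has_real_derivative \<psi> t) (at t within {t/2..t+1})"
    using t by (intro integral_has_real_derivative continuous_on_subset[OF cont]) auto
  then have "((\<lambda>x. integral {t/2..x} \<psi>) has_real_derivative \<psi> t) (at t)"
    using t by (simp add: at_within_Icc_at)
  then have "((\<lambda>x. H (t/2) + integral {t/2..x} \<psi>) has_real_derivative \<psi> t) (at t)"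
    by (auto intro!: derivative_eq_intros)
  then show ?thesis
  proof (rule has_field_derivative_transform_within_open)
    show "open {t/2<..}" "t \<in> {t/2<..}" using t by auto
    show "H (t/2) + integral {t/2..x} \<psi> = H x" if "x \<in> {t/2<..}" for x
      using primitive_eq[of "t/2" x] t that by simp
  qed
qed

lemma primitive_has_derivative_AE: "AE t in lebesgue. 0 < t \<longrightarrow> (H has_real_derivative \<psi> t) (at t)"
proof -
  have "AE t in lebesgue. 1 / Suc N < t \<and> t < Suc N \<longrightarrow> (H has_real_derivative \<psi> t) (at t)" for N :: nat
  proof -
    define c where "c = 1 / real (Suc N)"
    define d where "d = real (Suc N)"
    have c: "0 < c" "c \<le> d" by (auto simp: c_def d_def field_simps)
    \<comment> \<open>Integrability is known on compact subintervals of the half line; cutting off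
      to one of them gives a globally integrable function with the same primitive inside, up to a
      constant.\<close>
    define G where "G = (\<lambda>t. indicator {c..d} t * \<psi> t)"
    have G: "integrable lborel G" using int[OF c] by (simp add: set_integrable_def G_def)
    define F where "F = (\<lambda>x. LINT r:{..x}|lborel. G r)"
    have "AE t in lebesgue. (F has_real_derivative G t) (at t)"
      using lebesgue_differentiation[OF G] by (simp add: F_def)
    then show ?thesis
    proof (rule eventually_mono)
      fix t assume D: "(F has_real_derivative G t) (at t)"
      show "1 / Suc N < t \<and> t < Suc N \<longrightarrow> (H has_real_derivative \<psi> t) (at t)"
      proof
        assume "1 / Suc N < t \<and> t < Suc N"
        then have t: "c < t" "t < d" by (auto simp: c_def d_def)
        have "((\<lambda>x. H c + (F x - F c)) has_real_derivative \<psi> t) (at t)"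
          using D t by (auto intro!: derivative_eq_intros simp: G_def)
        then show "(H has_real_derivative \<psi> t) (at t)"
        proof (rule has_field_derivative_transform_within_open)
          show "open {c<..<d}" "t \<in> {c<..<d}" using t by auto
          show "H c + (F x - F c) = H x" if x: "x \<in> {c<..<d}" for x
          proof -
            have "F x - F c = (LINT r:{c<..x}|lborel. G r)"
              unfolding F_def by (rule set_lborel_integral_diff[OF G]) (use x in auto)
            also have "\<dots> = (LINT r:{c..x}|lborel. \<psi> r)"
              unfolding set_lebesgue_integral_def
            proof (rule integral_cong_AE)
              have "AE r in lborel. r \<noteq> c" by (rule AE_lborel_singleton)
              then show "AE r in lborel. indicat_real {c<..x} r *\<^sub>R G r = indicat_real {c..x} r *\<^sub>R \<psi> r"
                by eventually_elim (use x in \<open>auto simp: G_def indicator_def\<close>)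
              show "(\<lambda>r. indicat_real {c<..x} r *\<^sub>R G r) \<in> borel_measurable lborel" using G by auto
              show "(\<lambda>r. indicat_real {c..x} r *\<^sub>R \<psi> r) \<in> borel_measurable lborel"
                using int[of c x] c x unfolding set_integrable_def by auto
            qed
            also have "\<dots> = H x - H c" using H[of c x] c x by simp
            finally show ?thesis by simp
          qed
        qed
      qed
    qed
  qed
  then have "AE t in lebesgue. \<forall>N::nat. 1 / Suc N < t \<and> t < Suc N \<longrightarrow> (H has_real_derivative \<psi> t) (at t)"
    unfolding AE_all_countable by blast
  then show ?thesis
  proof (rule eventually_mono)
    fix t :: real
    assume *: "\<forall>N::nat. 1 / Suc N < t \<and> t < Suc N \<longrightarrow> (H has_real_derivative \<psi> t) (at t)"
    show "0 < t \<longrightarrow> (H has_real_derivative \<psi> t) (at t)"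
    proof
      assume t: "0 < t"
      obtain N1 :: nat where N1: "1 / Suc N1 < t" using nat_approx_posE[OF t] by blast
      obtain N2 :: nat where N2: "t < real N2" using reals_Archimedean2 by blast
      define N where "N = max N1 N2"
      have "1 / Suc N \<le> 1 / Suc N1" by (simp add: N_def frac_le)
      moreover have "real N2 \<le> Suc N" by (simp add: N_def)
      ultimately show "(H has_real_derivative \<psi> t) (at t)" using * N1 N2 by (meson le_less_trans less_le_trans)
    qed
  qed
qed

end

section \<open>Integrals of order one as primitives\<close>

lemma ekm_1: "ekm 1 t r = (if 0 \<le> t \<and> t < r then 2 * r else 0)"
proof -
  have "0 \<le> t \<Longrightarrow> t < r \<Longrightarrow> r\<^sup>2 - t\<^sup>2 > 0" by (simp add: power_strict_mono)
  then show ?thesis by (auto simp: ekm_def)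
qed

lemma ekp_1: "ekp 1 s r = (if 0 < r \<and> r < s then 2 * r else 0)"
proof -
  have "0 < r \<Longrightarrow> r < s \<Longrightarrow> s\<^sup>2 - r\<^sup>2 > 0" by (simp add: power_strict_mono)
  then show ?thesis by (auto simp: ekp_def)
qed

lemma ekm_1_primitive:
  assumes G: "\<And>t. 0 < t \<Longrightarrow> integrable lborel (\<lambda>r. ekm 1 t r * G r)" and c: "0 < c" "c \<le> t"
  shows "set_integrable lborel {c..t} (\<lambda>r. - (2 * r * G r))"
    and "(LINT r|lborel. ekm 1 t r * G r) - (LINT r|lborel. ekm 1 c r * G r) = (LINT r:{c..t}|lborel. - (2 * r * G r))"
proof -
  have t: "0 < t" using c by simp
  have I: "integrable lborel (\<lambda>r. indicator {c/2<..t} r * (ekm 1 (c/2) r * G r))"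
    using G[of "c/2"] c by (intro integrable_indicator_times) auto
  \<comment> \<open>The kernel based at c vanishes at r = c itself; based at c/2 it equals 2r on all
    of {c..t}.\<close>
  have I': "integrable lborel (\<lambda>r. - (indicator {c..t} r * (ekm 1 (c/2) r * G r)))"
    using G[of "c/2"] c by (intro integrable_minus integrable_indicator_times) auto
  have e: "indicator {c..t} r * - (2 * r * G r) = - (indicator {c..t} r * (ekm 1 (c/2) r * G r))" for r
    using c by (auto simp: ekm_1 indicator_def)
  show S: "set_integrable lborel {c..t} (\<lambda>r. - (2 * r * G r))"
    unfolding set_integrable_def real_scaleR_def e by (rule I')
  have "(LINT r|lborel. ekm 1 t r * G r) - (LINT r|lborel. ekm 1 c r * G r)
    = (LINT r|lborel. ekm 1 t r * G r - ekm 1 c r * G r)"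
    using G c t by (intro Bochner_Integration.integral_diff[symmetric]) auto
  also have "\<dots> = (LINT r:{c..t}|lborel. - (2 * r * G r))"
    unfolding set_lebesgue_integral_def
  proof (rule integral_cong_AE)
    have "AE r in lborel. r \<noteq> c" by (rule AE_lborel_singleton)
    then show "AE r in lborel. ekm 1 t r * G r - ekm 1 c r * G r = indicat_real {c..t} r *\<^sub>R - (2 * r * G r)"
      by eventually_elim (use c in \<open>auto simp: ekm_1 indicator_def\<close>)
    show "(\<lambda>r. ekm 1 t r * G r - ekm 1 c r * G r) \<in> borel_measurable lborel"
      using G[OF t] G[OF c(1)] by (intro borel_measurable_diff) auto
    show "(\<lambda>r. indicat_real {c..t} r *\<^sub>R - (2 * r * G r)) \<in> borel_measurable lborel"
      using S unfolding set_integrable_def by auto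
  qed
  finally show "(LINT r|lborel. ekm 1 t r * G r) - (LINT r|lborel. ekm 1 c r * G r) = (LINT r:{c..t}|lborel. - (2 * r * G r))" .
qed

lemma ekp_1_primitive:
  assumes G: "\<And>t. 0 < t \<Longrightarrow> integrable lborel (\<lambda>r. ekp 1 t r * G r)" and c: "0 < c" "c \<le> t"
  shows "set_integrable lborel {c..t} (\<lambda>r. 2 * r * G r)"
    and "(LINT r|lborel. ekp 1 t r * G r) - (LINT r|lborel. ekp 1 c r * G r) = (LINT r:{c..t}|lborel. 2 * r * G r)"
proof -
  have t: "0 < t" using c by simp
  \<comment> \<open>The kernel with endpoint t vanishes at r = t; the endpoint t + 1 lies beyond the
    closed interval.\<close>
  have I: "integrable lborel (\<lambda>r. indicator {c..t} r * (ekp 1 (t+1) r * G r))"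
    using G[of "t+1"] t by (intro integrable_indicator_times) auto
  have e: "indicator {c..t} r * (2 * r * G r) = indicator {c..t} r * (ekp 1 (t+1) r * G r)" for r
    using c by (auto simp: ekp_1 indicator_def)
  show S: "set_integrable lborel {c..t} (\<lambda>r. 2 * r * G r)"
    unfolding set_integrable_def real_scaleR_def e by (rule I)
  have "(LINT r|lborel. ekp 1 t r * G r) - (LINT r|lborel. ekp 1 c r * G r)
    = (LINT r|lborel. ekp 1 t r * G r - ekp 1 c r * G r)"
    using G c t by (intro Bochner_Integration.integral_diff[symmetric]) auto
  also have "\<dots> = (LINT r:{c..t}|lborel. 2 * r * G r)"
    unfolding set_lebesgue_integral_def
  proof (rule integral_cong_AE)
    have "AE r in lborel. r \<noteq> t" by (rule AE_lborel_singleton)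
    then show "AE r in lborel. ekp 1 t r * G r - ekp 1 c r * G r = indicat_real {c..t} r *\<^sub>R (2 * r * G r)"
      by eventually_elim (use c in \<open>auto simp: ekp_1 indicator_def\<close>)
    show "(\<lambda>r. ekp 1 t r * G r - ekp 1 c r * G r) \<in> borel_measurable lborel"
      using G[OF t] G[OF c(1)] by (intro borel_measurable_diff) auto
    show "(\<lambda>r. indicat_real {c..t} r *\<^sub>R (2 * r * G r)) \<in> borel_measurable lborel"
      using S unfolding set_integrable_def by auto
  qed
  finally show "(LINT r|lborel. ekp 1 t r * G r) - (LINT r|lborel. ekp 1 c r * G r) = (LINT r:{c..t}|lborel. 2 * r * G r)" .
qed

lemma ekm_1_integral:
  assumes G: "\<And>t. 0 < t \<Longrightarrow> integrable lborel (\<lambda>r. ekm 1 t r * G r)"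
  shows "continuous_on {0<..} (\<lambda>t. LINT r|lborel. ekm 1 t r * G r)"
    and "AE t in lebesgue. 0 < t \<longrightarrow> ((\<lambda>t. LINT r|lborel. ekm 1 t r * G r) has_real_derivative - (2 * t * G t)) (at t)"
    and "continuous_on {0<..} G \<Longrightarrow> 0 < t \<Longrightarrow> ((\<lambda>t. LINT r|lborel. ekm 1 t r * G r) has_real_derivative - (2 * t * G t)) (at t)"
proof -
  show "continuous_on {0<..} (\<lambda>t. LINT r|lborel. ekm 1 t r * G r)"
    by (rule primitive_continuous[OF ekm_1_primitive[OF G]])
  show "AE t in lebesgue. 0 < t \<longrightarrow> ((\<lambda>t. LINT r|lborel. ekm 1 t r * G r) has_real_derivative - (2 * t * G t)) (at t)"
    by (rule primitive_has_derivative_AE[OF ekm_1_primitive[OF G]])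
  show "((\<lambda>t. LINT r|lborel. ekm 1 t r * G r) has_real_derivative - (2 * t * G t)) (at t)" if "continuous_on {0<..} G" "0 < t"
    by (rule primitive_has_derivative[OF ekm_1_primitive[OF G]]) (use that in \<open>auto intro!: continuous_intros\<close>)
qed

lemma ekp_1_integral:
  assumes G: "\<And>t. 0 < t \<Longrightarrow> integrable lborel (\<lambda>r. ekp 1 t r * G r)"
  shows "continuous_on {0<..} (\<lambda>t. LINT r|lborel. ekp 1 t r * G r)"
    and "AE t in lebesgue. 0 < t \<longrightarrow> ((\<lambda>t. LINT r|lborel. ekp 1 t r * G r) has_real_derivative 2 * t * G t) (at t)"
    and "continuous_on {0<..} G \<Longrightarrow> 0 < t \<Longrightarrow> ((\<lambda>t. LINT r|lborel. ekp 1 t r * G r) has_real_derivative 2 * t * G t) (at t)"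
proof -
  show "continuous_on {0<..} (\<lambda>t. LINT r|lborel. ekp 1 t r * G r)"
    by (rule primitive_continuous[OF ekp_1_primitive[OF G]])
  show "AE t in lebesgue. 0 < t \<longrightarrow> ((\<lambda>t. LINT r|lborel. ekp 1 t r * G r) has_real_derivative 2 * t * G t) (at t)"
    by (rule primitive_has_derivative_AE[OF ekp_1_primitive[OF G]])
  show "((\<lambda>t. LINT r|lborel. ekp 1 t r * G r) has_real_derivative 2 * t * G t) (at t)" if "continuous_on {0<..} G" "0 < t"
    by (rule primitive_has_derivative[OF ekp_1_primitive[OF G]]) (use that in \<open>auto intro!: continuous_intros\<close>)
qed

text \<open>The sign \<sigma> lets one lemma serve left-sided integrals (+1) and right-sided ones
  (-1). The factorization of F is known for positive arguments, so the derivative is transferred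
  within the open half line.\<close>

lemma ek_step:
  assumes F: "\<And>r. 0 < r \<Longrightarrow> F r = k * h r" and h: "(h has_real_derivative \<sigma> * (2 * t * y)) (at t)" and t: "0 < t"
  shows "F differentiable (at t)" "ek_D F t = k * (\<sigma> * y)" "ek_neg_D F t = - (k * (\<sigma> * y))"
proof -
  have "((\<lambda>r. k * h r) has_real_derivative k * (\<sigma> * (2 * t * y))) (at t)"
    using h by (auto intro!: derivative_eq_intros)
  then have D: "(F has_real_derivative k * (\<sigma> * (2 * t * y))) (at t)"
    by (rule has_field_derivative_transform_within_open[of _ _ _ "{0<..}"]) (use t F in auto)
  then show "F differentiable (at t)" using real_differentiable_def by blast
  show "ek_D F t = k * (\<sigma> * y)" using t DERIV_imp_deriv[OF D] by (simp add: ek_D_def)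
  then show "ek_neg_D F t = - (k * (\<sigma> * y))" by (simp add: ek_neg_D_def)
qed

lemma ek_chain:
  assumes der: "\<And>i t. i < M \<Longrightarrow> 0 < t \<Longrightarrow> (H i has_real_derivative \<sigma> * (2 * t * H (Suc i) t)) (at t)"
    and eq: "\<And>t. 0 < t \<Longrightarrow> \<phi> t = H 0 t" and t: "0 < t" and i: "i \<le> M"
  shows "ek_differentiable i \<phi> t \<and> (ek_D ^^ i) \<phi> t = \<sigma> ^ i * H i t \<and> (ek_neg_D ^^ i) \<phi> t = (- \<sigma>) ^ i * H i t"
  using i t
proof (induction i arbitrary: t)
  case 0
  then show ?case using eq by simp
next
  case (Suc i)
  have IH: "ek_differentiable i \<phi> r" "(ek_D ^^ i) \<phi> r = \<sigma> ^ i * H i r" "(ek_neg_D ^^ i) \<phi> r = (- \<sigma>) ^ i * H i r"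
    if "0 < r" for r using Suc.IH[of r] Suc.prems that by auto
  have d: "(H i has_real_derivative \<sigma> * (2 * t * H (Suc i) t)) (at t)" using der Suc.prems by auto
  have ev: "\<forall>\<^sub>F r in nhds t. ek_differentiable i \<phi> r"
    using eventually_nhds_in_open[of "{0<..}" t] Suc.prems IH(1) by (auto elim: eventually_mono)
  show ?case
    using ev ek_step[of "(ek_D ^^ i) \<phi>", OF IH(2) d Suc.prems(2)] ek_step[of "(ek_neg_D ^^ i) \<phi>", OF IH(3) d Suc.prems(2)]
    by simp
qed

text \<open>The last derivative is assumed at the single point t, the earlier ones on the half line.
  This is the pattern of \<open>ek_differentiable\<close>: all differentiations but the last near t,
  the last one at t.\<close>

lemma ek_chain_top:
  assumes der: "\<And>i t. i < M \<Longrightarrow> 0 < t \<Longrightarrow> (H i has_real_derivative \<sigma> * (2 * t * H (Suc i) t)) (at t)"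
    and eq: "\<And>t. 0 < t \<Longrightarrow> \<phi> t = H 0 t" and t: "0 < t"
    and top: "(H M has_real_derivative \<sigma> * (2 * t * y)) (at t)"
  shows "ek_differentiable (Suc M) \<phi> t" "(ek_D ^^ Suc M) \<phi> t = \<sigma> ^ Suc M * y" "(ek_neg_D ^^ Suc M) \<phi> t = (- \<sigma>) ^ Suc M * y"
proof -
  have c: "ek_differentiable M \<phi> r" "(ek_D ^^ M) \<phi> r = \<sigma> ^ M * H M r" "(ek_neg_D ^^ M) \<phi> r = (- \<sigma>) ^ M * H M r"
    if "0 < r" for r using ek_chain[OF der eq that order_refl] by auto
  have ev: "\<forall>\<^sub>F r in nhds t. ek_differentiable M \<phi> r"
    using eventually_nhds_in_open[of "{0<..}" t] t c(1) by (auto elim: eventually_mono)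
  show "ek_differentiable (Suc M) \<phi> t" "(ek_D ^^ Suc M) \<phi> t = \<sigma> ^ Suc M * y" "(ek_neg_D ^^ Suc M) \<phi> t = (- \<sigma>) ^ Suc M * y"
    using ev ek_step[of "(ek_D ^^ M) \<phi>", OF c(2) top t] ek_step[of "(ek_neg_D ^^ M) \<phi>", OF c(3) top t]
    by simp_all
qed

section \<open>Right-sided integrals of integer order\<close>

context
  fixes G :: "real \<Rightarrow> real" and p :: nat
  assumes G[measurable]: "G \<in> borel_measurable borel" and p: "1 \<le> p"
    and fin: "\<And>t. 0 < t \<Longrightarrow> (\<integral>\<^sup>+x. ennreal (indicator {t<..} x * x ^ (2 * p - 1) * \<bar>G x\<bar>) \<partial>lborel) < \<infinity>"
begin

text \<open>For x > t one has (x^2 - t^2)^(q-1) \<le> x^(2q-2) and 1 \<le> (x/t)^(2p-2q), so the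
  weight belonging to the top order p controls the kernels of all lower orders.\<close>

lemma ekm_finite:
  assumes q: "1 \<le> q" "q \<le> p" and t: "0 < t"
  shows "(\<integral>\<^sup>+x. ennreal (ekm (real q) t x * \<bar>G x\<bar>) \<partial>lborel) < \<infinity>"
proof -
  define C where "C = 2 / Gamma (real q) * (1 / t ^ (2 * (p - q)))"
  have Gq: "Gamma (real q) > 0" using q by (intro Gamma_real_pos) auto
  have C: "C \<ge> 0" using Gq t by (simp add: C_def)
  have "ekm (real q) t x \<le> C * (indicator {t<..} x * x ^ (2 * p - 1))" for x
  proof (cases "t < x")
    case True
    then have x: "x > 0" and pos: "x\<^sup>2 - t\<^sup>2 > 0" using t by (auto simp: power_strict_mono)
    have "(x\<^sup>2 - t\<^sup>2) powr (real q - 1) = (x\<^sup>2 - t\<^sup>2) ^ (q - 1)"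
      using pos q by (simp add: powr_realpow[symmetric] of_nat_diff)
    also have "\<dots> \<le> (x\<^sup>2) ^ (q - 1)" using pos by (intro power_mono) auto
    also have "\<dots> = x ^ (2 * (q - 1))" by (simp add: power_mult)
    finally have a: "(x\<^sup>2 - t\<^sup>2) powr (real q - 1) * x \<le> x ^ (2 * (q - 1)) * x" using x by (intro mult_right_mono) auto
    have e: "2 * p - 1 = 2 * (q - 1) + 1 + 2 * (p - q)" using q by auto
    have "x ^ (2 * (q - 1)) * x * t ^ (2 * (p - q)) \<le> x ^ (2 * (q - 1)) * x * x ^ (2 * (p - q))"
      using x t True by (intro mult_left_mono power_mono) auto
    also have "\<dots> = x ^ (2 * p - 1)" unfolding e power_add by simp
    finally have "x ^ (2 * (q - 1)) * x \<le> 1 / t ^ (2 * (p - q)) * x ^ (2 * p - 1)"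
      using t by (simp add: field_simps)
    with a have "(x\<^sup>2 - t\<^sup>2) powr (real q - 1) * x \<le> 1 / t ^ (2 * (p - q)) * x ^ (2 * p - 1)" by simp
    then have "2 / Gamma (real q) * ((x\<^sup>2 - t\<^sup>2) powr (real q - 1) * x) \<le> 2 / Gamma (real q) * (1 / t ^ (2 * (p - q)) * x ^ (2 * p - 1))"
      using Gq by (intro mult_left_mono) auto
    then show ?thesis using True t by (simp add: ekm_def C_def mult.assoc)
  qed (use C in \<open>auto simp: ekm_def\<close>)
  then have "(\<integral>\<^sup>+x. ennreal (ekm (real q) t x * \<bar>G x\<bar>) \<partial>lborel) \<le> (\<integral>\<^sup>+x. ennreal C * ennreal (indicator {t<..} x * x ^ (2 * p - 1) * \<bar>G x\<bar>) \<partial>lborel)"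
    using C by (intro nn_integral_mono) (auto simp: ennreal_mult'[symmetric] mult.assoc[symmetric] intro!: ennreal_leI mult_right_mono)
  also have "\<dots> = ennreal C * (\<integral>\<^sup>+x. ennreal (indicator {t<..} x * x ^ (2 * p - 1) * \<bar>G x\<bar>) \<partial>lborel)"
    by (rule nn_integral_cmult) simp
  also have "\<dots> < \<infinity>" using fin[OF t] by (simp add: ennreal_mult_less_top)
  finally show ?thesis .
qed

lemma ekm_integrable:
  assumes q: "1 \<le> q" "q \<le> p" and t: "0 < t"
  shows "integrable lborel (\<lambda>x. ekm (real q) t x * G x)"
  by (rule integrableI_bounded) (use ekm_finite[OF q t] q in \<open>auto simp: abs_mult\<close>)

text \<open>Splits off one integration of order 1, the part on which a differentiation acts.\<close>

lemma ekm_Suc: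
  assumes q: "1 \<le> q" "Suc q \<le> p" and t: "0 < t"
  shows "integrable lborel (\<lambda>r. ekm 1 t r * (LINT x|lborel. ekm (real q) r x * G x))"
    and "(LINT x|lborel. ekm (real (Suc q)) t x * G x) = (LINT r|lborel. ekm 1 t r * (LINT x|lborel. ekm (real q) r x * G x))"
proof -
  have comp: "(\<integral>\<^sup>+r. ennreal (ekm 1 t r * ekm (real q) r x) \<partial>lborel) = ennreal (ekm (real (Suc q)) t x)" for x
    using ekm_semigroup[of 1 "real q" t x] q by simp
  note K = kernel_fubini[of "ekm 1 t" "ekm (real q)" G "ekm (real (Suc q)) t", OF _ _ _ _ _ _ _ comp]
  have f: "(\<integral>\<^sup>+x. ennreal (ekm (real (Suc q)) t x * \<bar>G x\<bar>) \<partial>lborel) < \<infinity>"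
    by (rule ekm_finite) (use q t in auto)
  show "integrable lborel (\<lambda>r. ekm 1 t r * (LINT x|lborel. ekm (real q) r x * G x))"
    by (rule K(1)[OF _ _ _ _ _ _ _ f]) (use q in auto)
  show "(LINT x|lborel. ekm (real (Suc q)) t x * G x) = (LINT r|lborel. ekm 1 t r * (LINT x|lborel. ekm (real q) r x * G x))"
    by (rule K(3)[OF _ _ _ _ _ _ _ f, symmetric]) (use q in auto)
qed

lemma ekm_continuous:
  assumes q: "1 \<le> q" "q \<le> p"
  shows "continuous_on {0<..} (\<lambda>t. LINT x|lborel. ekm (real q) t x * G x)"
proof (cases "q = 1")
  case True
  have "integrable lborel (\<lambda>x. ekm 1 t x * G x)" if "0 < t" for t using ekm_integrable[of 1 t] p that by simp
  from ekm_1_integral(1)[OF this] show ?thesis by (simp add: True)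
next
  case False
  then obtain q' where q': "q = Suc q'" "1 \<le> q'" using q by (cases q) auto
  have "continuous_on {0<..} (\<lambda>t. LINT r|lborel. ekm 1 t r * (LINT x|lborel. ekm (real q') r x * G x))"
    by (rule ekm_1_integral(1)[OF ekm_Suc(1)]) (use q q' in auto)
  then show ?thesis
    by (rule continuous_on_eq) (use ekm_Suc(2)[of q'] q' q in auto)
qed

lemma ekm_derivative:
  assumes q: "1 \<le> q" "Suc q \<le> p" and t: "0 < t"
  shows "((\<lambda>t. LINT x|lborel. ekm (real (Suc q)) t x * G x) has_real_derivative - (2 * t * (LINT x|lborel. ekm (real q) t x * G x))) (at t)"
proof -
  have "((\<lambda>t. LINT r|lborel. ekm 1 t r * (LINT x|lborel. ekm (real q) r x * G x)) has_real_derivative - (2 * t * (LINT x|lborel. ekm (real q) t x * G x))) (at t)"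
    by (rule ekm_1_integral(3)[OF ekm_Suc(1)]) (use q t ekm_continuous[of q] in auto)
  then show ?thesis
    by (rule has_field_derivative_transform_within_open[of _ _ _ "{0<..}"]) (use t ekm_Suc(2) q in auto)
qed

text \<open>Each application of -D lowers the order by one. Down to order 1 the integrals are
  continuous, so these derivatives exist everywhere; the last one meets the merely integrable G and
  exists almost everywhere.\<close>

lemma ek_neg_D_ekm:
  assumes \<phi>: "\<And>t. 0 < t \<Longrightarrow> \<phi> t = c * (LINT x|lborel. ekm (real p) t x * G x)"
  shows "AE t in lebesgue. 0 < t \<longrightarrow> ek_differentiable p \<phi> t \<and> (ek_neg_D ^^ p) \<phi> t = c * G t"
proof -
  define H where "H = (\<lambda>i t. c * (LINT x|lborel. ekm (real (p - i)) t x * G x))"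
  obtain M where M: "p = Suc M" using p by (cases p) auto
  have der: "(H i has_real_derivative (-1) * (2 * t * H (Suc i) t)) (at t)" if "i < M" "0 < t" for i t
  proof -
    have "p - i = Suc (p - Suc i)" "1 \<le> p - Suc i" "Suc (p - Suc i) \<le> p" using that M by auto
    with ekm_derivative[of "p - Suc i" t] that show ?thesis
      unfolding H_def by (auto intro!: derivative_eq_intros)
  qed
  have i1: "integrable lborel (\<lambda>x. ekm 1 t x * G x)" if "0 < t" for t using ekm_integrable[of 1 t] p that by simp
  have "AE t in lebesgue. 0 < t \<longrightarrow> ((\<lambda>t. LINT x|lborel. ekm 1 t x * G x) has_real_derivative - (2 * t * G t)) (at t)"
    using ekm_1_integral(2)[OF i1] .
  then show ?thesis
  proof (rule eventually_mono)
    fix t :: real assume *: "0 < t \<longrightarrow> ((\<lambda>t. LINT x|lborel. ekm 1 t x * G x) has_real_derivative - (2 * t * G t)) (at t)"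
    show "0 < t \<longrightarrow> ek_differentiable p \<phi> t \<and> (ek_neg_D ^^ p) \<phi> t = c * G t"
    proof
      assume t: "0 < t"
      have top: "(H M has_real_derivative (-1) * (2 * t * (c * G t))) (at t)"
        using * t M unfolding H_def by (auto intro!: derivative_eq_intros)
      have eq: "\<phi> t = H 0 t" if "0 < t" for t using \<phi>[OF that] by (simp add: H_def)
      show "ek_differentiable p \<phi> t \<and> (ek_neg_D ^^ p) \<phi> t = c * G t"
        using ek_chain_top[of M H "-1", OF der eq t top] unfolding M by simp
    qed
  qed
qed

end

section \<open>Left-sided integrals of integer order\<close>

context
  fixes G :: "real \<Rightarrow> real"
  assumes G[measurable]: "G \<in> borel_measurable borel"
    and fin: "\<And>s. 0 < s \<Longrightarrow> (\<integral>\<^sup>+x. ennreal (ekp 1 s x * \<bar>G x\<bar>) \<partial>lborel) < \<infinity>"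
begin

text \<open>On (0,s) the factor (s^2 - x^2)^(q-1) is at most s^(2q-2), so finiteness for order 1
  yields all higher integer orders.\<close>

lemma ekp_finite:
  assumes q: "1 \<le> q" and s: "0 < s"
  shows "(\<integral>\<^sup>+x. ennreal (ekp (real q) s x * \<bar>G x\<bar>) \<partial>lborel) < \<infinity>"
proof -
  define C where "C = 1 / Gamma (real q) * (s\<^sup>2) ^ (q - 1)"
  have Gq: "Gamma (real q) > 0" using q by (intro Gamma_real_pos) auto
  have C: "C \<ge> 0" using Gq s by (simp add: C_def)
  have "ekp (real q) s x \<le> C * ekp 1 s x" for x
  proof (cases "0 < x \<and> x < s")
    case True
    then have x: "x > 0" and pos: "s\<^sup>2 - x\<^sup>2 > 0" by (auto simp: power_strict_mono)
    have "(s\<^sup>2 - x\<^sup>2) powr (real q - 1) = (s\<^sup>2 - x\<^sup>2) ^ (q - 1)"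
      using pos q by (simp add: powr_realpow[symmetric] of_nat_diff)
    also have "\<dots> \<le> (s\<^sup>2) ^ (q - 1)" using pos by (intro power_mono) auto
    finally have "2 / Gamma (real q) * ((s\<^sup>2 - x\<^sup>2) powr (real q - 1) * x) \<le> 2 / Gamma (real q) * ((s\<^sup>2) ^ (q - 1) * x)"
      using Gq x by (intro mult_left_mono mult_right_mono) auto
    then show ?thesis using True by (simp add: ekp_def[of "real q"] ekp_1 C_def mult_ac)
  qed (use C in \<open>auto simp: ekp_def\<close>)
  then have "(\<integral>\<^sup>+x. ennreal (ekp (real q) s x * \<bar>G x\<bar>) \<partial>lborel) \<le> (\<integral>\<^sup>+x. ennreal C * ennreal (ekp 1 s x * \<bar>G x\<bar>) \<partial>lborel)"
    using C by (intro nn_integral_mono) (auto simp: ennreal_mult'[symmetric] mult.assoc[symmetric] intro!: ennreal_leI mult_right_mono)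
  also have "\<dots> = ennreal C * (\<integral>\<^sup>+x. ennreal (ekp 1 s x * \<bar>G x\<bar>) \<partial>lborel)"
    by (rule nn_integral_cmult) simp
  also have "\<dots> < \<infinity>" using fin[OF s] by (simp add: ennreal_mult_less_top)
  finally show ?thesis .
qed

lemma ekp_integrable:
  assumes q: "1 \<le> q" and s: "0 < s"
  shows "integrable lborel (\<lambda>x. ekp (real q) s x * G x)"
  by (rule integrableI_bounded) (use ekp_finite[OF q s] q in \<open>auto simp: abs_mult\<close>)

text \<open>The summands a and b may be fractional. This completes the order j/2 to an integer, and
  with a = 1 it exposes one integration to be differentiated away.\<close>

lemma ekp_compose:
  assumes ab: "0 < a" "0 < b" "a + b = real q" "1 \<le> q" and s: "0 < s"
  shows "integrable lborel (\<lambda>r. ekp a s r * (LINT x|lborel. ekp b r x * G x))"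
    and "(LINT r|lborel. ekp a s r * (LINT x|lborel. ekp b r x * G x)) = (LINT x|lborel. ekp (real q) s x * G x)"
proof -
  have comp: "(\<integral>\<^sup>+r. ennreal (ekp a s r * ekp b r x) \<partial>lborel) = ennreal (ekp (real q) s x)" for x
    using ekp_semigroup[of a b s x] ab by simp
  note K = kernel_fubini[of "ekp a s" "ekp b" G "ekp (real q) s", OF _ _ _ _ _ _ _ comp]
  show "integrable lborel (\<lambda>r. ekp a s r * (LINT x|lborel. ekp b r x * G x))"
    by (rule K(1)[OF _ _ _ _ _ _ _ ekp_finite]) (use ab s in auto)
  show "(LINT r|lborel. ekp a s r * (LINT x|lborel. ekp b r x * G x)) = (LINT x|lborel. ekp (real q) s x * G x)"
    by (rule K(3)[OF _ _ _ _ _ _ _ ekp_finite]) (use ab s in auto)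
qed

lemma ekp_continuous:
  assumes q: "1 \<le> q"
  shows "continuous_on {0<..} (\<lambda>t. LINT x|lborel. ekp (real q) t x * G x)"
proof (cases "q = 1")
  case True
  have "integrable lborel (\<lambda>x. ekp 1 t x * G x)" if "0 < t" for t using ekp_integrable[of 1 t] that by simp
  from ekp_1_integral(1)[OF this] show ?thesis by (simp add: True)
next
  case False
  then obtain q' where q': "q = Suc q'" "1 \<le> q'" using q by (cases q) auto
  have "continuous_on {0<..} (\<lambda>t. LINT r|lborel. ekp 1 t r * (LINT x|lborel. ekp (real q') r x * G x))"
    by (rule ekp_1_integral(1)[OF ekp_compose(1)[where q = q]]) (use q q' in auto)
  then show ?thesis
    by (rule continuous_on_eq) (use ekp_compose(2)[of 1 "real q'" q] q' q in auto)
qed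

lemma ekp_derivative:
  assumes q: "1 \<le> q" and t: "0 < t"
  shows "((\<lambda>t. LINT x|lborel. ekp (real (Suc q)) t x * G x) has_real_derivative 2 * t * (LINT x|lborel. ekp (real q) t x * G x)) (at t)"
proof -
  have "((\<lambda>t. LINT r|lborel. ekp 1 t r * (LINT x|lborel. ekp (real q) r x * G x)) has_real_derivative 2 * t * (LINT x|lborel. ekp (real q) t x * G x)) (at t)"
    by (rule ekp_1_integral(3)[OF ekp_compose(1)[where q = "Suc q"]]) (use q t ekp_continuous[of q] in auto)
  then show ?thesis
    by (rule has_field_derivative_transform_within_open[of _ _ _ "{0<..}"])
      (use t ekp_compose(2)[of 1 "real q" "Suc q"] q in auto)
qed

text \<open>Pointwise on purpose: the last derivative is a hypothesis at t, so the same statement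
  serves a continuous G (every t) and a merely integrable one (almost every t).\<close>

lemma ek_D_ekp_at:
  assumes \<phi>: "\<And>t. 0 < t \<Longrightarrow> \<phi> t = c * (LINT x|lborel. ekp (real (Suc M)) t x * G x)"
    and t: "0 < t" and d: "((\<lambda>t. LINT x|lborel. ekp 1 t x * G x) has_real_derivative 2 * t * G t) (at t)"
  shows "ek_differentiable (Suc M) \<phi> t \<and> (ek_D ^^ Suc M) \<phi> t = c * G t"
proof -
  define H where "H = (\<lambda>i t. c * (LINT x|lborel. ekp (real (Suc M - i)) t x * G x))"
  have der: "(H i has_real_derivative 1 * (2 * t * H (Suc i) t)) (at t)" if "i < M" "0 < t" for i t
  proof -
    have "Suc M - i = Suc (Suc M - Suc i)" "1 \<le> Suc M - Suc i" using that by auto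
    with ekp_derivative[of "Suc M - Suc i" t] that show ?thesis
      unfolding H_def by (auto intro!: derivative_eq_intros)
  qed
  have top: "(H M has_real_derivative 1 * (2 * t * (c * G t))) (at t)"
    using d unfolding H_def by (auto intro!: derivative_eq_intros)
  have eq: "\<phi> t = H 0 t" if "0 < t" for t using \<phi>[OF that] by (simp add: H_def)
  show ?thesis
    using ek_chain_top[of M H "1", OF der eq t top] by simp
qed

lemma ekp_1_derivative_AE:
  "AE t in lebesgue. 0 < t \<longrightarrow> ((\<lambda>t. LINT x|lborel. ekp 1 t x * G x) has_real_derivative 2 * t * G t) (at t)"
proof -
  have i1: "integrable lborel (\<lambda>x. ekp 1 t x * G x)" if "0 < t" for t using ekp_integrable[of 1 t] that by simp
  show ?thesis using ekp_1_integral(2)[OF i1] .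
qed

lemma ekp_1_derivative:
  assumes "continuous_on {0<..} G" "0 < t"
  shows "((\<lambda>t. LINT x|lborel. ekp 1 t x * G x) has_real_derivative 2 * t * G t) (at t)"
proof -
  have i1: "integrable lborel (\<lambda>x. ekp 1 t x * G x)" if "0 < t" for t using ekp_integrable[of 1 t] that by simp
  show ?thesis
    by (rule ekp_1_integral(3)[OF i1]) (use assms in auto)
qed

end

section \<open>Inversion of the composed integrals\<close>

text \<open>A non-integrable function has integral 0 by convention, which makes the bound
  unconditional.\<close>

lemma abs_integral_le_nn_integral:
  fixes f :: "'a \<Rightarrow> real"
  shows "ennreal \<bar>integral\<^sup>L M f\<bar> \<le> (\<integral>\<^sup>+x. ennreal \<bar>f x\<bar> \<partial>M)"
proof (cases "integrable M f")
  case True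
  then show ?thesis using integral_norm_bound_ennreal[OF True] by simp
qed (simp add: not_integrable_integral_eq)

lemma power2_powr: "0 < y \<Longrightarrow> (y\<^sup>2) powr z = y powr (2 * z)" for y z :: real
proof -
  assume "0 < y"
  then have "y\<^sup>2 = y powr 2" by (simp add: powr_numeral)
  then show ?thesis by (simp only: powr_powr)
qed

text \<open>Integer powers appear because the exponent q - 2 is -1 for q = 1.\<close>

lemma half_powr: "0 < r \<Longrightarrow> (r\<^sup>2) powr (real q / 2 - 1) = r powi (int q - 2)" for r :: real
proof -
  assume r: "0 < r"
  have "(r\<^sup>2) powr (real q / 2 - 1) = r powr (real_of_int (int q - 2))"
    using power2_powr[OF r, of "real q / 2 - 1"] by (simp add: algebra_simps)
  also have "\<dots> = r powi (int q - 2)" using r by (subst powr_real_of_int') auto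
  finally show ?thesis .
qed

text \<open>In the transform the left-sided integral of order j/2 acts on this function, which is
  r^(n-j-k-2) times the right-sided integral of order k/2.\<close>

definition inner_ek :: "nat \<Rightarrow> nat \<Rightarrow> nat \<Rightarrow> (real \<Rightarrow> real) \<Rightarrow> real \<Rightarrow> real" where
  "inner_ek n j k g x = x powi (int n - int j - int k - 2) * (LINT r|lborel. ekm (real k / 2) x r * g r)"

context
  fixes g :: "real \<Rightarrow> real" and n j k :: nat and a :: real
  assumes g[measurable]: "g \<in> borel_measurable borel"
    and jk: "0 < j" "0 < k" "j + k < n" and a: "0 < a"
    and loc: "\<And>R. 0 < R \<Longrightarrow> (\<integral>\<^sup>+r. ennreal (indicator {0<..R} r * r ^ (n - j - 1) * \<bar>g r\<bar>) \<partial>lborel) < \<infinity>"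
    and tail: "(\<integral>\<^sup>+r. ennreal (indicator {a<..} r * r ^ (k - 1) * \<bar>g r\<bar>) \<partial>lborel) < \<infinity>"
begin

text \<open>Moves the start of the tail from a to any t > 0. Between t and a local integrability
  helps: for r > t, r^(k-1) is at most t^(-(n-j-k)) r^(n-j-1).\<close>

lemma tail_finite:
  assumes t: "0 < t"
  shows "(\<integral>\<^sup>+r. ennreal (indicator {t<..} r * r ^ (k - 1) * \<bar>g r\<bar>) \<partial>lborel) < \<infinity>"
proof -
  define C where "C = (1 / t) ^ (n - j - k)"
  have C: "C \<ge> 0" using t by (simp add: C_def)
  have le: "indicator {t<..} r * r ^ (k - 1) \<le> C * (indicator {0<..a} r * r ^ (n - j - 1)) + indicator {a<..} r * r ^ (k - 1)" for r :: real
  proof (cases "t < r \<and> r \<le> a")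
    case True
    then have r: "r > 0" using t by simp
    have e: "n - j - 1 = (n - j - k) + (k - 1)" using jk by auto
    have "1 \<le> (1 / t * r) ^ (n - j - k)" using True t by (intro one_le_power) (auto simp: field_simps)
    then have "1 * r ^ (k - 1) \<le> (C * r ^ (n - j - k)) * r ^ (k - 1)"
      unfolding C_def power_mult_distrib[symmetric] using r by (intro mult_right_mono) auto
    then have "r ^ (k - 1) \<le> C * r ^ (n - j - 1)"
      unfolding e power_add by (simp only: mult.assoc mult_1)
    then show ?thesis using True r by simp
  next
    case False
    then show ?thesis using C t a by (auto simp: indicator_def)
  qed
  have "(\<integral>\<^sup>+r. ennreal (indicator {t<..} r * r ^ (k - 1) * \<bar>g r\<bar>) \<partial>lborel)
    \<le> (\<integral>\<^sup>+r. ennreal C * ennreal (indicator {0<..a} r * r ^ (n - j - 1) * \<bar>g r\<bar>) + ennreal (indicator {a<..} r * r ^ (k - 1) * \<bar>g r\<bar>) \<partial>lborel)"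
  proof (rule nn_integral_mono)
    fix r :: real
    have nn: "0 \<le> indicator {0<..a} r * r ^ (n - j - 1) * \<bar>g r\<bar>" "0 \<le> indicator {a<..} r * r ^ (k - 1) * \<bar>g r\<bar>"
      using a by (auto simp: indicator_def)
    have "indicator {t<..} r * r ^ (k - 1) * \<bar>g r\<bar> \<le> (C * (indicator {0<..a} r * r ^ (n - j - 1)) + indicator {a<..} r * r ^ (k - 1)) * \<bar>g r\<bar>"
      by (intro mult_right_mono le) auto
    then have "ennreal (indicator {t<..} r * r ^ (k - 1) * \<bar>g r\<bar>) \<le> ennreal (C * (indicator {0<..a} r * r ^ (n - j - 1) * \<bar>g r\<bar>) + indicator {a<..} r * r ^ (k - 1) * \<bar>g r\<bar>)"
      by (intro ennreal_leI) (simp add: algebra_simps)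
    also have "\<dots> = ennreal C * ennreal (indicator {0<..a} r * r ^ (n - j - 1) * \<bar>g r\<bar>) + ennreal (indicator {a<..} r * r ^ (k - 1) * \<bar>g r\<bar>)"
      using nn C by (simp add: ennreal_plus ennreal_mult')
    finally show "ennreal (indicator {t<..} r * r ^ (k - 1) * \<bar>g r\<bar>) \<le> \<dots>" .
  qed
  also have "\<dots> = ennreal C * (\<integral>\<^sup>+r. ennreal (indicator {0<..a} r * r ^ (n - j - 1) * \<bar>g r\<bar>) \<partial>lborel) + (\<integral>\<^sup>+r. ennreal (indicator {a<..} r * r ^ (k - 1) * \<bar>g r\<bar>) \<partial>lborel)"
    by (subst nn_integral_add) (auto simp: nn_integral_cmult)
  also have "\<dots> < \<infinity>" using loc[OF a] tail by (simp add: ennreal_mult_less_top)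
  finally show ?thesis .
qed

text \<open>Kernel of the left-sided integral of order 1 composed with \<open>inner_ek\<close>. For
  x \<le> 2s the range of r is enlarged to (0,x), a full Beta integral of size x^(n-j-1); for x > 2s
  the difference x^2 - r^2 is comparable to x^2, which gives size x^(k-1). Cutting at 2s instead of
  s keeps x away from r < s, where for k = 1 the kernel is singular.\<close>

lemma inner_kernel_bound:
  assumes s: "0 < s"
  obtains C1 C2 where "0 \<le> C1" "0 \<le> C2"
    "\<And>x. (\<integral>\<^sup>+r. ennreal (ekp 1 s r * r powi (int n - int j - int k - 2) * ekm (real k / 2) r x) \<partial>lborel)
      \<le> ennreal (C1 * (indicator {0<..2 * s} x * x ^ (n - j - 1)) + C2 * (indicator {2 * s<..} x * x ^ (k - 1)))"
proof -
  define q where "q = n - j - k"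
  have q: "1 \<le> q" "int n - int j - int k - 2 = int q - 2" "n - j - 1 = q + k - 1" using jk by (auto simp: q_def)
  define A where "A = 2 / Gamma (real k / 2)"
  have A: "A > 0" using jk by (simp add: A_def Gamma_real_pos)
  define C1 where "C1 = A * Beta (real k / 2) (real q / 2)"
  \<comment> \<open>The normalization times the integral of r^(q-2) 2r over (0,s); the factor 2 is
    the loss in the case k = 1.\<close>
  define C2 where "C2 = 2 * A * (Beta 1 (real q / 2) * (s\<^sup>2 - 0\<^sup>2) powr (1 + real q / 2 - 1))"
  have C: "0 \<le> C1" "0 \<le> C2"
    using A jk q by (auto simp: C1_def C2_def Beta_def Gamma_real_pos less_imp_le intro!: mult_nonneg_nonneg divide_nonneg_nonneg)
  have "(\<integral>\<^sup>+r. ennreal (ekp 1 s r * r powi (int q - 2) * ekm (real k / 2) r x) \<partial>lborel)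
      \<le> ennreal (C1 * (indicator {0<..2 * s} x * x ^ (n - j - 1)) + C2 * (indicator {2 * s<..} x * x ^ (k - 1)))" for x
  proof -
    consider "x \<le> 0" | "0 < x" "x \<le> 2 * s" | "2 * s < x" by linarith
    then show ?thesis
    proof cases
      case 1
      then have "ekp 1 s r * r powi (int q - 2) * ekm (real k / 2) r x = 0" for r by (auto simp: ekm_def)
      then show ?thesis by (simp only: ennreal_0 nn_integral_const) simp
    next
      case 2
      have "(\<integral>\<^sup>+r. ennreal (ekp 1 s r * r powi (int q - 2) * ekm (real k / 2) r x) \<partial>lborel)
        \<le> (\<integral>\<^sup>+r. ennreal (A * x) * ennreal ((x\<^sup>2 - r\<^sup>2) powr (real k / 2 - 1) * (r\<^sup>2 - 0\<^sup>2) powr (real q / 2 - 1) * (2 * r) * indicator {0..x} r) \<partial>lborel)"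
      proof (rule nn_integral_mono)
        fix r
        show "ennreal (ekp 1 s r * r powi (int q - 2) * ekm (real k / 2) r x)
          \<le> ennreal (A * x) * ennreal ((x\<^sup>2 - r\<^sup>2) powr (real k / 2 - 1) * (r\<^sup>2 - 0\<^sup>2) powr (real q / 2 - 1) * (2 * r) * indicator {0..x} r)"
        proof (cases "0 < r \<and> r < s \<and> r < x")
          case True
          have e: "(r\<^sup>2 - 0\<^sup>2) powr (real q / 2 - 1) = r powi (int q - 2)" using half_powr[of r q] True by simp
          have "ekp 1 s r * r powi (int q - 2) * ekm (real k / 2) r x =
            A * x * ((x\<^sup>2 - r\<^sup>2) powr (real k / 2 - 1) * (r\<^sup>2 - 0\<^sup>2) powr (real q / 2 - 1) * (2 * r) * indicator {0..x} r)"
            unfolding e using True by (simp add: ekp_1 ekm_def A_def)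
          then show ?thesis using 2 A by (simp add: ennreal_mult'[symmetric])
        next
          case False
          then have "ekp 1 s r * r powi (int q - 2) * ekm (real k / 2) r x = 0" by (auto simp: ekm_def ekp_def)
          then show ?thesis by (simp only: ennreal_0) simp
        qed
      qed
      also have "\<dots> = ennreal (A * x) * ennreal (Beta (real k / 2) (real q / 2) * (x\<^sup>2 - 0\<^sup>2) powr (real k / 2 + real q / 2 - 1))"
        by (subst nn_integral_cmult, simp, subst beta_integral_squares) (use 2 jk q in auto)
      also have "\<dots> = ennreal (C1 * x ^ (n - j - 1))"
      proof -
        have "(x\<^sup>2 - 0\<^sup>2) powr (real k / 2 + real q / 2 - 1) = (x\<^sup>2) powr (real (k + q) / 2 - 1)"
          by (simp add: add_divide_distrib)
        also have "\<dots> = x powi (int (k + q) - 2)" by (rule half_powr) (use 2 in simp)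
        also have "\<dots> = x ^ (q + k - 2)"
          using q jk by (simp add: power_int_def nat_diff_distrib algebra_simps) (metis nat_int of_nat_add)
        finally have "x * (x\<^sup>2 - 0\<^sup>2) powr (real k / 2 + real q / 2 - 1) = x ^ Suc (q + k - 2)" by simp
        also have "Suc (q + k - 2) = n - j - 1" using q jk by simp
        finally have "A * x * (Beta (real k / 2) (real q / 2) * (x\<^sup>2 - 0\<^sup>2) powr (real k / 2 + real q / 2 - 1)) = C1 * x ^ (n - j - 1)"
          by (simp add: C1_def mult_ac)
        then show ?thesis using A 2 by (simp add: ennreal_mult'[symmetric] del: zero_power2 diff_zero)
      qed
      finally show ?thesis using 2 by simp
    next
      case 3
      then have x: "0 < x" using s by simp
      \<comment> \<open>The factor with exponent 1 - 1 equals 1 on (0,s); it gives the integrand the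
        form of \<open>beta_integral_squares\<close> with a = 1.\<close>
      have "(\<integral>\<^sup>+r. ennreal (ekp 1 s r * r powi (int q - 2) * ekm (real k / 2) r x) \<partial>lborel)
        \<le> (\<integral>\<^sup>+r. ennreal (2 * A * x ^ (k - 1)) * ennreal ((s\<^sup>2 - r\<^sup>2) powr (1 - 1) * (r\<^sup>2 - 0\<^sup>2) powr (real q / 2 - 1) * (2 * r) * indicator {0..s} r) \<partial>lborel)"
      proof (rule nn_integral_mono)
        fix r
        show "ennreal (ekp 1 s r * r powi (int q - 2) * ekm (real k / 2) r x)
          \<le> ennreal (2 * A * x ^ (k - 1)) * ennreal ((s\<^sup>2 - r\<^sup>2) powr (1 - 1) * (r\<^sup>2 - 0\<^sup>2) powr (real q / 2 - 1) * (2 * r) * indicator {0..s} r)"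
        proof (cases "0 < r \<and> r < s")
          case True
          have e: "(r\<^sup>2 - 0\<^sup>2) powr (real q / 2 - 1) = r powi (int q - 2)" using half_powr[of r q] True by simp
          have sr: "s\<^sup>2 - r\<^sup>2 > 0" using True by (simp add: power_strict_mono)
          have "r\<^sup>2 \<le> (x / 2)\<^sup>2" using True 3 by (intro power_mono) auto
          moreover have "(x / 2)\<^sup>2 = x\<^sup>2 / 4" by (simp add: power_divide)
          ultimately have xr: "(x / 2)\<^sup>2 \<le> x\<^sup>2 - r\<^sup>2" "x\<^sup>2 - r\<^sup>2 \<le> x\<^sup>2"
            using zero_le_power2[of x] zero_le_power2[of r] by linarith+
          have xr0: "0 < x\<^sup>2 - r\<^sup>2" using xr(1) x by (meson less_le_trans zero_less_power half_gt_zero)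
          \<comment> \<open>The exponent k/2 - 1 is negative exactly for k = 1. Then the lower bound
            (x/2)^2 for x^2 - r^2 is used, otherwise the upper bound x^2.\<close>
          have bound: "(x\<^sup>2 - r\<^sup>2) powr (real k / 2 - 1) * x \<le> 2 * x ^ (k - 1)"
          proof (cases "k = 1")
            case True
            have "(x\<^sup>2 - r\<^sup>2) powr (real k / 2 - 1) \<le> ((x / 2)\<^sup>2) powr (real k / 2 - 1)"
              using xr xr0 x True by (intro powr_mono2') auto
            also have "\<dots> = (x / 2) powi (int k - 2)" by (rule half_powr) (use x in simp)
            also have "\<dots> = 2 / x" using True x by (simp add: power_int_minus)
            finally have "(x\<^sup>2 - r\<^sup>2) powr (real k / 2 - 1) * x \<le> 2 / x * x" using x by (intro mult_right_mono) auto
            then show ?thesis using True x by simp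
          next
            case False
            then have k2: "k \<ge> 2" using jk by simp
            have "(x\<^sup>2 - r\<^sup>2) powr (real k / 2 - 1) \<le> (x\<^sup>2) powr (real k / 2 - 1)"
              using xr xr0 x k2 by (intro powr_mono2) auto
            also have "\<dots> = x powi (int k - 2)" by (rule half_powr) (use x in simp)
            also have "\<dots> = x ^ (k - 2)" using k2 by (simp add: power_int_def nat_diff_distrib)
            finally have "(x\<^sup>2 - r\<^sup>2) powr (real k / 2 - 1) * x \<le> x ^ (k - 2) * x" using x by (intro mult_right_mono) auto
            moreover have "x ^ (k - 2) * x = x ^ (k - 1)"
            proof -
              have "k - 1 = Suc (k - 2)" using k2 by simp
              then show ?thesis by (simp only: power_Suc mult.commute)
            qed
            moreover have "x ^ (k - 1) \<ge> 0" using x by simp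
            ultimately show ?thesis by linarith
          qed
          have "ekp 1 s r * r powi (int q - 2) * ekm (real k / 2) r x = (2 * r * r powi (int q - 2) * A) * ((x\<^sup>2 - r\<^sup>2) powr (real k / 2 - 1) * x)"
            using True 3 by (simp add: ekp_1 ekm_def A_def)
          also have "\<dots> \<le> (2 * r * r powi (int q - 2) * A) * (2 * x ^ (k - 1))"
            using bound True A by (intro mult_left_mono) auto
          also have "\<dots> = 2 * A * x ^ (k - 1) * ((s\<^sup>2 - r\<^sup>2) powr (1 - 1) * (r\<^sup>2 - 0\<^sup>2) powr (real q / 2 - 1) * (2 * r) * indicator {0..s} r)"
            unfolding e using True sr by simp
          finally show ?thesis using x A by (simp add: ennreal_mult'[symmetric] ennreal_leI del: zero_power2 diff_zero)
        next
          case False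
          then have "ekp 1 s r * r powi (int q - 2) * ekm (real k / 2) r x = 0" by (auto simp: ekp_def)
          then show ?thesis by (simp only: ennreal_0) simp
        qed
      qed
      also have "\<dots> = ennreal (2 * A * x ^ (k - 1)) * ennreal (Beta 1 (real q / 2) * (s\<^sup>2 - 0\<^sup>2) powr (1 + real q / 2 - 1))"
        by (subst nn_integral_cmult, simp, subst beta_integral_squares) (use s q in auto)
      also have "\<dots> = ennreal (C2 * x ^ (k - 1))"
        using A x by (simp add: ennreal_mult'[symmetric] C2_def mult_ac del: zero_power2 diff_zero)
      finally show ?thesis using 3 s by simp
    qed
  qed
  then show ?thesis using that[of C1 C2] C q by simp
qed

abbreviation chi :: "real \<Rightarrow> real" where "chi \<equiv> inner_ek n j k g"

lemma chi_measurable[measurable]: "chi \<in> borel_measurable borel"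
  unfolding inner_ek_def by measurable

text \<open>After Tonelli the two integrability assumptions, both cut at 2s, meet the two regimes of
  the kernel bound. This is the convergence condition under which the left-sided integral is
  inverted.\<close>

lemma chi_finite:
  assumes s: "0 < s"
  shows "(\<integral>\<^sup>+r. ennreal (ekp 1 s r * \<bar>chi r\<bar>) \<partial>lborel) < \<infinity>"
proof -
  obtain C1 C2 where C: "0 \<le> C1" "0 \<le> C2"
    "\<And>x. (\<integral>\<^sup>+r. ennreal (ekp 1 s r * r powi (int n - int j - int k - 2) * ekm (real k / 2) r x) \<partial>lborel)
      \<le> ennreal (C1 * (indicator {0<..2 * s} x * x ^ (n - j - 1)) + C2 * (indicator {2 * s<..} x * x ^ (k - 1)))"
    using inner_kernel_bound[OF s] by blast
  let ?w = "\<lambda>r. ekp 1 s r * r powi (int n - int j - int k - 2)"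
  have w: "0 \<le> ?w r" for r by (auto simp: ekp_1)
  have k: "0 \<le> ekm (real k / 2) r x" for r x using jk by simp
  have "(\<integral>\<^sup>+r. ennreal (ekp 1 s r * \<bar>chi r\<bar>) \<partial>lborel) \<le>
    (\<integral>\<^sup>+r. \<integral>\<^sup>+x. ennreal (?w r * ekm (real k / 2) r x) * ennreal \<bar>g x\<bar> \<partial>lborel \<partial>lborel)"
  proof (rule nn_integral_mono)
    fix r
    have "ekp 1 s r * \<bar>chi r\<bar> = ?w r * \<bar>LINT x|lborel. ekm (real k / 2) r x * g x\<bar>"
      by (auto simp: inner_ek_def abs_mult ekp_1)
    then have "ennreal (ekp 1 s r * \<bar>chi r\<bar>) = ennreal (?w r) * ennreal \<bar>LINT x|lborel. ekm (real k / 2) r x * g x\<bar>"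
      by (simp only: ennreal_mult'[OF w])
    also have "\<dots> \<le> ennreal (?w r) * (\<integral>\<^sup>+x. ennreal \<bar>ekm (real k / 2) r x * g x\<bar> \<partial>lborel)"
      by (intro mult_left_mono abs_integral_le_nn_integral) auto
    also have "\<dots> = (\<integral>\<^sup>+x. ennreal (?w r) * ennreal \<bar>ekm (real k / 2) r x * g x\<bar> \<partial>lborel)"
      by (rule nn_integral_cmult[symmetric]) simp
    also have "\<dots> = (\<integral>\<^sup>+x. ennreal (?w r * ekm (real k / 2) r x) * ennreal \<bar>g x\<bar> \<partial>lborel)"
    proof (rule nn_integral_cong)
      fix x
      have "\<bar>ekm (real k / 2) r x * g x\<bar> = ekm (real k / 2) r x * \<bar>g x\<bar>"
        using k[of r x] by (simp only: abs_mult abs_of_nonneg)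
      then show "ennreal (?w r) * ennreal \<bar>ekm (real k / 2) r x * g x\<bar> = ennreal (?w r * ekm (real k / 2) r x) * ennreal \<bar>g x\<bar>"
        unfolding ennreal_mult'[OF w] ennreal_mult'[OF k] by (simp only: ennreal_mult'[OF k] mult.assoc)
    qed
    finally show "ennreal (ekp 1 s r * \<bar>chi r\<bar>) \<le> \<dots>" .
  qed
  also have "\<dots> = (\<integral>\<^sup>+x. \<integral>\<^sup>+r. ennreal (?w r * ekm (real k / 2) r x) * ennreal \<bar>g x\<bar> \<partial>lborel \<partial>lborel)"
    by (rule lborel_pair.Fubini') measurable
  also have "\<dots> = (\<integral>\<^sup>+x. (\<integral>\<^sup>+r. ennreal (?w r * ekm (real k / 2) r x) \<partial>lborel) * ennreal \<bar>g x\<bar> \<partial>lborel)"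
    by (intro nn_integral_cong nn_integral_multc) measurable
  also have "\<dots> \<le> (\<integral>\<^sup>+x. ennreal C1 * ennreal (indicator {0<..2 * s} x * x ^ (n - j - 1) * \<bar>g x\<bar>) + ennreal C2 * ennreal (indicator {2 * s<..} x * x ^ (k - 1) * \<bar>g x\<bar>) \<partial>lborel)"
  proof (rule nn_integral_mono)
    fix x :: real
    have nn: "0 \<le> indicator {0<..2 * s} x * x ^ (n - j - 1)" "0 \<le> indicator {2 * s<..} x * x ^ (k - 1)"
      using s by (auto simp: indicator_def)
    have "(\<integral>\<^sup>+r. ennreal (?w r * ekm (real k / 2) r x) \<partial>lborel) * ennreal \<bar>g x\<bar> \<le>
      ennreal (C1 * (indicator {0<..2 * s} x * x ^ (n - j - 1)) + C2 * (indicator {2 * s<..} x * x ^ (k - 1))) * ennreal \<bar>g x\<bar>"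
      by (intro mult_right_mono C(3)) simp
    also have "\<dots> = (ennreal C1 * ennreal (indicator {0<..2 * s} x * x ^ (n - j - 1)) + ennreal C2 * ennreal (indicator {2 * s<..} x * x ^ (k - 1))) * ennreal \<bar>g x\<bar>"
      by (simp only: ennreal_plus[OF mult_nonneg_nonneg[OF C(1) nn(1)] mult_nonneg_nonneg[OF C(2) nn(2)]]
          ennreal_mult'[OF C(1)] ennreal_mult'[OF C(2)])
    also have "\<dots> = ennreal C1 * ennreal (indicator {0<..2 * s} x * x ^ (n - j - 1) * \<bar>g x\<bar>) + ennreal C2 * ennreal (indicator {2 * s<..} x * x ^ (k - 1) * \<bar>g x\<bar>)"
      unfolding ennreal_mult'[OF nn(1)] ennreal_mult'[OF nn(2)] by (simp only: distrib_right mult.assoc)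
    finally show "(\<integral>\<^sup>+r. ennreal (?w r * ekm (real k / 2) r x) \<partial>lborel) * ennreal \<bar>g x\<bar> \<le> \<dots>" .
  qed
  also have "\<dots> = ennreal C1 * (\<integral>\<^sup>+x. ennreal (indicator {0<..2 * s} x * x ^ (n - j - 1) * \<bar>g x\<bar>) \<partial>lborel) + ennreal C2 * (\<integral>\<^sup>+x. ennreal (indicator {2 * s<..} x * x ^ (k - 1) * \<bar>g x\<bar>) \<partial>lborel)"
    by (subst nn_integral_add) (auto simp: nn_integral_cmult)
  also have "\<dots> < \<infinity>" using loc[of "2 * s"] tail_finite[of "2 * s"] s by (simp add: ennreal_mult_less_top)
  finally show ?thesis .
qed

text \<open>The left-sided derivative first integrates with order 1 - frac(j/2), which completes j/2
  to the integer [j/2] + 1; differentiating that often recovers c times \<open>inner_ek\<close>. The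
  power of r cancels and leaves c times the right-sided integral of order k/2. For odd k a further
  half order makes (k+1)/2 an integer.\<close>

lemma ek_inversion:
  fixes I :: "real \<Rightarrow> real"
  assumes I: "\<And>s. 0 < s \<Longrightarrow> I s = radon_const n j k * (s powi (int k + 2 - int n) * (LINT x|lborel. ekp (real j / 2) s x * chi x))"
  defines "\<Phi> \<equiv> (\<lambda>s. s powi (int n - int k - 2) * I s)"
  defines "\<Psi> \<equiv> (\<lambda>r. r powi (2 - int n + int j + int k) * ek_deriv_plus (real j / 2) \<Phi> r)"
  shows "AE t in lebesgue. 0 < t \<longrightarrow>
            ek_deriv_plus_exists (real j / 2) \<Phi> t \<and>
            ek_deriv_minus_exists k \<Psi> t \<and>
            g t = inverse (radon_const n j k) * ek_deriv_minus k \<Psi> t"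
proof -
  define c where "c = radon_const n j k"
  have c: "c > 0" using jk by (auto simp: c_def radon_const_def intro!: divide_pos_pos mult_pos_pos Gamma_real_pos)
  define \<alpha> where "\<alpha> = real j / 2"
  define M where "M = nat \<lfloor>\<alpha>\<rfloor>"
  have \<alpha>: "0 < \<alpha>" using jk by (simp add: \<alpha>_def)
  have b: "0 < 1 - frac \<alpha>" using frac_lt_1[of \<alpha>] by simp
  have sum: "(1 - frac \<alpha>) + \<alpha> = real (Suc M)" using \<alpha> by (simp add: M_def frac_def)
  define \<Phi>' where "\<Phi>' = (\<lambda>s. LINT x|lborel. ekp \<alpha> s x * chi x)"
  have [measurable]: "\<Phi>' \<in> borel_measurable borel" unfolding \<Phi>'_def by measurable
  have \<Phi>: "\<Phi> s = c * \<Phi>' s" if s: "0 < s" for s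
  proof -
    have "s powi (int n - int k - 2) * s powi (int k + 2 - int n) = 1"
      using s by (subst power_int_add[symmetric]) auto
    then show ?thesis unfolding \<Phi>_def \<Phi>'_def I[OF s] c_def \<alpha>_def by (simp add: mult.left_commute)
  qed
  have comp: "integrable lborel (\<lambda>r. ekp (1 - frac \<alpha>) s r * \<Phi>' r)"
      "(LINT r|lborel. ekp (1 - frac \<alpha>) s r * \<Phi>' r) = (LINT x|lborel. ekp (real (Suc M)) s x * chi x)"
    if s: "0 < s" for s
    unfolding \<Phi>'_def
    by (rule ekp_compose[OF chi_measurable _ b \<alpha> sum]; use chi_finite s in simp)+
  have G0: "Gamma (1 - frac \<alpha>) \<noteq> 0" using Gamma_real_pos[OF b] by linarith
  \<comment> \<open>The exponent - frac \<alpha> is that of the kernel of order 1 - frac \<alpha>,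
    and the factor Gamma / 2 removes its normalization. Outside (0,s) both sides are 0, so \<Phi> is
    evaluated at positive arguments, where it is known.\<close>
  have kint: "indicat_real {0<..<s} r *\<^sub>R ((s\<^sup>2 - r\<^sup>2) powr (- frac \<alpha>) * \<Phi> r * r) = Gamma (1 - frac \<alpha>) / 2 * c * (ekp (1 - frac \<alpha>) s r * \<Phi>' r)" for s r
    using b by (auto simp: ekp_def \<Phi> indicator_def Gamma_eq_zero_iff)
  have plus_int: "set_integrable lebesgue {0<..<s} (\<lambda>r. (s\<^sup>2 - r\<^sup>2) powr (- frac \<alpha>) * \<Phi> r * r)" if s: "0 < s" for s
    unfolding set_integrable_def kint
    by (intro integrable_mult_right) (subst integrable_completion, use comp(1)[OF s] in auto)
  have plus_eq: "ek_int_plus (1 - frac \<alpha>) \<Phi> s = c * (LINT x|lborel. ekp (real (Suc M)) s x * chi x)" if s: "0 < s" for s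
  proof -
    have "ek_int_plus (1 - frac \<alpha>) \<Phi> s = 2 / Gamma (1 - frac \<alpha>) * (LINT r|lebesgue. Gamma (1 - frac \<alpha>) / 2 * c * (ekp (1 - frac \<alpha>) s r * \<Phi>' r))"
      unfolding ek_int_plus_def set_lebesgue_integral_def kint[symmetric] by simp
    also have "\<dots> = c * (LINT r|lebesgue. ekp (1 - frac \<alpha>) s r * \<Phi>' r)"
      using G0 by simp
    also have "(LINT r|lebesgue. ekp (1 - frac \<alpha>) s r * \<Phi>' r) = (LINT r|lborel. ekp (1 - frac \<alpha>) s r * \<Phi>' r)"
      by (rule integral_completion) measurable
    also have "\<dots> = (LINT x|lborel. ekp (real (Suc M)) s x * chi x)"
      by (rule comp(2)[OF s])
    finally show ?thesis .
  qed
  have dp: "ek_deriv_plus \<alpha> \<Phi> = (ek_D ^^ Suc M) (ek_int_plus (1 - frac \<alpha>) \<Phi>)"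
    by (simp add: ek_deriv_plus_def M_def)
  have plus_at: "ek_differentiable (Suc M) (ek_int_plus (1 - frac \<alpha>) \<Phi>) t \<and> ek_deriv_plus \<alpha> \<Phi> t = c * chi t"
    if "0 < t" "((\<lambda>t. LINT x|lborel. ekp 1 t x * chi x) has_real_derivative 2 * t * chi t) (at t)" for t
    unfolding dp by (rule ek_D_ekp_at[OF chi_measurable chi_finite plus_eq that(1,2)])
  have plus_ex: "ek_deriv_plus_exists \<alpha> \<Phi> t"
    if t: "0 < t" "((\<lambda>t. LINT x|lborel. ekp 1 t x * chi x) has_real_derivative 2 * t * chi t) (at t)" for t
  proof -
    have "\<forall>\<^sub>F s in nhds t. set_integrable lebesgue {0<..<s} (\<lambda>r. (s\<^sup>2 - r\<^sup>2) powr (- frac \<alpha>) * \<Phi> r * r)"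
      using eventually_nhds_in_open[of "{0<..}" t] t plus_int by (auto elim: eventually_mono)
    then show ?thesis using plus_at[OF t] by (simp add: ek_deriv_plus_exists_def M_def)
  qed
  have AE1: "AE t in lebesgue. 0 < t \<longrightarrow> ((\<lambda>t. LINT x|lborel. ekp 1 t x * chi x) has_real_derivative 2 * t * chi t) (at t)"
    by (rule ekp_1_derivative_AE[OF chi_measurable chi_finite])
  define K where "K = (\<lambda>r. LINT x|lborel. ekm (real k / 2) r x * g x)"
  have [measurable]: "K \<in> borel_measurable borel" unfolding K_def by measurable
  have chi_K: "r powi (2 - int n + int j + int k) * (c * chi r) = c * K r" if r: "0 < r" for r
  proof -
    have "r powi (2 - int n + int j + int k) * r powi (int n - int j - int k - 2) = 1"
      using r by (subst power_int_add[symmetric]) auto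
    moreover have "r powi (2 - int n + int j + int k) * (c * (r powi (int n - int j - int k - 2) * K r))
      = (r powi (2 - int n + int j + int k) * r powi (int n - int j - int k - 2)) * (c * K r)" by (simp only: mult_ac)
    ultimately show ?thesis unfolding inner_ek_def K_def by simp
  qed
  have \<Psi>_at: "\<Psi> t = c * K t"
    if "0 < t" "((\<lambda>t. LINT x|lborel. ekp 1 t x * chi x) has_real_derivative 2 * t * chi t) (at t)" for t
    using plus_at[OF that] chi_K[OF that(1)] by (simp add: \<Psi>_def \<alpha>_def)
  have minus: "AE t in lebesgue. 0 < t \<longrightarrow> ek_deriv_minus_exists k \<Psi> t \<and> ek_deriv_minus k \<Psi> t = c * g t"
  proof (cases "even k")
    case True
    then obtain p where p: "k = 2 * p" by auto
    then have p1: "1 \<le> p" using jk by simp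
    have fin: "(\<integral>\<^sup>+x. ennreal (indicator {t<..} x * x ^ (2 * p - 1) * \<bar>g x\<bar>) \<partial>lborel) < \<infinity>" if "0 < t" for t
      using tail_finite[OF that] p by simp
    \<comment> \<open>Continuity upgrades the identity for \<Psi> to every t > 0. Differentiating
      \<Psi> looks at whole neighbourhoods, for which an almost-everywhere identity would be too
      weak.\<close>
    have "continuous_on {0<..} (\<lambda>t. LINT x|lborel. ekm (real p) t x * g x)"
      using ekm_continuous[OF g p1 fin p1 order_refl] .
    then have "continuous_on {0<..} chi"
      unfolding inner_ek_def by (intro continuous_intros) (auto simp: p)
    then have \<Psi>: "\<Psi> t = c * (LINT x|lborel. ekm (real p) t x * g x)" if "0 < t" for t
      using \<Psi>_at[OF that ekp_1_derivative[OF chi_measurable chi_finite _ that]] by (simp add: K_def p)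
    show ?thesis
      using ek_neg_D_ekm[OF g p1 fin \<Psi>] True p
      by (auto simp: ek_deriv_minus_exists_def ek_deriv_minus_def elim!: eventually_mono)
  next
    case False
    then obtain p' where p': "k = 2 * p' + 1" by (auto elim: oddE)
    define p where "p = Suc p'"
    have p: "k = 2 * p - 1" "1 \<le> p" "(k + 1) div 2 = p" using p' by (auto simp: p_def)
    \<comment> \<open>Dividing by x accounts for the power x^(-1) that the weighted semigroup law
      leaves inside; the outer factor t in the derivative for odd k cancels it at the end.\<close>
    define G where "G = (\<lambda>x. g x / x)"
    have G[measurable]: "G \<in> borel_measurable borel" unfolding G_def by measurable
    \<comment> \<open>Here 2p - 1 = k, so x^(2p-1) / x is the weight x^(k-1) of the tail
      condition.\<close>
    have fin: "(\<integral>\<^sup>+x. ennreal (indicator {t<..} x * x ^ (2 * p - 1) * \<bar>G x\<bar>) \<partial>lborel) < \<infinity>" if t: "0 < t" for t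
    proof -
      have "indicator {t<..} x * x ^ (2 * p - 1) * \<bar>G x\<bar> = indicator {t<..} x * x ^ (k - 1) * \<bar>g x\<bar>" for x
      proof (cases "t < x")
        case True
        have "x ^ (2 * p - 1) = x ^ (k - 1) * x" unfolding p(1)[symmetric] using power_minus_mult[OF jk(2), of x] by simp
        then show ?thesis using True t by (simp add: G_def)
      qed simp
      then show ?thesis using tail_finite[OF t] by (simp only:)
    qed
    \<comment> \<open>Almost every r is enough: \<Psi> now enters through the integral of order
      1/2.\<close>
    have \<Psi>_AE: "AE r in lborel. 0 < r \<longrightarrow> \<Psi> r = c * K r"
    proof -
      have "AE r in lebesgue. 0 < r \<longrightarrow> \<Psi> r = c * K r"
        using AE1 by (rule eventually_mono) (use \<Psi>_at in auto)
      then show ?thesis by (simp add: AE_completion_iff)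
    qed
    have pp: "1 / 2 + real k / 2 = real p" using p by (simp add: of_nat_diff field_simps)
    have half: "(1/2::real) > 0" "real k / 2 > 0" using jk by auto
    have g12: "Gamma (1/2 :: real) \<noteq> 0" using Gamma_real_pos[of "1/2::real"] by linarith
    define k1 where "k1 = (\<lambda>s r. ekm (1/2) s r * r powr (- 2 * (1/2) - 2 * (real k / 2)))"
    define k3 where "k3 = (\<lambda>s x. s powr (- 2 * (real k / 2)) * x powr (- 2 * (1/2)) * ekm (1/2 + real k / 2) s x)"
    have k3: "k3 s x * y = s powr (- real k) * (ekm (real p) s x * (y / x))" if "0 < s" for s x y
    proof (cases "s < x")
      case True
      then have "x powr (- 2 * (1/2)) = 1 / x" using that by (simp add: powr_minus_divide)
      then show ?thesis by (simp add: k3_def pp)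
    qed (use that in \<open>simp add: k3_def pp ekm_def\<close>)
    have kern: "integrable lborel (\<lambda>r. k1 s r * K r)"
      "(LINT r|lborel. k1 s r * K r) = s powr (- real k) * (LINT x|lborel. ekm (real p) s x * G x)" if s: "0 < s" for s
    proof -
      have cmp: "(\<integral>\<^sup>+r. ennreal (k1 s r * ekm (real k / 2) r x) \<partial>lborel) = ennreal (k3 s x)" for x
        unfolding k1_def k3_def using ekm_weighted_semigroup[OF half s] .
      have f: "(\<integral>\<^sup>+x. ennreal (k3 s x * \<bar>g x\<bar>) \<partial>lborel) < \<infinity>"
      proof -
        have "k3 s x * \<bar>g x\<bar> = s powr (- real k) * (ekm (real p) s x * \<bar>G x\<bar>)" for x
        proof (cases "0 < x")
          case True then show ?thesis using k3[OF s, of x "\<bar>g x\<bar>"] by (simp add: G_def)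
        next
          case False
          then have "ekm z s x = 0" for z using s by (auto simp: ekm_def)
          then show ?thesis by (simp add: k3_def)
        qed
        then have "(\<integral>\<^sup>+x. ennreal (k3 s x * \<bar>g x\<bar>) \<partial>lborel) = (\<integral>\<^sup>+x. ennreal (s powr (- real k)) * ennreal (ekm (real p) s x * \<bar>G x\<bar>) \<partial>lborel)"
          by (simp add: ennreal_mult')
        also have "\<dots> = ennreal (s powr (- real k)) * (\<integral>\<^sup>+x. ennreal (ekm (real p) s x * \<bar>G x\<bar>) \<partial>lborel)"
          by (rule nn_integral_cmult) simp
        also have "\<dots> < \<infinity>" using ekm_finite[OF G p(2) fin p(2) order_refl s] by (simp add: ennreal_mult_less_top)
        finally show ?thesis .
      qed
      have m1: "k1 s \<in> borel_measurable borel" unfolding k1_def by measurable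
      have m3: "k3 s \<in> borel_measurable borel" unfolding k3_def by measurable
      note F = kernel_fubini[OF m1 ekm_measurable g m3 _ _ _ cmp f]
      show "integrable lborel (\<lambda>r. k1 s r * K r)"
        unfolding K_def by (rule F(1)) (use half in \<open>auto simp: k1_def k3_def\<close>)
      have "(LINT r|lborel. k1 s r * K r) = (LINT x|lborel. k3 s x * g x)"
        unfolding K_def by (rule F(3)) (use half in \<open>auto simp: k1_def k3_def\<close>)
      also have "\<dots> = (LINT x|lborel. s powr (- real k) * (ekm (real p) s x * G x))"
        unfolding k3[OF s] G_def ..
      also have "\<dots> = s powr (- real k) * (LINT x|lborel. ekm (real p) s x * G x)"
        by (rule integral_mult_right_zero)
      finally show "(LINT r|lborel. k1 s r * K r) = s powr (- real k) * (LINT x|lborel. ekm (real p) s x * G x)" .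
    qed
    have point: "Gamma (1/2) / 2 * c * (k1 s r * K r) = indicat_real {s<..} r *\<^sub>R ((r\<^sup>2 - s\<^sup>2) powr (- 1 / 2) * (r powi (- int k - 1) * \<Psi> r) * r)"
      if s: "0 < s" and "0 < r \<longrightarrow> \<Psi> r = c * K r" for s r
    proof (cases "s < r")
      case True
      have "r powr (- 2 * (1/2) - 2 * (real k / 2)) = r powr (real_of_int (- int k - 1))"
        by (rule arg_cong[of _ _ "\<lambda>z. r powr z"]) simp
      also have "\<dots> = r powi (- int k - 1)" using True s by (subst powr_real_of_int') auto
      finally show ?thesis using True that g12 by (simp add: k1_def ekm_def)
    next
      case False
      then show ?thesis using s by (simp add: k1_def ekm_def)
    qed
    have AEp: "AE r in lborel. Gamma (1/2) / 2 * c * (k1 s r * K r) = indicat_real {s<..} r *\<^sub>R ((r\<^sup>2 - s\<^sup>2) powr (- 1 / 2) * (r powi (- int k - 1) * \<Psi> r) * r)"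
      if s: "0 < s" for s
      using \<Psi>_AE by (rule eventually_mono) (use point[OF s] in blast)
    have minus_int: "set_integrable lebesgue {s<..} (\<lambda>r. (r\<^sup>2 - s\<^sup>2) powr (- 1 / 2) * (r powi (- int k - 1) * \<Psi> r) * r)" if s: "0 < s" for s
      unfolding set_integrable_def
      by (rule lebesgue_integral_cong_AE_lborel(1)[OF _ AEp[OF s]]) (use kern(1)[OF s] in simp)
    have odd: "ek_odd_kernel k \<Psi> s = c * (LINT x|lborel. ekm (real p) s x * G x)" if s: "0 < s" for s
    proof -
      have "ek_int_minus (1 / 2) (\<lambda>r. r powi (- int k - 1) * \<Psi> r) s =
        2 / Gamma (1/2) * (LINT r|lebesgue. indicat_real {s<..} r *\<^sub>R ((r\<^sup>2 - s\<^sup>2) powr (- 1 / 2) * (r powi (- int k - 1) * \<Psi> r) * r))"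
        by (simp add: ek_int_minus_def set_lebesgue_integral_def)
      also have "\<dots> = 2 / Gamma (1/2) * (LINT r|lborel. Gamma (1/2) / 2 * c * (k1 s r * K r))"
        by (subst lebesgue_integral_cong_AE_lborel(2)[OF _ AEp[OF s]]) (use kern(1)[OF s] in auto)
      also have "\<dots> = c * (LINT r|lborel. k1 s r * K r)" using g12 by simp
      also have "\<dots> = c * (s powr (- real k) * (LINT x|lborel. ekm (real p) s x * G x))" unfolding kern(2)[OF s] ..
      finally have "ek_odd_kernel k \<Psi> s = s ^ k * (c * (s powr (- real k) * (LINT x|lborel. ekm (real p) s x * G x)))"
        by (simp add: ek_odd_kernel_def)
      \<comment> \<open>This is the purpose of the factor s^k in \<open>ek_odd_kernel\<close>: it
        removes the power s^(-k) produced by the weighted semigroup law.\<close>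
      moreover have "s ^ k * s powr (- real k) = 1" using s by (simp add: powr_minus powr_realpow)
      ultimately show ?thesis by (simp add: mult.left_commute mult.assoc[symmetric])
    qed
    have "AE t in lebesgue. 0 < t \<longrightarrow> ek_differentiable p (ek_odd_kernel k \<Psi>) t \<and> (ek_neg_D ^^ p) (ek_odd_kernel k \<Psi>) t = c * G t"
      by (rule ek_neg_D_ekm[OF G p(2) fin odd])
    then show ?thesis
    proof (rule eventually_mono)
      fix t :: real
      assume *: "0 < t \<longrightarrow> ek_differentiable p (ek_odd_kernel k \<Psi>) t \<and> (ek_neg_D ^^ p) (ek_odd_kernel k \<Psi>) t = c * G t"
      show "0 < t \<longrightarrow> ek_deriv_minus_exists k \<Psi> t \<and> ek_deriv_minus k \<Psi> t = c * g t"
      proof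
        assume t: "0 < t"
        have "\<forall>\<^sub>F s in nhds t. set_integrable lebesgue {s<..} (\<lambda>r. (r\<^sup>2 - s\<^sup>2) powr (- 1 / 2) * (r powi (- int k - 1) * \<Psi> r) * r)"
          using eventually_nhds_in_open[of "{0<..}" t] t minus_int by (auto elim: eventually_mono)
        then show "ek_deriv_minus_exists k \<Psi> t \<and> ek_deriv_minus k \<Psi> t = c * g t"
          using * t False p(3) by (simp add: ek_deriv_minus_exists_def ek_deriv_minus_def G_def)
      qed
    qed
  qed
  show ?thesis
    using AE1 minus
  proof eventually_elim
    case (elim t)
    then show ?case using plus_ex[of t] c unfolding \<alpha>_def[symmetric] c_def[symmetric] by (simp add: field_simps)
  qed
qed

end

section \<open>Lebesgue measure on subspaces\<close>

text \<open>Computes the double integral of 1_A(T x) 1_B(y - T x) in two ways. Integrating over y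
  first gives the product of the volumes of the preimage of A and of B. Translating x by the
  preimage of y first turns the integrand into 1_A(T x + y) 1_B(-T x), and the ball B does not
  notice -T, so the volumes of A and B appear.\<close>

lemma lborel_orthogonal:
  fixes T :: "'a::euclidean_space \<Rightarrow> 'a"
  assumes T: "orthogonal_transformation T"
  shows "distr lborel borel T = lborel"
proof (rule measure_eqI)
  have lin: "linear T" using T by (rule orthogonal_transformation_linear)
  have Tm[measurable]: "T \<in> borel \<rightarrow>\<^sub>M borel"
    using linear_continuous_on[of T UNIV] lin by (intro borel_measurable_continuous_onI) (simp add: linear_linear)
  show "sets (distr lborel borel T) = sets lborel" by simp
  fix A assume "A \<in> sets (distr lborel borel T)"
  then have A[measurable]: "A \<in> sets borel" by simp
  \<comment> \<open>The unit ball is mapped onto itself by -T, and its volume is positive and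
    finite, so it can be cancelled.\<close>
  define B where "B = ball (0::'a) 1"
  have B[measurable]: "B \<in> sets borel" by (simp add: B_def)
  have Bpos: "emeasure lborel B \<noteq> 0" "emeasure lborel B \<noteq> \<infinity>"
    using emeasure_lborel_ball_finite[of "0::'a" 1] emeasure_ball[of 1 "0::'a"] unit_ball_vol_pos[of "real DIM('a)"]
    by (auto simp: B_def simp del: unit_ball_vol_pos)
  have shift: "(\<integral>\<^sup>+x. f (c + x) \<partial>lborel) = (\<integral>\<^sup>+x. f x \<partial>lborel)" if [measurable]: "f \<in> borel_measurable borel" for f :: "'a \<Rightarrow> ennreal" and c
    by (subst (2) lborel_distr_plus[symmetric, of c]) (simp add: nn_integral_distr)
  have surj: "\<exists>z. T z = y" for y using orthogonal_transformation_surj[OF T] by (metis surjD)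
  have "emeasure (distr lborel borel T) A * emeasure lborel B =
    (\<integral>\<^sup>+x. indicator A (T x) * (\<integral>\<^sup>+y. indicator B (- T x + y) \<partial>lborel) \<partial>lborel)"
  proof -
    have i: "(\<integral>\<^sup>+y. indicator B (- T x + y) \<partial>lborel) = emeasure lborel B" for x
      using shift[of "indicator B" "- T x"] by simp
    have ii: "emeasure (distr lborel borel T) A = (\<integral>\<^sup>+x. indicator A (T x) \<partial>lborel)"
      using nn_integral_distr[of T lborel borel "indicator A"] by simp
    show ?thesis unfolding i ii by (rule nn_integral_multc[symmetric]) measurable
  qed
  also have "\<dots> = (\<integral>\<^sup>+x. \<integral>\<^sup>+y. indicator A (T x) * indicator B (- T x + y) \<partial>lborel \<partial>lborel)"
    by (intro nn_integral_cong nn_integral_cmult[symmetric]) measurable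
  also have "\<dots> = (\<integral>\<^sup>+y. \<integral>\<^sup>+x. indicator A (T x) * indicator B (- T x + y) \<partial>lborel \<partial>lborel)"
    by (rule lborel_pair.Fubini') measurable
  also have "\<dots> = (\<integral>\<^sup>+y. \<integral>\<^sup>+x. indicator A (T x + y) * indicator B (- T x) \<partial>lborel \<partial>lborel)"
  proof (rule nn_integral_cong)
    fix y :: 'a
    obtain z where z: "T z = y" using surj by blast
    have "(\<integral>\<^sup>+x. indicator A (T x) * indicator B (- T x + y) \<partial>lborel) = (\<integral>\<^sup>+x. indicator A (T (z + x)) * indicator B (- T (z + x) + y) \<partial>lborel)"
      by (rule shift[symmetric]) measurable
    also have "\<dots> = (\<integral>\<^sup>+x. indicator A (T x + y) * indicator B (- T x) \<partial>lborel)"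
      by (simp add: linear_add[OF lin] z add.commute)
    finally show "(\<integral>\<^sup>+x. indicator A (T x) * indicator B (- T x + y) \<partial>lborel) = \<dots>" .
  qed
  also have "\<dots> = (\<integral>\<^sup>+x. \<integral>\<^sup>+y. indicator A (T x + y) * indicator B (- T x) \<partial>lborel \<partial>lborel)"
    by (rule lborel_pair.Fubini'[symmetric]) measurable
  also have "\<dots> = (\<integral>\<^sup>+x. (\<integral>\<^sup>+y. indicator A (T x + y) \<partial>lborel) * indicator B (- T x) \<partial>lborel)"
    by (intro nn_integral_cong nn_integral_multc) measurable
  also have "\<dots> = (\<integral>\<^sup>+x. emeasure lborel A * indicator B (x::'a) \<partial>lborel)"
  proof (rule nn_integral_cong)
    fix x :: 'a
    have "(\<integral>\<^sup>+y. indicator A (T x + y) \<partial>lborel) = emeasure lborel A" by (subst shift) auto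
    moreover have "indicator B (- T x) = (indicator B x :: ennreal)"
      using orthogonal_transformation_norm[OF T, of x] by (simp add: B_def indicator_def)
    ultimately show "(\<integral>\<^sup>+y. indicator A (T x + y) \<partial>lborel) * indicator B (- T x) = emeasure lborel A * indicator B x" by simp
  qed
  also have "\<dots> = emeasure lborel A * emeasure lborel B" by (simp add: nn_integral_cmult)
  finally show "emeasure (distr lborel borel T) A = emeasure lborel A"
    using Bpos ennreal_mult_cancel_left[of "emeasure lborel B" "emeasure (distr lborel borel T) A" "emeasure lborel A"]
    by (simp add: mult.commute[of "emeasure lborel B"])
qed

text \<open>The property inside the choice of \<open>orthonormal_basis_of\<close> as a predicate, so
  that bases can be varied, united and compared.\<close>

definition onb :: "'a::euclidean_space set \<Rightarrow> 'a set \<Rightarrow> bool" where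
  "onb B W \<longleftrightarrow> B \<subseteq> W \<and> pairwise orthogonal B \<and> (\<forall>b\<in>B. norm b = 1) \<and> span B = W"

lemma onb_exists: "subspace W \<Longrightarrow> \<exists>B. onb B W"
  by (erule orthonormal_basis_subspace) (auto simp: onb_def)

lemma onb_finite: "onb B W \<Longrightarrow> finite B" and onb_card: "onb B W \<Longrightarrow> card B = dim W"
  and onb_subspace: "onb B W \<Longrightarrow> subspace W"
proof -
  assume B: "onb B W"
  have "independent B"
    by (rule pairwise_orthogonal_independent) (use B in \<open>auto simp: onb_def\<close>)
  then show "finite B" "card B = dim W" "subspace W"
    using B dim_eq_card_independent[of B] dim_span[of B] by (auto simp: onb_def independent_imp_finite)
qed

lemma orthonormal_basis_of_onb: "subspace W \<Longrightarrow> onb (orthonormal_basis_of W) W"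
  using onb_exists[of W] unfolding onb_def orthonormal_basis_of_def by (rule someI_ex)

lemma onb_inner: "onb B W \<Longrightarrow> b \<in> B \<Longrightarrow> b' \<in> B \<Longrightarrow> b \<bullet> b' = (if b = b' then 1 else 0)"
  by (auto simp: onb_def pairwise_def orthogonal_def norm_eq_1)

lemma onb_sum_inner:
  assumes B: "onb B W"
  shows "(\<Sum>b\<in>B. c b *\<^sub>R b) \<bullet> (\<Sum>b\<in>B. d b *\<^sub>R b) = (\<Sum>b\<in>B. c b * d b)"
  using onb_finite[OF B] by (simp add: inner_sum_left inner_sum_right onb_inner[OF B] if_distrib sum.delta mult.commute cong: if_cong)

lemma onb_norm:
  assumes B: "onb B W"
  shows "norm (\<Sum>b\<in>B. c b *\<^sub>R b) = sqrt (\<Sum>b\<in>B. (c b)\<^sup>2)"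
  by (simp add: norm_eq_sqrt_inner onb_sum_inner[OF B] power2_eq_square)

lemma onb_Un:
  assumes B: "onb B W" and C: "onb C (W\<^sup>\<bottom>)"
  shows "onb (B \<union> C) UNIV" "B \<inter> C = {}"
proof -
  have orth: "x \<bullet> y = 0" if "x \<in> W" "y \<in> W\<^sup>\<bottom>" for x y
    using that by (auto simp: orthogonal_comp_def orthogonal_def)
  have sub: "subspace W" using B by (rule onb_subspace)
  show "B \<inter> C = {}"
  proof (rule ccontr)
    assume "B \<inter> C \<noteq> {}"
    then obtain b where b: "b \<in> B" "b \<in> C" by auto
    then have "b \<bullet> b = 0" using orth[of b b] B C by (auto simp: onb_def)
    then show False using b B by (auto simp: onb_def)
  qed
  have "span (B \<union> C) = UNIV"
  proof -
    have "x \<in> span (B \<union> C)" for x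
    proof -
      obtain y z where yz: "y \<in> span W" "\<And>w. w \<in> span W \<Longrightarrow> orthogonal z w" "x = y + z"
        using orthogonal_subspace_decomp_exists[of W x] by metis
      have "y \<in> span B" using yz(1) B sub by (simp add: onb_def span_eq_iff[THEN iffD2])
      moreover have "z \<in> span C"
        using yz(2) C sub by (auto simp: onb_def orthogonal_comp_def orthogonal_commute span_base)
      ultimately show ?thesis using yz(3)
        using span_mono[of B "B \<union> C"] span_mono[of C "B \<union> C"] span_add[of y "B \<union> C" z] by auto
    qed
    then show ?thesis by auto
  qed
  moreover have "pairwise orthogonal (B \<union> C)"
  proof (rule pairwiseI)
    fix x y assume xy: "x \<in> B \<union> C" "y \<in> B \<union> C" "x \<noteq> y"
    have sub: "B \<subseteq> W" "C \<subseteq> W\<^sup>\<bottom>" using B C by (auto simp: onb_def)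
    have "pairwise orthogonal B" "pairwise orthogonal C" using B C by (auto simp: onb_def)
    then have "orthogonal x y" if "x \<in> B \<and> y \<in> B \<or> x \<in> C \<and> y \<in> C"
      using that xy(3) by (auto simp: pairwise_def)
    moreover have "orthogonal x y" if "x \<in> B" "y \<in> C"
      using orth[of x y] that sub by (auto simp: orthogonal_def)
    moreover have "orthogonal x y" if "x \<in> C" "y \<in> B"
      using orth[of y x] that sub by (auto simp: orthogonal_def inner_commute[of x])
    ultimately show "orthogonal x y" using xy by blast
  qed
  ultimately show "onb (B \<union> C) UNIV" using B C by (auto simp: onb_def)
qed

lemma Basis_onb: "onb Basis UNIV"
  by (auto simp: onb_def pairwise_def orthogonal_def inner_Basis)

lemma orthogonal_transformation_between_bases:
  fixes B E :: "'a::euclidean_space set"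
  assumes B: "onb B UNIV" and E: "onb E UNIV" and \<phi>: "bij_betw \<phi> B E"
  shows "orthogonal_transformation (\<lambda>v. \<Sum>b\<in>B. (v \<bullet> b) *\<^sub>R \<phi> b)" (is "orthogonal_transformation ?T")
    and "b \<in> B \<Longrightarrow> (\<Sum>c\<in>B. (b \<bullet> c) *\<^sub>R \<phi> c) = \<phi> b"
proof -
  have fin: "finite B" using B by (rule onb_finite)
  have exp: "(\<Sum>b\<in>B. (v \<bullet> b) *\<^sub>R b) = v" for v
    by (rule orthonormal_basis_expand) (use B fin in \<open>auto simp: onb_def\<close>)
  have in\<phi>: "\<phi> b \<bullet> \<phi> c = (if b = c then 1 else 0)" if "b \<in> B" "c \<in> B" for b c
    using onb_inner[OF E, of "\<phi> b" "\<phi> c"] \<phi> that by (auto simp: bij_betw_def inj_on_def)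
  have "?T v \<bullet> ?T w = v \<bullet> w" for v w
  proof -
    have "?T v \<bullet> ?T w = (\<Sum>b\<in>B. (v \<bullet> b) * (w \<bullet> b))"
      using fin by (simp add: inner_sum_left inner_sum_right in\<phi> if_distrib sum.delta mult.commute cong: if_cong)
    also have "\<dots> = v \<bullet> w" using onb_sum_inner[OF B, of "\<lambda>b. v \<bullet> b" "\<lambda>b. w \<bullet> b"] by (simp add: exp)
    finally show ?thesis .
  qed
  moreover have "linear ?T"
    by (auto intro!: linearI simp: inner_add_left scaleR_add_left sum.distrib scaleR_sum_right)
  ultimately show "orthogonal_transformation ?T" by (simp add: orthogonal_transformation_def)
  show "(\<Sum>c\<in>B. (b \<bullet> c) *\<^sub>R \<phi> c) = \<phi> b" if "b \<in> B"
    using that fin by (simp add: onb_inner[OF B that] if_distrib[of "\<lambda>x. x *\<^sub>R _"] sum.delta cong: if_cong sum.cong)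
qed

text \<open>The Borel measure whose completion is \<open>subspace_lebesgue\<close>, with the basis
  as parameter. Tonelli arguments are carried out on it, before completion.\<close>

definition lam :: "'a::euclidean_space set \<Rightarrow> 'a measure" where
  "lam B = distr (PiM B (\<lambda>_. lborel :: real measure)) borel (\<lambda>c. \<Sum>b\<in>B. c b *\<^sub>R b)"

lemma subspace_lebesgue_lam: "subspace_lebesgue W = completion (lam (orthonormal_basis_of W))"
  by (simp add: subspace_lebesgue_def lam_def Let_def)

lemma sets_lam[measurable_cong, simp]: "sets (lam B) = sets borel" and space_lam[simp]: "space (lam B) = UNIV"
  by (simp_all add: lam_def)

lemma lam_sum_measurable[measurable]:
  fixes B :: "'a::euclidean_space set"
  shows "(\<lambda>c. \<Sum>b\<in>B. c b *\<^sub>R b) \<in> PiM B (\<lambda>_. lborel :: real measure) \<rightarrow>\<^sub>M borel"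
proof (intro borel_measurable_sum borel_measurable_scaleR borel_measurable_const)
  fix b assume "b \<in> B"
  then have "(\<lambda>c. c b) \<in> PiM B (\<lambda>_. lborel :: real measure) \<rightarrow>\<^sub>M lborel"
    by (rule measurable_component_singleton)
  then show "(\<lambda>c. c b) \<in> PiM B (\<lambda>_. lborel :: real measure) \<rightarrow>\<^sub>M borel" by simp
qed

text \<open>Relabelling coordinates along a bijection from \<open>Basis\<close> to E preserves the
  product measure; what remains is the image of \<open>lborel\<close> under the orthogonal map that
  extends the bijection.\<close>

lemma lam_UNIV:
  assumes E: "onb E (UNIV :: 'a::euclidean_space set)"
  shows "lam E = lborel"
proof -
  interpret product_sigma_finite "\<lambda>_::'a. lborel :: real measure" ..
  have finE: "finite E" using E by (rule onb_finite)
  have "card E = card (Basis :: 'a set)" using onb_card[OF E] by simp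
  then obtain \<phi> where \<phi>: "bij_betw \<phi> (Basis :: 'a set) E"
    using finE finite_same_card_bij[OF finite_Basis finE] by auto
  define \<psi> where "\<psi> = inv_into Basis \<phi>"
  have \<psi>: "\<psi> e \<in> Basis" "\<phi> (\<psi> e) = e" if "e \<in> E" for e
    using \<phi> that by (auto simp: \<psi>_def bij_betw_def inv_into_into f_inv_into_f)
  have \<psi>\<phi>: "\<phi> b \<in> E" "\<psi> (\<phi> b) = b" if "b \<in> Basis" for b
    using \<phi> that by (auto simp: \<psi>_def bij_betw_def)
  let ?R = "\<lambda>f. \<lambda>e\<in>E. f (\<psi> e)"
  have Rm[measurable]: "?R \<in> PiM Basis (\<lambda>_. lborel :: real measure) \<rightarrow>\<^sub>M PiM E (\<lambda>_. lborel :: real measure)"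
    by (intro measurable_restrict measurable_component_singleton) (use \<psi> in auto)
  have "distr (PiM Basis (\<lambda>_. lborel :: real measure)) (PiM E (\<lambda>_. lborel :: real measure)) ?R = PiM E (\<lambda>_. lborel :: real measure)"
  proof (rule PiM_eqI[OF finE])
    fix A :: "'a \<Rightarrow> real set" assume A: "\<And>i. i \<in> E \<Longrightarrow> A i \<in> sets lborel"
    have "?R -` PiE E A \<inter> space (PiM Basis (\<lambda>_. lborel :: real measure)) = PiE Basis (\<lambda>b. A (\<phi> b))"
    proof (intro set_eqI iffI)
      fix f assume f: "f \<in> ?R -` PiE E A \<inter> space (PiM Basis (\<lambda>_. lborel :: real measure))"
      then have "f \<in> extensional Basis" by (simp add: space_PiM PiE_def)
      moreover have "f b \<in> A (\<phi> b)" if "b \<in> Basis" for b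
      proof -
        have "?R f (\<phi> b) \<in> A (\<phi> b)" using f \<psi>\<phi>[OF that] by (intro PiE_mem[of "?R f" E A]) auto
        then show ?thesis using \<psi>\<phi>[OF that] by simp
      qed
      ultimately show "f \<in> PiE Basis (\<lambda>b. A (\<phi> b))" by (auto simp: PiE_def)
    next
      fix f assume f: "f \<in> PiE Basis (\<lambda>b. A (\<phi> b))"
      have "f (\<psi> e) \<in> A e" if "e \<in> E" for e
        using PiE_mem[OF f, of "\<psi> e"] \<psi>[OF that] by simp
      then show "f \<in> ?R -` PiE E A \<inter> space (PiM Basis (\<lambda>_. lborel :: real measure))" using f by (auto simp: space_PiM PiE_def)
    qed
    then have "emeasure (distr (PiM Basis (\<lambda>_. lborel :: real measure)) (PiM E (\<lambda>_. lborel :: real measure)) ?R) (PiE E A) = emeasure (PiM Basis (\<lambda>_. lborel :: real measure)) (PiE Basis (\<lambda>b. A (\<phi> b)))"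
      by (subst emeasure_distr) (use A finE in \<open>auto intro!: sets_PiM_I_finite\<close>)
    also have "\<dots> = (\<Prod>b\<in>Basis. emeasure lborel (A (\<phi> b)))"
      by (rule emeasure_PiM) (use A \<psi>\<phi> in auto)
    also have "\<dots> = (\<Prod>e\<in>E. emeasure lborel (A e))"
      using \<phi> by (rule prod.reindex_bij_betw)
    finally show "emeasure (distr (PiM Basis (\<lambda>_. lborel :: real measure)) (PiM E (\<lambda>_. lborel :: real measure)) ?R) (PiE E A) = (\<Prod>e\<in>E. emeasure lborel (A e))" .
  qed simp
  then have "lam E = distr (distr (PiM Basis (\<lambda>_. lborel :: real measure)) (PiM E (\<lambda>_. lborel :: real measure)) ?R) borel (\<lambda>c. \<Sum>b\<in>E. c b *\<^sub>R b)"
    by (simp add: lam_def)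
  also have "\<dots> = distr (PiM Basis (\<lambda>_. lborel :: real measure)) borel (\<lambda>f. \<Sum>b\<in>Basis. f b *\<^sub>R \<phi> b)"
  proof (subst distr_distr)
    have "(\<Sum>b\<in>E. ?R f b *\<^sub>R b) = (\<Sum>b\<in>Basis. f b *\<^sub>R \<phi> b)" for f
      using \<psi>\<phi> by (subst sum.reindex_bij_betw[OF \<phi>, symmetric]) simp
    then show "distr (PiM Basis (\<lambda>_. lborel :: real measure)) borel ((\<lambda>c. \<Sum>b\<in>E. c b *\<^sub>R b) \<circ> ?R) = distr (PiM Basis (\<lambda>_. lborel :: real measure)) borel (\<lambda>f. \<Sum>b\<in>Basis. f b *\<^sub>R \<phi> b)"
      by (simp add: comp_def)
  qed auto
  also have "\<dots> = distr lborel borel (\<lambda>v. \<Sum>b\<in>Basis. (v \<bullet> b) *\<^sub>R \<phi> b)"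
    by (subst (2) lborel_eq, subst distr_distr) (auto simp: comp_def inner_sum_left inner_Basis if_distrib sum.delta cong: if_cong sum.cong intro!: distr_cong)
  also have "\<dots> = lborel"
    by (rule lborel_orthogonal[OF orthogonal_transformation_between_bases(1)[OF Basis_onb E \<phi>]])
  finally show ?thesis .
qed

lemma nn_integral_lam_Un:
  fixes F :: "'a::euclidean_space \<Rightarrow> ennreal"
  assumes fin: "finite B" "finite C" and dj: "B \<inter> C = {}" and F[measurable]: "F \<in> borel_measurable borel"
  shows "(\<integral>\<^sup>+v. F v \<partial>lam (B \<union> C)) = (\<integral>\<^sup>+x. \<integral>\<^sup>+y. F (x + y) \<partial>lam C \<partial>lam B)"
proof -
  interpret product_sigma_finite "\<lambda>_::'a. lborel :: real measure" ..
  interpret C: finite_product_sigma_finite "\<lambda>_::'a. lborel :: real measure" C by standard fact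
  have sC: "sigma_finite_measure (PiM C (\<lambda>_. lborel :: real measure))" ..
  have "(\<integral>\<^sup>+v. F v \<partial>lam (B \<union> C)) = (\<integral>\<^sup>+c. F (\<Sum>b\<in>B \<union> C. c b *\<^sub>R b) \<partial>PiM (B \<union> C) (\<lambda>_. lborel :: real measure))"
    unfolding lam_def by (rule nn_integral_distr) measurable
  also have "\<dots> = (\<integral>\<^sup>+x. \<integral>\<^sup>+y. F (\<Sum>b\<in>B \<union> C. merge B C (x, y) b *\<^sub>R b) \<partial>PiM C (\<lambda>_. lborel :: real measure) \<partial>PiM B (\<lambda>_. lborel :: real measure))"
    by (rule product_nn_integral_fold) (use dj fin in measurable)
  also have "\<dots> = (\<integral>\<^sup>+x. \<integral>\<^sup>+y. F ((\<Sum>b\<in>B. x b *\<^sub>R b) + (\<Sum>b\<in>C. y b *\<^sub>R b)) \<partial>PiM C (\<lambda>_. lborel :: real measure) \<partial>PiM B (\<lambda>_. lborel :: real measure))"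
  proof -
    have "(\<Sum>b\<in>B \<union> C. merge B C (x, y) b *\<^sub>R b) = (\<Sum>b\<in>B. x b *\<^sub>R b) + (\<Sum>b\<in>C. y b *\<^sub>R b)" for x y
      using fin dj by (subst sum.union_disjoint) (auto intro!: arg_cong2[of _ _ _ _ "(+)"] sum.cong simp: merge_def)
    then show ?thesis by simp
  qed
  also have "\<dots> = (\<integral>\<^sup>+x. \<integral>\<^sup>+y. F (x + (\<Sum>b\<in>C. y b *\<^sub>R b)) \<partial>PiM C (\<lambda>_. lborel :: real measure) \<partial>lam B)"
    unfolding lam_def by (rule nn_integral_distr[symmetric]) measurable
  also have "\<dots> = (\<integral>\<^sup>+x. \<integral>\<^sup>+y. F (x + y) \<partial>lam C \<partial>lam B)"
    unfolding lam_def[of C] by (intro nn_integral_cong nn_integral_distr[symmetric]) measurable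
  finally show ?thesis .
qed

lemma emeasure_lam_cball:
  assumes B: "onb B W" and r: "0 < r"
  shows "emeasure (lam B) (cball 0 r) = ennreal (unit_ball_vol (real (dim W)) * r ^ dim W)"
proof -
  have "emeasure (lam B) (cball 0 r) = emeasure (PiM B (\<lambda>_. lborel :: real measure))
    ((\<lambda>c. \<Sum>b\<in>B. c b *\<^sub>R b) -` cball 0 r \<inter> space (PiM B (\<lambda>_. lborel :: real measure)))"
    unfolding lam_def by (rule emeasure_distr) auto
  also have "(\<lambda>c. \<Sum>b\<in>B. c b *\<^sub>R b) -` cball 0 r = {c. sqrt (\<Sum>b\<in>B. (c b)\<^sup>2) \<le> r}"
    by (auto simp: onb_norm[OF B])
  also have "emeasure (PiM B (\<lambda>_. lborel :: real measure)) (\<dots> \<inter> space (PiM B (\<lambda>_. lborel :: real measure))) = ennreal (unit_ball_vol (real (card B)) * r ^ card B)"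
    by (rule emeasure_cball_aux[OF onb_finite[OF B] r])
  finally show ?thesis by (simp add: onb_card[OF B])
qed

lemma sigma_finite_lam:
  assumes B: "onb B W"
  shows "sigma_finite_measure (lam B)"
proof
  show "\<exists>A. countable A \<and> A \<subseteq> sets (lam B) \<and> \<Union> A = space (lam B) \<and> (\<forall>a\<in>A. emeasure (lam B) a \<noteq> \<infinity>)"
  proof (intro exI[of _ "range (\<lambda>i::nat. cball 0 (real (Suc i)))"] conjI)
    show "\<Union> (range (\<lambda>i::nat. cball 0 (real (Suc i)))) = space (lam B)"
    proof -
      have "\<exists>i::nat. norm x \<le> real (Suc i)" for x :: 'a
        using real_arch_simple[of "norm x"] by (metis le_SucI of_nat_le_iff order_refl order_trans)
      then show ?thesis by auto
    qed
    show "\<forall>a\<in>range (\<lambda>i::nat. cball 0 (real (Suc i))). emeasure (lam B) a \<noteq> \<infinity>"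
    proof safe
      fix i :: nat assume "emeasure (lam B) (cball 0 (real (Suc i))) = \<infinity>"
      then show False by (subst (asm) emeasure_lam_cball[OF B]) auto
    qed
  qed auto
qed

lemma borel_measurable_infdist_const[measurable]:
  fixes f :: "'b \<Rightarrow> 'a::euclidean_space"
  assumes "f \<in> borel_measurable M"
  shows "(\<lambda>x. infdist (f x) A) \<in> borel_measurable M"
proof -
  have "(\<lambda>v. infdist v A) \<in> borel_measurable borel"
    by (intro borel_measurable_continuous_onI continuous_on_infdist continuous_on_id)
  then show ?thesis using assms by (rule measurable_compose_rev)
qed

lemma infdist_translate: "infdist x ((+) u ` A) = infdist (x - u) (A :: 'a::euclidean_space set)"
  by (auto simp: infdist_def image_image dist_norm algebra_simps intro!: arg_cong[of _ _ Inf] image_cong)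

lemma infdist_orthogonal_image:
  assumes "orthogonal_transformation T"
  shows "infdist (T x) (T ` A) = infdist x (A :: 'a::euclidean_space set)"
proof -
  have "dist (T x) (T a) = dist x a" for a
    using orthogonal_transformation_norm[OF assms, of "x - a"] orthogonal_transformation_linear[OF assms]
    by (simp add: dist_norm linear_diff)
  then show ?thesis by (auto simp: infdist_def image_image)
qed

lemma infdist_orthogonal_sum:
  fixes y z :: "'a::euclidean_space"
  assumes W: "subspace W" and y: "y \<in> W" and z: "z \<in> W\<^sup>\<bottom>"
  shows "infdist (y + z) W = norm z"
proof (rule antisym)
  show "infdist (y + z) W \<le> norm z" using infdist_le[OF y, of "y + z"] by (simp add: dist_norm)
  have "norm z \<le> dist (y + z) w" if w: "w \<in> W" for w
  proof -
    have "orthogonal (y - w) z" using z subspace_diff[OF W y w] by (auto simp: orthogonal_comp_def)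
    then have "(norm (y - w + z))\<^sup>2 = (norm (y - w))\<^sup>2 + (norm z)\<^sup>2" by (rule norm_add_Pythagorean)
    then have "(norm z)\<^sup>2 \<le> (norm (y - w + z))\<^sup>2" by simp
    then have "norm z \<le> norm (y - w + z)" by (simp add: power2_le_iff_abs_le)
    then show ?thesis by (simp add: dist_norm algebra_simps)
  qed
  moreover have "W \<noteq> {}" using y by auto
  ultimately show "norm z \<le> infdist (y + z) W" by (auto simp: infdist_notempty intro!: cINF_greatest)
qed

lemma closest_point_orthogonal_sum:
  fixes y z :: "'a::euclidean_space"
  assumes W: "subspace W" and y: "y \<in> W" and z: "z \<in> W\<^sup>\<bottom>"
  shows "closest_point W (y + z) = y"
proof (rule closest_point_unique[symmetric])
  show "convex W" "closed W" using W by (auto simp: subspace_imp_convex closed_subspace)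
  show "\<forall>w\<in>W. dist (y + z) y \<le> dist (y + z) w"
    using infdist_orthogonal_sum[OF assms] infdist_le[of _ W "y + z"] by (auto simp: dist_norm)
qed fact

lemma orthogonal_decomp:
  fixes x :: "'a::euclidean_space"
  assumes W: "subspace W"
  obtains y z where "y \<in> W" "z \<in> W\<^sup>\<bottom>" "x = y + z"
proof -
  obtain y z where yz: "y \<in> span W" "\<And>w. w \<in> span W \<Longrightarrow> orthogonal z w" "x = y + z"
    using orthogonal_subspace_decomp_exists[of W x] by metis
  then show ?thesis using that[of y z] W span_eq_iff[THEN iffD2, OF W]
    by (auto simp: orthogonal_comp_def orthogonal_commute)
qed

lemma closest_point_measurable[measurable]:
  fixes W :: "'a::euclidean_space set"
  assumes "subspace W"
  shows "closest_point W \<in> borel \<rightarrow>\<^sub>M borel"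
  using assms by (intro borel_measurable_continuous_onI continuous_on_closest_point)
    (use subspace_0[OF assms] in \<open>auto simp: subspace_imp_convex closed_subspace\<close>)

text \<open>The measure is defined on the ambient space; this confines integrands to the subspace,
  where projections and distances are explicit.\<close>

lemma AE_lam_mem: "onb B W \<Longrightarrow> AE u in lam B. u \<in> W"
proof -
  assume B: "onb B W"
  have W: "subspace W" using B by (rule onb_subspace)
  have "(\<Sum>b\<in>B. c b *\<^sub>R b) \<in> W" for c
    using B W by (intro subspace_sum subspace_scale) (auto simp: onb_def)
  moreover have "W \<in> sets borel" using W by (intro borel_closed closed_subspace)
  ultimately show ?thesis
    unfolding lam_def by (subst AE_distr_iff) auto
qed

lemma nn_integral_lborel_split:
  fixes F :: "'a::euclidean_space \<Rightarrow> ennreal"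
  assumes B: "onb B W" and C: "onb C (W\<^sup>\<bottom>)" and F[measurable]: "F \<in> borel_measurable borel"
  shows "(\<integral>\<^sup>+v. F v \<partial>lborel) = (\<integral>\<^sup>+x. \<integral>\<^sup>+y. F (x + y) \<partial>lam C \<partial>lam B)"
  using nn_integral_lam_Un[OF onb_finite[OF B] onb_finite[OF C] onb_Un(2)[OF B C] F] lam_UNIV[OF onb_Un(1)[OF B C]] by simp

text \<open>Lebesgue measure on W read off from the tube of radius 1 about W, whose cross-section is
  the unit ball of the orthogonal complement. The left side mentions no basis and involves W through
  projection and distance alone; this yields independence of the basis and, later, measurability of
  such integrals in the subspace.\<close>

lemma nn_integral_lam_eq_lborel:
  fixes F :: "'a::euclidean_space \<Rightarrow> ennreal"
  assumes B: "onb B W" and F[measurable]: "F \<in> borel_measurable borel"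
  shows "(\<integral>\<^sup>+v. F (closest_point W v) * indicator {v. infdist v W \<le> 1} v \<partial>lborel)
    = ennreal (unit_ball_vol (real (dim (W\<^sup>\<bottom>)))) * (\<integral>\<^sup>+x. F x \<partial>lam B)"
proof -
  have W: "subspace W" using B by (rule onb_subspace)
  note [measurable] = closest_point_measurable[OF W]
  obtain C where C: "onb C (W\<^sup>\<bottom>)" using onb_exists[OF subspace_orthogonal_comp] by blast
  have [measurable]: "{v. infdist v W \<le> 1} \<in> sets borel" by measurable
  have "(\<integral>\<^sup>+v. F (closest_point W v) * indicator {v. infdist v W \<le> 1} v \<partial>lborel)
    = (\<integral>\<^sup>+x. \<integral>\<^sup>+y. F (closest_point W (x + y)) * indicator {v. infdist v W \<le> 1} (x + y) \<partial>lam C \<partial>lam B)"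
    by (rule nn_integral_lborel_split[OF B C]) measurable
  also have "\<dots> = (\<integral>\<^sup>+x. F x * ennreal (unit_ball_vol (real (dim (W\<^sup>\<bottom>)))) \<partial>lam B)"
  proof (rule nn_integral_cong_AE)
    show "AE x in lam B. (\<integral>\<^sup>+y. F (closest_point W (x + y)) * indicator {v. infdist v W \<le> 1} (x + y) \<partial>lam C) = F x * ennreal (unit_ball_vol (real (dim (W\<^sup>\<bottom>))))"
      using AE_lam_mem[OF B]
    proof eventually_elim
      case (elim x)
      have "(\<integral>\<^sup>+y. F (closest_point W (x + y)) * indicator {v. infdist v W \<le> 1} (x + y) \<partial>lam C) = (\<integral>\<^sup>+y. F x * indicator (cball 0 1) y \<partial>lam C)"
      proof (rule nn_integral_cong_AE)
        show "AE y in lam C. F (closest_point W (x + y)) * indicator {v. infdist v W \<le> 1} (x + y) = F x * indicator (cball 0 1) y"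
          using AE_lam_mem[OF C]
          by eventually_elim (use elim W in \<open>simp add: closest_point_orthogonal_sum infdist_orthogonal_sum indicator_def\<close>)
      qed
      also have "\<dots> = F x * emeasure (lam C) (cball 0 1)" by (rule nn_integral_cmult_indicator) simp
      also have "emeasure (lam C) (cball 0 1) = ennreal (unit_ball_vol (real (dim (W\<^sup>\<bottom>))))"
        by (subst emeasure_lam_cball[OF C]) auto
      finally show ?case .
    qed
  qed
  also have "\<dots> = ennreal (unit_ball_vol (real (dim (W\<^sup>\<bottom>)))) * (\<integral>\<^sup>+x. F x \<partial>lam B)"
    by (simp add: nn_integral_multc mult.commute)
  finally show ?thesis .
qed

lemma lam_cong:
  fixes W :: "'a::euclidean_space set"
  assumes B: "onb B W" and B': "onb B' W"
  shows "lam B = lam B'"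
proof (rule measure_eqI)
  fix A assume "A \<in> sets (lam B)"
  then have A: "indicator A \<in> borel_measurable borel" by simp
  let ?c = "ennreal (unit_ball_vol (real (dim (W\<^sup>\<bottom>))))"
  have "?c * emeasure (lam B) A = ?c * emeasure (lam B') A"
    using nn_integral_lam_eq_lborel[OF B A] nn_integral_lam_eq_lborel[OF B' A] \<open>A \<in> sets (lam B)\<close> by simp
  moreover have "?c \<noteq> 0" "?c \<noteq> top" using unit_ball_vol_pos[of "real (dim (W\<^sup>\<bottom>))"] by (auto simp del: unit_ball_vol_pos)
  ultimately show "emeasure (lam B) A = emeasure (lam B') A"
    by (simp add: ennreal_mult_cancel_left)
qed simp

text \<open>The preimage of a null set of W under projection is a cylinder, null in the ambient
  space by Tonelli.\<close>

lemma AE_lam_imp_AE_lborel: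
  fixes W :: "'a::euclidean_space set"
  assumes B: "onb B W" and N: "N \<in> sets borel" "emeasure (lam B) N = 0"
  shows "AE v in lborel. closest_point W v \<notin> N"
proof -
  have W: "subspace W" using B by (rule onb_subspace)
  note [measurable] = closest_point_measurable[OF W] N(1)
  obtain C where C: "onb C (W\<^sup>\<bottom>)" using onb_exists[OF subspace_orthogonal_comp] by blast
  have "(\<integral>\<^sup>+v. indicator N (closest_point W v) \<partial>lborel) = (\<integral>\<^sup>+x. \<integral>\<^sup>+y. indicator N (closest_point W (x + y)) \<partial>lam C \<partial>lam B)"
    by (rule nn_integral_lborel_split[OF B C]) measurable
  also have "\<dots> = (\<integral>\<^sup>+x. 0 \<partial>lam B)"
  proof (rule nn_integral_cong_AE)
    have "AE x in lam B. x \<notin> N" using N by (intro AE_not_in) (auto simp: null_sets_def)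
    then show "AE x in lam B. (\<integral>\<^sup>+y. indicator N (closest_point W (x + y)) \<partial>lam C) = 0"
      using AE_lam_mem[OF B]
    proof eventually_elim
      case (elim x)
      have "(\<integral>\<^sup>+y. indicator N (closest_point W (x + y)) \<partial>lam C) = (\<integral>\<^sup>+y. 0 \<partial>lam C)"
      proof (rule nn_integral_cong_AE)
        show "AE y in lam C. indicator N (closest_point W (x + y)) = (0::ennreal)"
          using AE_lam_mem[OF C]
          by eventually_elim (use elim W in \<open>simp add: closest_point_orthogonal_sum\<close>)
      qed
      then show ?case by simp
    qed
  qed
  finally have "(\<integral>\<^sup>+v. indicator N (closest_point W v) \<partial>lborel) = 0" by simp
  then show ?thesis by (subst (asm) nn_integral_0_iff_AE) (auto simp: indicator_def elim!: eventually_mono split: if_splits)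
qed

text \<open>Both sides have the same distribution function. With k = dim W, a ball of radius
  sqrt(R^2 - x^2) has volume pi^(k/2) / Gamma(k/2 + 1) times (R^2 - x^2)^(k/2), and integrating the
  kernel of order k/2 up to R raises its order by one.\<close>

lemma distr_lam_norm:
  fixes B :: "'a::euclidean_space set"
  assumes B: "onb B W" and d: "0 < dim W" and x: "0 \<le> x"
  shows "distr (lam B) borel (\<lambda>u. sqrt ((norm u)\<^sup>2 + x\<^sup>2)) = density lborel (\<lambda>r. ennreal (pi powr (real (dim W) / 2) * ekm (real (dim W) / 2) x r))"
    (is "?M = ?N")
proof (rule measure_eqI_generator_eq[where E = "range (\<lambda>R::real. {..R})" and \<Omega> = UNIV and A = "\<lambda>i::nat. {..real i}"])
  define k where "k = dim W"
  have k: "0 < k" using d by (simp add: k_def)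
  have G: "Gamma (real k / 2 + 1) > 0" by (intro Gamma_real_pos) auto
  have fM: "emeasure ?M {..R} = ennreal (if x < R then unit_ball_vol (real k) * (R\<^sup>2 - x\<^sup>2) powr (real k / 2) else 0)" for R
  proof -
    have m: "emeasure ?M {..R} = emeasure (lam B) {u::'a. sqrt ((norm u)\<^sup>2 + x\<^sup>2) \<le> R}"
      by (subst emeasure_distr) (auto simp: vimage_def)
    consider "x < R" | "R = x" | "R < x" by linarith
    then show ?thesis
    proof cases
      case 1
      then have pos: "R\<^sup>2 - x\<^sup>2 > 0" using x by (simp add: power_strict_mono)
      have "{u::'a. sqrt ((norm u)\<^sup>2 + x\<^sup>2) \<le> R} = cball 0 (sqrt (R\<^sup>2 - x\<^sup>2))"
      proof -
        have "sqrt ((norm u)\<^sup>2 + x\<^sup>2) \<le> R \<longleftrightarrow> norm u \<le> sqrt (R\<^sup>2 - x\<^sup>2)" for u :: 'a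
        proof -
          have "sqrt ((norm u)\<^sup>2 + x\<^sup>2) \<le> R \<longleftrightarrow> (norm u)\<^sup>2 + x\<^sup>2 \<le> R\<^sup>2"
            using real_sqrt_le_iff[of "(norm u)\<^sup>2 + x\<^sup>2" "R\<^sup>2"] 1 x by simp
          also have "\<dots> \<longleftrightarrow> (norm u)\<^sup>2 \<le> R\<^sup>2 - x\<^sup>2" by auto
          also have "\<dots> \<longleftrightarrow> norm u \<le> sqrt (R\<^sup>2 - x\<^sup>2)" 
            using real_sqrt_le_iff[of "(norm u)\<^sup>2" "R\<^sup>2 - x\<^sup>2"] by simp
          finally show ?thesis .
        qed
        then show ?thesis unfolding set_eq_iff mem_Collect_eq mem_cball_0 by blast
      qed
      moreover have "sqrt (R\<^sup>2 - x\<^sup>2) ^ k = (R\<^sup>2 - x\<^sup>2) powr (real k / 2)"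
      proof -
        have "sqrt (R\<^sup>2 - x\<^sup>2) ^ k = sqrt (R\<^sup>2 - x\<^sup>2) powr real k" using pos by (simp add: powr_realpow)
        also have "\<dots> = ((R\<^sup>2 - x\<^sup>2) powr (1 / 2)) powr real k" using pos by (simp add: powr_half_sqrt)
        also have "\<dots> = (R\<^sup>2 - x\<^sup>2) powr (1 / 2 * real k)" by (rule powr_powr)
        finally show ?thesis by simp
      qed
      ultimately show ?thesis
        using 1 pos emeasure_lam_cball[OF B, of "sqrt (R\<^sup>2 - x\<^sup>2)"] by (simp add: m k_def)
    next
      \<comment> \<open>At R = x at most the origin satisfies the inequality. It is enclosed in
        small balls, since the volume formula is for positive radii; r^k \<le> r because k > 0 and r
        \<le> 1.\<close>
      case 2
      have "emeasure ?M {..R} \<le> 0"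
      proof (rule ennreal_le_epsilon)
        fix e :: real assume e: "0 < e"
        define V where "V = unit_ball_vol (real k)"
        have V: "V > 0" by (simp add: V_def)
        define r where "r = min 1 (e / V)"
        have r: "0 < r" "r \<le> 1" "V * r \<le> e" using e V by (auto simp: r_def min_def field_simps)
        have "{u::'a. sqrt ((norm u)\<^sup>2 + x\<^sup>2) \<le> R} \<subseteq> cball 0 r"
        proof safe
          fix u :: 'a assume "sqrt ((norm u)\<^sup>2 + x\<^sup>2) \<le> R"
          then have "(norm u)\<^sup>2 + x\<^sup>2 \<le> x\<^sup>2" using x 2 by (metis real_sqrt_le_iff real_sqrt_unique)
          then show "u \<in> cball 0 r" using r by simp
        qed
        then have "emeasure (lam B) {u::'a. sqrt ((norm u)\<^sup>2 + x\<^sup>2) \<le> R} \<le> emeasure (lam B) (cball 0 r)"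
          by (intro emeasure_mono) auto
        also have "\<dots> = ennreal (V * r ^ k)" using emeasure_lam_cball[OF B r(1)] by (simp add: V_def k_def)
        also have "\<dots> \<le> ennreal (V * r)"
          using V r k power_decreasing[of 1 k r] by (intro ennreal_leI mult_left_mono) auto
        also have "\<dots> \<le> ennreal e" using r by (intro ennreal_leI)
        finally show "emeasure ?M {..R} \<le> 0 + ennreal e" by (simp add: m)
      qed
      then show ?thesis using 2 by simp
    next
      case 3
      have "{u::'a. sqrt ((norm u)\<^sup>2 + x\<^sup>2) \<le> R} = {}"
      proof -
        have "x \<le> sqrt ((norm u)\<^sup>2 + x\<^sup>2)" for u :: 'a using x by (simp add: real_le_rsqrt)
        then show ?thesis using 3 by (auto simp: not_le intro: less_le_trans)
      qed
      then show ?thesis using 3 by (simp only: m) simp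
    qed
  qed
  have fN: "emeasure ?N {..R} = ennreal (if x < R then unit_ball_vol (real k) * (R\<^sup>2 - x\<^sup>2) powr (real k / 2) else 0)" for R
  proof (cases "x < R")
    case False
    then have z: "ennreal (pi powr (real (dim W) / 2) * ekm (real (dim W) / 2) x r) * indicator {..R} r = 0" for r
      by (auto simp: ekm_def indicator_def)
    have "emeasure ?N {..R} = (\<integral>\<^sup>+r. ennreal (pi powr (real (dim W) / 2) * ekm (real (dim W) / 2) x r) * indicator {..R} r \<partial>lborel)"
      by (rule emeasure_density) measurable
    then show ?thesis using False by (simp only: z) simp
  next
    case True
    then have R: "0 < R" using x by simp
    have "emeasure ?N {..R} = (\<integral>\<^sup>+r. ennreal (pi powr (real k / 2) * ekm (real k / 2) x r) * indicator {..R} r \<partial>lborel)"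
      by (simp add: emeasure_density k_def)
    \<comment> \<open>For r < R the kernel of order 1 from r to R is the constant 2R, so it can
      stand in for the indicator, and the semigroup law evaluates the integral.\<close>
    also have "\<dots> = (\<integral>\<^sup>+r. ennreal (pi powr (real k / 2) / (2 * R)) * ennreal (ekm (real k / 2) x r * ekm 1 r R) \<partial>lborel)"
    proof (rule nn_integral_cong_AE)
      have "AE r in lborel. r \<noteq> R" by (rule AE_lborel_singleton)
      then show "AE r in lborel. ennreal (pi powr (real k / 2) * ekm (real k / 2) x r) * indicator {..R} r = ennreal (pi powr (real k / 2) / (2 * R)) * ennreal (ekm (real k / 2) x r * ekm 1 r R)"
      proof eventually_elim
        case (elim r)
        show ?case
        proof (cases "x < r \<and> r < R")
          case True
          then have "pi powr (real k / 2) * ekm (real k / 2) x r = pi powr (real k / 2) / (2 * R) * (ekm (real k / 2) x r * ekm 1 r R)"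
            using R x by (simp add: ekm_1)
          moreover have "0 \<le> pi powr (real k / 2) / (2 * R)" using R by simp
          ultimately show ?thesis using True by (simp only: ennreal_mult'[symmetric]) simp
        next
          case False
          then have "ekm (real k / 2) x r = 0 \<or> ekm 1 r R = 0 \<and> R < r" using elim by (auto simp: ekm_def)
          then show ?thesis by auto
        qed
      qed
    qed
    also have "\<dots> = ennreal (pi powr (real k / 2) / (2 * R)) * ennreal (ekm (real k / 2 + 1) x R)"
      by (subst nn_integral_cmult, simp, subst ekm_semigroup) (use k in auto)
    also have "\<dots> = ennreal (unit_ball_vol (real k) * (R\<^sup>2 - x\<^sup>2) powr (real k / 2))"
      using True R x G by (simp add: ennreal_mult'[symmetric] ekm_def unit_ball_vol_def)
    finally show ?thesis using True by simp
  qed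
  show "Int_stable (range (\<lambda>R::real. {..R}))" by (auto simp: Int_stable_def)
  show "\<And>X. X \<in> range (\<lambda>R::real. {..R}) \<Longrightarrow> emeasure ?M X = emeasure ?N X"
    using fM fN by auto
  show "sets ?M = sigma_sets UNIV (range (\<lambda>R::real. {..R}))" "sets ?N = sigma_sets UNIV (range (\<lambda>R::real. {..R}))"
    by (simp_all add: borel_eq_atMost)
  show "(\<Union>i::nat. {..real i}) = UNIV" using real_arch_simple by auto
  show "emeasure ?M {..real i} \<noteq> \<infinity>" for i using fM by simp
qed auto

section \<open>Borel structure on planes\<close>

lemma openin_plane_topology:
  "openin (plane_topology X) U \<longleftrightarrow> (\<exists>V. open V \<and> U = (\<lambda>\<tau> x. infdist x \<tau>) -` V \<inter> X)"
  unfolding plane_topology_def openin_pullback_topology by (simp only: open_openin)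

lemma openin_plane_topology_subset: "{U. openin (plane_topology X) U} \<subseteq> Pow X"
  unfolding openin_plane_topology by blast

lemma space_plane_borel[simp]: "space (plane_borel X) = X"
  unfolding plane_borel_def by (rule space_measure_of[OF openin_plane_topology_subset])

lemma openin_plane_borel: "openin (plane_topology X) U \<Longrightarrow> U \<in> sets (plane_borel X)"
  unfolding plane_borel_def sets_measure_of[OF openin_plane_topology_subset] by (rule sigma_sets.Basic) simp

lemma infdist_measurable_plane_borel[measurable]: "(\<lambda>\<tau>. infdist x \<tau>) \<in> borel_measurable (plane_borel X)"
proof (rule borel_measurableI)
  fix S :: "real set" assume "open S"
  then have "open ((\<lambda>h. h x) -` S)" by (intro open_vimage continuous_on_product_coordinates)
  then have "openin (plane_topology X) ((\<lambda>\<tau> x. infdist x \<tau>) -` ((\<lambda>h. h x) -` S) \<inter> X)"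
    unfolding openin_plane_topology by blast
  then have "(\<lambda>\<tau> x. infdist x \<tau>) -` ((\<lambda>h. h x) -` S) \<inter> X \<in> sets (plane_borel X)" by (rule openin_plane_borel)
  then show "(\<lambda>\<tau>. infdist x \<tau>) -` S \<inter> space (plane_borel X) \<in> sets (plane_borel X)" by (simp add: vimage_def)
qed

text \<open>Distance functions are 1-Lipschitz, so finitely many conditions on the distances from points of a
  countable dense set, with rational bounds, form a countable base.\<close>

lemma measurable_plane_borel:
  fixes \<phi> :: "'m \<Rightarrow> 'a::euclidean_space set"
  assumes X: "\<phi> \<in> space M \<rightarrow> X" and m[measurable]: "\<And>x. (\<lambda>m. infdist x (\<phi> m)) \<in> borel_measurable M"
  shows "\<phi> \<in> M \<rightarrow>\<^sub>M plane_borel X"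
  unfolding plane_borel_def
proof (rule measurable_measure_of)
  show "{U. openin (plane_topology X) U} \<subseteq> Pow X" by (rule openin_plane_topology_subset)
  show "\<phi> \<in> space M \<rightarrow> X" by fact
  fix U assume "U \<in> {U. openin (plane_topology X) U}"
  then obtain V where V: "open V" "U = (\<lambda>\<tau> x. infdist x \<tau>) -` V \<inter> X"
    unfolding mem_Collect_eq openin_plane_topology by blast
  obtain D :: "'a set" where D: "countable D" "\<And>Y. open Y \<Longrightarrow> Y \<noteq> {} \<Longrightarrow> \<exists>d\<in>D. d \<in> Y"
    by (erule countable_dense_setE)
  define b where "b = (\<lambda>L::('a \<times> real \<times> real) set. {\<tau>. \<forall>(q, r, e)\<in>L. \<bar>infdist q \<tau> - r\<bar> < e})"
  define \<L> where "\<L> = {L. L \<subseteq> D \<times> \<rat> \<times> \<rat> \<and> finite L \<and> b L \<inter> X \<subseteq> U}"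
  have "countable \<L>"
    by (rule countable_subset[OF _ countable_Collect_finite_subset[of "D \<times> \<rat> \<times> \<rat>"]])
      (auto simp: \<L>_def intro!: countable_SIGMA D countable_rat)
  moreover have "\<phi> -` b L \<inter> space M \<in> sets M" if "L \<in> \<L>" for L
  proof -
    have "finite L" using that by (simp add: \<L>_def)
    then have "{m \<in> space M. \<forall>l\<in>L. \<bar>infdist (fst l) (\<phi> m) - fst (snd l)\<bar> < snd (snd l)} \<in> sets M" by measurable
    also have "{m \<in> space M. \<forall>l\<in>L. \<bar>infdist (fst l) (\<phi> m) - fst (snd l)\<bar> < snd (snd l)} = \<phi> -` b L \<inter> space M"
      by (auto simp: b_def split: prod.splits)
    finally show ?thesis .
  qed
  ultimately have "(\<Union>L\<in>\<L>. \<phi> -` b L \<inter> space M) \<in> sets M" by (intro sets.countable_UN') auto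
  also have "(\<Union>L\<in>\<L>. \<phi> -` b L \<inter> space M) = \<phi> -` U \<inter> space M"
  proof (intro set_eqI iffI)
    fix m assume "m \<in> (\<Union>L\<in>\<L>. \<phi> -` b L \<inter> space M)"
    then show "m \<in> \<phi> -` U \<inter> space M" using X by (auto simp: \<L>_def)
  next
    fix m assume m: "m \<in> \<phi> -` U \<inter> space M"
    define \<tau> where "\<tau> = \<phi> m"
    have \<tau>: "(\<lambda>x. infdist x \<tau>) \<in> V" using m V by (auto simp: \<tau>_def)
    obtain Y where Y: "(\<lambda>x. infdist x \<tau>) \<in> PiE UNIV Y" "\<And>i. open (Y i)" "finite {i. Y i \<noteq> UNIV}" "PiE UNIV Y \<subseteq> V"
      using product_topology_open_contains_basis[OF V(1)[unfolded open_fun_def] \<tau>] by auto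
    define J where "J = {i. Y i \<noteq> UNIV}"
    have "\<exists>q r e. q \<in> D \<and> r \<in> \<rat> \<and> e \<in> \<rat> \<and> \<bar>infdist q \<tau> - r\<bar> < e \<and> (\<forall>\<tau>'. \<bar>infdist q \<tau>' - r\<bar> < e \<longrightarrow> infdist i \<tau>' \<in> Y i)" for i
    proof -
      have "infdist i \<tau> \<in> Y i" using Y(1) by (auto simp: PiE_def)
      then obtain \<epsilon> where \<epsilon>: "\<epsilon> > 0" "ball (infdist i \<tau>) \<epsilon> \<subseteq> Y i" using Y(2) open_contains_ball by blast
      obtain q where q: "q \<in> D" "q \<in> ball i (\<epsilon>/8)" using D(2)[of "ball i (\<epsilon>/8)"] \<epsilon> by auto
      obtain r where r: "r \<in> \<rat>" "infdist q \<tau> < r" "r < infdist q \<tau> + \<epsilon>/8"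
        using Rats_dense_in_real[of "infdist q \<tau>" "infdist q \<tau> + \<epsilon>/8"] \<epsilon> by auto
      obtain e where e: "e \<in> \<rat>" "\<epsilon>/8 < e" "e < \<epsilon>/4" using Rats_dense_in_real[of "\<epsilon>/8" "\<epsilon>/4"] \<epsilon> by auto
      have "infdist i \<tau>' \<in> Y i" if "\<bar>infdist q \<tau>' - r\<bar> < e" for \<tau>'
      proof -
        have "dist i q < \<epsilon>/8" using q by simp
        then have "\<bar>infdist i \<tau>' - infdist q \<tau>'\<bar> < \<epsilon>/8" "\<bar>infdist i \<tau> - infdist q \<tau>\<bar> < \<epsilon>/8"
          using infdist_triangle_abs[of i \<tau>' q] infdist_triangle_abs[of i \<tau> q] by simp_all
        then have "\<bar>infdist i \<tau> - infdist i \<tau>'\<bar> < \<epsilon>" using that r(2,3) e \<epsilon> by linarith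
        then show ?thesis using \<epsilon>(2) by (auto simp: dist_real_def)
      qed
      moreover have "\<bar>infdist q \<tau> - r\<bar> < e" using r e by linarith
      ultimately show ?thesis using q r e by blast
    qed
    then obtain q r e where qre: "\<And>i. q i \<in> D" "\<And>i. r i \<in> \<rat>" "\<And>i. e i \<in> \<rat>" "\<And>i. \<bar>infdist (q i) \<tau> - r i\<bar> < e i"
      "\<And>i \<tau>'. \<bar>infdist (q i) \<tau>' - r i\<bar> < e i \<Longrightarrow> infdist i \<tau>' \<in> Y i" by metis
    define L where "L = (\<lambda>i. (q i, r i, e i)) ` J"
    have "b L \<inter> X \<subseteq> U"
    proof
      fix \<tau>' assume \<tau>': "\<tau>' \<in> b L \<inter> X"
      have "infdist i \<tau>' \<in> Y i" for i
      proof (cases "i \<in> J")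
        case True
        then show ?thesis using \<tau>' qre(5)[of i \<tau>'] by (auto simp: b_def L_def)
      qed (simp add: J_def)
      then have "(\<lambda>x. infdist x \<tau>') \<in> PiE UNIV Y" by auto
      then show "\<tau>' \<in> U" using Y(4) V(2) \<tau>' by auto
    qed
    then have "L \<in> \<L>" using qre Y(3) by (auto simp: \<L>_def L_def J_def)
    moreover have "\<tau> \<in> b L" using qre(4) by (auto simp: b_def L_def)
    ultimately show "m \<in> (\<Union>L\<in>\<L>. \<phi> -` b L \<inter> space M)" using m by (auto simp: \<tau>_def)
  qed
  finally show "\<phi> -` U \<inter> space M \<in> sets M" .
qed

text \<open>Joint measurability in point and plane. By the Lipschitz bound, the distance of v to the
  plane is below c iff some q in a countable dense set and some rational r satisfy dist v q < r and
  bound the distance of q by c - r.\<close>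

lemma measurable_infdist[measurable (raw)]:
  fixes v :: "'m \<Rightarrow> 'a::euclidean_space"
  assumes v[measurable]: "v \<in> borel_measurable M" and \<phi>[measurable]: "\<phi> \<in> M \<rightarrow>\<^sub>M plane_borel X"
  shows "(\<lambda>m. infdist (v m) (\<phi> m)) \<in> borel_measurable M"
proof (rule borel_measurableI_less)
  fix c :: real
  obtain D :: "'a set" where D: "countable D" "\<And>Y. open Y \<Longrightarrow> Y \<noteq> {} \<Longrightarrow> \<exists>d\<in>D. d \<in> Y"
    by (erule countable_dense_setE)
  have [measurable]: "(\<lambda>m. infdist q (\<phi> m)) \<in> borel_measurable M" for q
    by (rule measurable_compose[OF \<phi> infdist_measurable_plane_borel])
  have "{m \<in> space M. infdist (v m) (\<phi> m) < c} =
    (\<Union>(q, r)\<in>D \<times> \<rat>. {m \<in> space M. dist (v m) q < r \<and> infdist q (\<phi> m) < c - r})"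
  proof (intro set_eqI iffI)
    fix m assume m: "m \<in> {m \<in> space M. infdist (v m) (\<phi> m) < c}"
    define \<epsilon> where "\<epsilon> = (c - infdist (v m) (\<phi> m)) / 4"
    have \<epsilon>: "\<epsilon> > 0" using m by (simp add: \<epsilon>_def)
    obtain q where q: "q \<in> D" "q \<in> ball (v m) \<epsilon>" using D(2)[of "ball (v m) \<epsilon>"] \<epsilon> by auto
    obtain r where r: "r \<in> \<rat>" "\<epsilon> < r" "r < 2 * \<epsilon>" using Rats_dense_in_real[of \<epsilon> "2 * \<epsilon>"] \<epsilon> by auto
    have "infdist q (\<phi> m) \<le> infdist (v m) (\<phi> m) + dist q (v m)" by (rule infdist_triangle)
    then have "infdist q (\<phi> m) < c - r" using q r \<epsilon>_def by (simp add: dist_commute)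
    moreover have "dist (v m) q < r" using q r by simp
    ultimately show "m \<in> (\<Union>(q, r)\<in>D \<times> \<rat>. {m \<in> space M. dist (v m) q < r \<and> infdist q (\<phi> m) < c - r})"
      using q r m by blast
  next
    fix m assume "m \<in> (\<Union>(q, r)\<in>D \<times> \<rat>. {m \<in> space M. dist (v m) q < r \<and> infdist q (\<phi> m) < c - r})"
    then obtain q r where "m \<in> space M" "dist (v m) q < r" "infdist q (\<phi> m) < c - r" by auto
    then show "m \<in> {m \<in> space M. infdist (v m) (\<phi> m) < c}"
      using infdist_triangle[of "v m" "\<phi> m" q] by auto
  qed
  moreover have "(\<Union>(q, r)\<in>D \<times> \<rat>. {m \<in> space M. dist (v m) q < r \<and> infdist q (\<phi> m) < c - r}) \<in> sets M"
    by (rule sets.countable_UN') (auto intro!: countable_SIGMA D countable_rat)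
  ultimately show "{m \<in> space M. infdist (v m) (\<phi> m) < c} \<in> sets M" by simp
qed

lemma grassmannian_translate:
  assumes "\<xi> \<in> grassmannian W j"
  shows "(+) u ` \<xi> \<in> affine_grassmannian j"
proof -
  have "subspace \<xi>" "dim \<xi> = j" using assms by (auto simp: grassmannian_def)
  then show ?thesis
    using affine_translation[of \<xi> u] by (auto simp: affine_grassmannian_def subspace_imp_affine aff_dim_translation_eq aff_dim_subspace)
qed

lemma measurable_translate_plane[measurable (raw)]:
  fixes v :: "'m \<Rightarrow> 'a::euclidean_space"
  assumes v[measurable]: "v \<in> borel_measurable M" and \<phi>[measurable]: "\<phi> \<in> M \<rightarrow>\<^sub>M plane_borel (grassmannian W j)"
  shows "(\<lambda>m. (+) (v m) ` \<phi> m) \<in> M \<rightarrow>\<^sub>M plane_borel (affine_grassmannian j)"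
proof (rule measurable_plane_borel)
  show "(\<lambda>m. (+) (v m) ` \<phi> m) \<in> space M \<rightarrow> affine_grassmannian j"
    using measurable_space[OF \<phi>] grassmannian_translate by fastforce
  show "(\<lambda>m. infdist x ((+) (v m) ` \<phi> m)) \<in> borel_measurable M" for x
    unfolding infdist_translate by measurable
qed

lemma grassmannian_image:
  assumes T: "orthogonal_transformation T" and W: "T ` W = W" and \<xi>: "\<xi> \<in> grassmannian W j"
  shows "T ` \<xi> \<in> grassmannian W j"
proof -
  have lin: "linear T" using T by (rule orthogonal_transformation_linear)
  have "dim (T ` \<xi>) = dim \<xi>"
    by (rule dim_image_eq[OF lin]) (use orthogonal_transformation_inj[OF T] in \<open>auto intro: inj_on_subset\<close>)
  then show ?thesis using \<xi> W linear_subspace_image[OF lin, of \<xi>] by (auto simp: grassmannian_def)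
qed

text \<open>The distance from x to the image plane is the distance from the preimage of x to the
  plane, again one of the generating functions.\<close>

lemma measurable_image_plane:
  fixes T :: "'a::euclidean_space \<Rightarrow> 'a"
  assumes T: "orthogonal_transformation T" and W: "T ` W = W"
  shows "(\<lambda>\<xi>. T ` \<xi>) \<in> plane_borel (grassmannian W j) \<rightarrow>\<^sub>M plane_borel (grassmannian W j)"
proof (rule measurable_plane_borel)
  show "(\<lambda>\<xi>. T ` \<xi>) \<in> space (plane_borel (grassmannian W j)) \<rightarrow> grassmannian W j"
    using grassmannian_image[OF T W] by auto
  fix x
  obtain y where "T y = x" using orthogonal_transformation_surj[OF T] by (metis surjD)
  then have "infdist x (T ` \<xi>) = infdist y \<xi>" for \<xi> using infdist_orthogonal_image[OF T] by auto
  then show "(\<lambda>\<xi>. infdist x (T ` \<xi>)) \<in> borel_measurable (plane_borel (grassmannian W j))" by simp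
qed

section \<open>Existence of the invariant probability measure\<close>

text \<open>Continuity of the image plane in the linear map. The nearest point p = A v to y has norm
  at most 2 |y|, so |v| \<le> 2 |y| / m by the lower bound, and A' v is within \<delta> |v| of
  p.\<close>

lemma infdist_image_le:
  fixes A A' :: "'b::real_normed_vector \<Rightarrow> 'a::euclidean_space"
  assumes V: "subspace V" and A: "linear A" and m: "0 < m" "0 \<le> \<delta>"
    and low: "\<And>v. v \<in> V \<Longrightarrow> m * norm v \<le> norm (A v)"
    and close: "\<And>v. v \<in> V \<Longrightarrow> norm (A v - A' v) \<le> \<delta> * norm v"
  shows "infdist y (A' ` V) \<le> infdist y (A ` V) + 2 * \<delta> * norm y / m"
proof -
  have sub: "subspace (A ` V)" using A V by (rule linear_subspace_image)
  then have "closed (A ` V)" "A ` V \<noteq> {}" using subspace_0[OF V] by (auto simp: closed_subspace)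
  then obtain p where p: "p \<in> A ` V" "infdist y (A ` V) = dist y p" using infdist_attains_inf by metis
  then obtain v where v: "v \<in> V" "p = A v" by auto
  have "dist y p \<le> norm y" using infdist_le[OF subspace_0[OF sub], of y] p(2) by simp
  then have "norm p \<le> 2 * norm y" using norm_triangle_ineq4[of y "y - p"] by (simp add: dist_norm)
  then have "m * norm v \<le> 2 * norm y" using low[OF v(1)] v(2) by simp
  then have "norm v \<le> 2 * norm y / m" using m by (simp add: field_simps)
  then have "\<delta> * norm v \<le> \<delta> * (2 * norm y / m)" using m by (intro mult_left_mono)
  then have d: "norm (A v - A' v) \<le> 2 * \<delta> * norm y / m" using close[OF v(1)] by (simp add: mult_ac)
  have "infdist y (A' ` V) \<le> dist y (A' v)" using v by (intro infdist_le) auto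
  also have "\<dots> \<le> dist y p + norm (A v - A' v)"
    using norm_triangle_ineq[of "y - A v" "A v - A' v"] by (simp add: dist_norm v(2))
  finally show ?thesis using d p(2) by simp
qed

lemma orthogonal_closest_point:
  fixes T :: "'a::euclidean_space \<Rightarrow> 'a"
  assumes T: "orthogonal_transformation T" and W: "T ` W = W" "subspace W"
  shows "closest_point W (T x) = T (closest_point W x)"
proof -
  obtain y z where yz: "y \<in> W" "z \<in> W\<^sup>\<bottom>" "x = y + z" using orthogonal_decomp[OF W(2)] .
  have "T y \<in> W" using yz W by auto
  moreover have "T z \<in> W\<^sup>\<bottom>"
  proof -
    have "orthogonal w (T z)" if "w \<in> W" for w
    proof -
      obtain w' where "w' \<in> W" "w = T w'" using \<open>w \<in> W\<close> W(1) by auto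
      then show ?thesis using yz(2) orthogonal_orthogonal_transformation[OF T] by (auto simp: orthogonal_comp_def)
    qed
    then show ?thesis by (auto simp: orthogonal_comp_def)
  qed
  ultimately show ?thesis
    using yz W orthogonal_transformation_linear[OF T] by (simp add: linear_add closest_point_orthogonal_sum)
qed

lemma linear_closest_point:
  fixes W :: "'a::euclidean_space set"
  assumes W: "subspace W"
  shows "linear (closest_point W)"
proof (rule linearI)
  fix x x' :: 'a and c :: real
  obtain y z where yz: "y \<in> W" "z \<in> W\<^sup>\<bottom>" "x = y + z" using orthogonal_decomp[OF W] .
  obtain y' z' where yz': "y' \<in> W" "z' \<in> W\<^sup>\<bottom>" "x' = y' + z'" using orthogonal_decomp[OF W] .
  have "x + x' = (y + y') + (z + z')" "c *\<^sub>R x = c *\<^sub>R y + c *\<^sub>R z" using yz yz' by (auto simp: algebra_simps)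
  moreover have "y + y' \<in> W" "z + z' \<in> W\<^sup>\<bottom>" "c *\<^sub>R y \<in> W" "c *\<^sub>R z \<in> W\<^sup>\<bottom>"
    using yz yz' W subspace_orthogonal_comp by (auto intro: subspace_add subspace_scale)
  ultimately show "closest_point W (x + x') = closest_point W x + closest_point W x'" "closest_point W (c *\<^sub>R x) = c *\<^sub>R closest_point W x"
    using closest_point_orthogonal_sum[OF W] yz yz' by metis+
qed

lemma norm_closest_point_le:
  fixes W :: "'a::euclidean_space set"
  assumes W: "subspace W"
  shows "norm (closest_point W x) \<le> norm x"
proof -
  obtain y z where yz: "y \<in> W" "z \<in> W\<^sup>\<bottom>" "x = y + z" using orthogonal_decomp[OF W] .
  have "orthogonal y z" using yz by (auto simp: orthogonal_comp_def)
  then have "(norm x)\<^sup>2 = (norm y)\<^sup>2 + (norm z)\<^sup>2" unfolding yz(3) by (rule norm_add_Pythagorean)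
  then have "norm y \<le> norm x" by (metis le_add_same_cancel1 norm_ge_zero power2_le_imp_le zero_le_power2)
  then show ?thesis using closest_point_orthogonal_sum[OF W yz(1,2)] yz(3) by simp
qed

text \<open>The transpose of x applied to v. With rows, composing with a linear T on the left acts
  on each row separately.\<close>

definition row_comb :: "real^'n^'n \<Rightarrow> real^'n \<Rightarrow> real^'n" where
  "row_comb x v = (\<Sum>b\<in>UNIV. v $ b *\<^sub>R x $ b)"

lemma linear_row_comb: "linear (row_comb x)" and linear_row_comb_left: "linear (\<lambda>x. row_comb x v)"
  by (auto intro!: linearI simp: row_comb_def algebra_simps sum.distrib scaleR_sum_right)

lemma norm_row_comb: "norm (row_comb x v) \<le> norm x * norm v"
proof -
  have "norm (row_comb x v) \<le> (\<Sum>b\<in>UNIV. \<bar>norm (v $ b)\<bar> * \<bar>norm (x $ b)\<bar>)"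
    unfolding row_comb_def by (rule order_trans[OF norm_sum]) simp
  also have "\<dots> \<le> L2_set (\<lambda>b. norm (v $ b)) UNIV * L2_set (\<lambda>b. norm (x $ b)) UNIV"
    by (rule L2_set_mult_ineq)
  finally show ?thesis by (simp add: norm_vec_def mult.commute)
qed

text \<open>The random plane is the image of a fixed V under a random matrix followed by projection
  to W. The matrix is uniform on an open set of matrices, and composing with T acts on matrices as
  an orthogonal transformation: it preserves their Lebesgue measure and moves the random plane by
  T.\<close>

lemma invariant_prob_exists:
  fixes W :: "(real^'n) set"
  assumes W: "subspace W" and j: "j \<le> dim W"
  shows "\<exists>\<mu>. invariant_prob W j \<mu>"
proof -
  obtain V where V: "subspace V" "V \<subseteq> W" "dim V = j"
    using choose_subspace_of_subspace[OF j] W span_eq_iff[THEN iffD2, OF W] by auto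
  \<comment> \<open>Projection keeps the image inside W, and it commutes with every orthogonal T
    that maps W onto itself.\<close>
  define P where "P = closest_point W"
  have linP: "linear P" unfolding P_def by (rule linear_closest_point[OF W])
  have PW: "P v \<in> W" for v using W subspace_0[OF W] unfolding P_def by (intro closest_point_in_set closed_subspace) auto
  have Pid: "P v = v" if "v \<in> W" for v using that by (simp add: P_def closest_point_self)
  have nP: "norm (P v) \<le> norm v" for v unfolding P_def by (rule norm_closest_point_le[OF W])
  define A where "A = (\<lambda>x v. P (row_comb x v))"
  have linA: "linear (A x)" for x unfolding A_def using linear_compose[OF linear_row_comb linP] by (simp add: comp_def)
  have A_diff: "norm (A x v - A x' v) \<le> norm (x - x') * norm v" for x x' v
  proof -
    have "A x v - A x' v = P (row_comb (x - x') v)"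
      by (simp add: A_def linear_diff[OF linP] linear_diff[OF linear_row_comb_left])
    then show ?thesis using nP[of "row_comb (x - x') v"] norm_row_comb[of "x - x'" v] by simp
  qed
  \<comment> \<open>Injectivity on V in quantitative form, so that openness follows by halving m.
    The unit ball keeps the volume finite and is invariant under orthogonal maps of
    matrices.\<close>
  define S where "S = {x \<in> ball 0 1. \<exists>m>0. \<forall>v\<in>V. m * norm v \<le> norm (A x v)}"
  have S_open: "open S"
    unfolding open_contains_ball
  proof
    fix x assume x: "x \<in> S"
    then obtain m where m: "m > 0" "\<And>v. v \<in> V \<Longrightarrow> m * norm v \<le> norm (A x v)" by (auto simp: S_def)
    have "norm x < 1" using x by (simp add: S_def)
    define e where "e = min (m / 2) (1 - norm x)"
    have "x' \<in> S" if "x' \<in> ball x e" for x'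
    proof -
      have d: "norm (x - x') < m / 2" "norm (x - x') < 1 - norm x" using that by (auto simp: e_def dist_norm)
      have "norm x' < 1" using d(2) norm_triangle_ineq4[of x "x - x'"] by simp
      moreover have "m / 2 * norm v \<le> norm (A x' v)" if "v \<in> V" for v
      proof -
        have "norm (x - x') * norm v \<le> m / 2 * norm v" using d(1) by (intro mult_right_mono) auto
        then show ?thesis using A_diff[of x v x'] m(2)[OF that] norm_triangle_ineq2[of "A x v" "A x' v"] by linarith
      qed
      ultimately show ?thesis using m(1) unfolding S_def by (auto intro!: exI[of _ "m / 2"])
    qed
    moreover have "e > 0" using m \<open>norm x < 1\<close> by (simp add: e_def)
    ultimately show "\<exists>e>0. ball x e \<subseteq> S" by blast
  qed
  then have Sm[measurable]: "S \<in> sets borel" by simp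
  have S_ne: "S \<noteq> {}"
  proof -
    \<comment> \<open>A small multiple of the identity acts on V as a positive scalar and therefore
      lies in \<open>S\<close>.\<close>
    define I :: "real^'n^'n" where "I = (\<chi> b. axis b 1)"
    define c where "c = 1 / (norm I + 1)"
    have c: "c > 0" by (simp add: c_def add_nonneg_pos)
    have "row_comb (c *\<^sub>R I) v = c *\<^sub>R v" for v
      by (simp add: row_comb_def I_def vec_eq_iff axis_def if_distrib sum.delta cong: if_cong)
    then have "A (c *\<^sub>R I) v = c *\<^sub>R v" if "v \<in> V" for v
      using Pid[of "c *\<^sub>R v"] that V(2) subspace_scale[OF W] by (auto simp: A_def)
    then have "c * norm v \<le> norm (A (c *\<^sub>R I) v)" if "v \<in> V" for v using that c by simp
    moreover have "norm (c *\<^sub>R I) < 1"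
    proof -
      have "0 < norm I + 1" using norm_ge_zero[of I] by linarith
      then have "c * norm I < 1" by (simp add: c_def pos_divide_less_eq)
      then show ?thesis using c by simp
    qed
    ultimately have "c *\<^sub>R I \<in> S" using c by (auto simp: S_def)
    then show ?thesis by auto
  qed
  have Spos: "emeasure lborel S \<noteq> 0"
  proof -
    obtain x where "x \<in> S" using S_ne by auto
    then obtain e where e: "e > 0" "ball x e \<subseteq> S" using S_open open_contains_ball by blast
    have "0 < emeasure lborel (ball x e)"
      using e(1) by (subst emeasure_ball) auto
    also have "\<dots> \<le> emeasure lborel S" using e(2) by (intro emeasure_mono) auto
    finally show ?thesis by simp
  qed
  have Sfin: "emeasure lborel S \<noteq> \<infinity>"
  proof -
    have "emeasure lborel S \<le> emeasure lborel (ball (0::real^'n^'n) 1)" by (intro emeasure_mono) (auto simp: S_def)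
    also have "\<dots> < \<infinity>" by (rule emeasure_lborel_ball_finite)
    finally show ?thesis by simp
  qed
  define \<nu> where "\<nu> = uniform_measure lborel S"
  interpret \<nu>: prob_space \<nu> unfolding \<nu>_def by (rule prob_space_uniform_measure[OF Spos Sfin])
  have s\<nu>[measurable_cong]: "sets \<nu> = sets borel" by (simp add: \<nu>_def)
  define G where "G = grassmannian W j"
  \<comment> \<open>The value V off \<open>S\<close> is a dummy inside the Grassmannian; \<nu> is
    concentrated on \<open>S\<close>.\<close>
  define \<xi> where "\<xi> = (\<lambda>x. if x \<in> S then A x ` V else V)"
  have \<xi>G: "\<xi> x \<in> G" for x
  proof (cases "x \<in> S")
    case True
    then obtain m where m: "m > 0" "\<And>v. v \<in> V \<Longrightarrow> m * norm v \<le> norm (A x v)" by (auto simp: S_def)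
    have "inj_on (A x) V"
    proof (rule inj_onI)
      fix u v assume uv: "u \<in> V" "v \<in> V" "A x u = A x v"
      then have "m * norm (u - v) \<le> 0" using m(2)[of "u - v"] subspace_diff[OF V(1)] by (simp add: linear_diff[OF linA])
      then show "u = v" using m(1) by (simp add: mult_le_0_iff)
    qed
    then have "inj_on (A x) (span V)" unfolding span_eq_iff[THEN iffD2, OF V(1)] .
    then have "dim (A x ` V) = j" using dim_image_eq[OF linA] V(3) by metis
    moreover have "A x ` V \<subseteq> W" using PW by (auto simp: A_def)
    ultimately show ?thesis using True linear_subspace_image[OF linA V(1)] by (auto simp: G_def \<xi>_def grassmannian_def)
  qed (use V in \<open>auto simp: G_def \<xi>_def grassmannian_def\<close>)
  have \<xi>m: "\<xi> \<in> borel \<rightarrow>\<^sub>M plane_borel G"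
  proof (rule measurable_plane_borel)
    show "\<xi> \<in> space borel \<rightarrow> G" using \<xi>G by auto
    fix y
    have "continuous_on S (\<lambda>x. infdist y (A x ` V))"
      unfolding continuous_on_iff
    proof (intro ballI allI impI)
      fix x e assume x: "x \<in> S" and e: "(e::real) > 0"
      then obtain m where m: "m > 0" "\<And>v. v \<in> V \<Longrightarrow> m * norm v \<le> norm (A x v)" by (auto simp: S_def)
      \<comment> \<open>In one direction the lower bound is m/2, hence 2 |y| / (m/2) = 4 |y| / m.
        The 1 added to \<open>K\<close> below avoids division by 0.\<close>
      define K where "K = 4 * norm y / m"
      have K: "K \<ge> 0" using m by (simp add: K_def)
      define d where "d = min (m / 2) (e / (K + 1))"
      have d: "d > 0" using m e K by (simp add: d_def)
      have "dist (infdist y (A x' ` V)) (infdist y (A x ` V)) < e" if "dist x' x < d" for x'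
      proof -
        define \<delta> where "\<delta> = norm (x - x')"
        have \<delta>: "\<delta> < m / 2" "\<delta> < e / (K + 1)" "0 \<le> \<delta>" using that by (auto simp: d_def \<delta>_def dist_norm norm_minus_commute)
        have low': "m / 2 * norm v \<le> norm (A x' v)" if "v \<in> V" for v
        proof -
          have "norm (x - x') * norm v \<le> m / 2 * norm v" using \<delta>(1) by (intro mult_right_mono) (auto simp: \<delta>_def)
          then show ?thesis using A_diff[of x v x'] m(2)[OF that] norm_triangle_ineq2[of "A x v" "A x' v"] by linarith
        qed
        have 1: "infdist y (A x' ` V) \<le> infdist y (A x ` V) + 2 * \<delta> * norm y / m"
          by (rule infdist_image_le[OF V(1) linA m(1) \<delta>(3) m(2)]) (use A_diff in \<open>auto simp: \<delta>_def\<close>)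
        have 2: "infdist y (A x ` V) \<le> infdist y (A x' ` V) + 2 * \<delta> * norm y / (m / 2)"
          by (rule infdist_image_le[OF V(1) linA _ \<delta>(3) low']) (use A_diff[of x'] m in \<open>auto simp: \<delta>_def norm_minus_commute[of x]\<close>)
        have 3: "2 * \<delta> * norm y / (m / 2) = K * \<delta>" "2 * \<delta> * norm y / m \<le> K * \<delta>"
          using m \<delta> by (auto simp: K_def field_simps)
        have "K * \<delta> \<le> (K + 1) * \<delta>" using \<delta>(3) by (simp add: distrib_right)
        also have "\<dots> < e" using \<delta>(2) K by (simp add: field_simps)
        finally show ?thesis using 1 2 3 by (simp add: dist_real_def abs_less_iff)
      qed
      then show "\<exists>d>0. \<forall>x'\<in>S. dist x' x < d \<longrightarrow> dist (infdist y (A x' ` V)) (infdist y (A x ` V)) < e" using d by blast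
    qed
    then have "(\<lambda>x. if x \<in> S then infdist y (A x ` V) else infdist y V) \<in> borel_measurable borel"
      by (intro borel_measurable_continuous_on_if continuous_on_const) auto
    then show "(\<lambda>x. infdist y (\<xi> x)) \<in> borel_measurable borel" by (simp add: \<xi>_def if_distrib[of "infdist y"])
  qed
  have \<xi>m': "\<xi> \<in> \<nu> \<rightarrow>\<^sub>M plane_borel G" using \<xi>m by (simp add: measurable_cong_sets[OF s\<nu> refl])
  define \<mu> where "\<mu> = distr \<nu> (plane_borel G) \<xi>"
  have "distr \<mu> \<mu> (\<lambda>\<xi>. T ` \<xi>) = \<mu>" if T: "orthogonal_transformation T" and TW: "T ` W = W" for T
  proof -
    \<comment> \<open>T applied to every row. It is orthogonal because the inner product of matrices
      is the sum of the inner products of their rows.\<close>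
    define R where "R = (\<lambda>x::real^'n^'n. \<chi> b. T (x $ b))"
    have linT: "linear T" using T by (rule orthogonal_transformation_linear)
    have R: "orthogonal_transformation R"
      using T unfolding orthogonal_transformation_def R_def
      by (auto intro!: linearI simp: vec_eq_iff linear_add[OF linT] linear_scale[OF linT] inner_vec_def[of "\<chi> b. _ b"] inner_vec_def)
    have RA: "A (R x) v = T (A x v)" for x v
    proof -
      have "row_comb (R x) v = T (row_comb x v)" by (simp add: row_comb_def R_def linear_sum[OF linT] linear_scale[OF linT])
      then show ?thesis using orthogonal_closest_point[OF T TW W] by (simp add: A_def P_def)
    qed
    have RS: "R x \<in> S \<longleftrightarrow> x \<in> S" for x
      by (simp add: S_def RA orthogonal_transformation_norm[OF T] orthogonal_transformation_norm[OF R])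
    have R\<xi>: "\<xi> (R x) = T ` \<xi> x" if "x \<in> S" for x using that RS by (simp add: \<xi>_def RA image_image)
    have Rm[measurable]: "R \<in> borel \<rightarrow>\<^sub>M borel"
      using linear_continuous_on[of R UNIV] orthogonal_transformation_linear[OF R]
      by (intro borel_measurable_continuous_onI) (simp add: linear_linear)
    have R\<nu>: "distr \<nu> \<nu> R = \<nu>"
    proof (rule measure_eqI)
      fix X assume "X \<in> sets (distr \<nu> \<nu> R)"
      then have X[measurable]: "X \<in> sets borel" by (simp add: s\<nu>)
      have "emeasure (distr \<nu> \<nu> R) X = emeasure \<nu> (R -` X)"
        using X by (subst emeasure_distr) (auto simp: s\<nu> measurable_cong_sets[OF s\<nu> s\<nu>] \<nu>_def)
      also have "\<dots> = emeasure lborel (S \<inter> R -` X) / emeasure lborel S"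
        using measurable_sets[OF Rm X] by (simp add: \<nu>_def)
      also have "S \<inter> R -` X = R -` (S \<inter> X)" using RS by auto
      also have "emeasure lborel (R -` (S \<inter> X)) = emeasure (distr lborel borel R) (S \<inter> X)"
        by (subst emeasure_distr) auto
      also have "\<dots> = emeasure lborel (S \<inter> X)" by (simp add: lborel_orthogonal[OF R])
      also have "emeasure lborel (S \<inter> X) / emeasure lborel S = emeasure \<nu> X" by (simp add: \<nu>_def)
      finally show "emeasure (distr \<nu> \<nu> R) X = emeasure \<nu> X" .
    qed simp
    have Tm: "(\<lambda>\<xi>. T ` \<xi>) \<in> plane_borel G \<rightarrow>\<^sub>M plane_borel G" unfolding G_def by (rule measurable_image_plane[OF T TW])
    have Rm': "R \<in> \<nu> \<rightarrow>\<^sub>M \<nu>" using Rm by (simp add: measurable_cong_sets[OF s\<nu> s\<nu>])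
    have "distr \<mu> \<mu> (\<lambda>\<xi>. T ` \<xi>) = distr \<mu> (plane_borel G) (\<lambda>\<xi>. T ` \<xi>)" by (rule distr_cong) (auto simp: \<mu>_def)
    also have "\<dots> = distr \<nu> (plane_borel G) (\<lambda>x. T ` \<xi> x)"
      unfolding \<mu>_def by (subst distr_distr[OF Tm \<xi>m']) (simp add: comp_def)
    also have "\<dots> = distr \<nu> (plane_borel G) (\<lambda>x. \<xi> (R x))"
    proof (rule distr_cong_AE)
      have "AE x in \<nu>. x \<in> S" unfolding \<nu>_def by (rule AE_uniform_measureI) auto
      then show "AE x in \<nu>. T ` \<xi> x = \<xi> (R x)" by eventually_elim (simp add: R\<xi>)
      show "(\<lambda>x. T ` \<xi> x) \<in> \<nu> \<rightarrow>\<^sub>M plane_borel G" using measurable_compose[OF \<xi>m' Tm] .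
      show "(\<lambda>x. \<xi> (R x)) \<in> \<nu> \<rightarrow>\<^sub>M plane_borel G" using measurable_compose[OF Rm' \<xi>m'] .
    qed auto
    also have "\<dots> = distr (distr \<nu> \<nu> R) (plane_borel G) \<xi>"
      by (subst distr_distr[OF \<xi>m' Rm']) (simp add: comp_def)
    finally show ?thesis by (simp add: R\<nu> \<mu>_def)
  qed
  moreover have "prob_space \<mu>" unfolding \<mu>_def by (rule \<nu>.prob_space_distr[OF \<xi>m'])
  ultimately have "invariant_prob W j \<mu>" by (auto simp: invariant_prob_def \<mu>_def G_def)
  then show ?thesis ..
qed

lemma invariant_grassmann_measure:
  fixes W :: "(real^'n) set"
  assumes "subspace W" "j \<le> dim W"
  shows "invariant_prob W j (grassmann_measure W j)"
  unfolding grassmann_measure_def using someI_ex[OF invariant_prob_exists[OF assms]] .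

section \<open>Distance from a point to a random subspace\<close>

lemma infdist_scale:
  fixes \<xi> :: "'a::euclidean_space set"
  assumes \<xi>: "subspace \<xi>"
  shows "infdist (c *\<^sub>R v) \<xi> = \<bar>c\<bar> * infdist v \<xi>"
proof -
  obtain y z where yz: "y \<in> \<xi>" "z \<in> \<xi>\<^sup>\<bottom>" "v = y + z" using orthogonal_decomp[OF \<xi>] .
  have "c *\<^sub>R y \<in> \<xi>" "c *\<^sub>R z \<in> \<xi>\<^sup>\<bottom>" using yz \<xi> subspace_orthogonal_comp by (auto intro: subspace_scale)
  then have "infdist (c *\<^sub>R y + c *\<^sub>R z) \<xi> = norm (c *\<^sub>R z)" by (rule infdist_orthogonal_sum[OF \<xi>])
  moreover have "infdist (y + z) \<xi> = norm z" using yz by (intro infdist_orthogonal_sum[OF \<xi>])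
  ultimately show ?thesis using yz by (simp add: scaleR_add_right)
qed

text \<open>The reflection in the hyperplane orthogonal to w = v - v'. It sends v to v' because the
  norms agree, and it preserves W because w lies in W.\<close>

lemma reflection_between:
  fixes v v' :: "'a::euclidean_space"
  assumes W: "subspace W" "v \<in> W" "v' \<in> W" and n: "norm v = norm v'"
  obtains T where "orthogonal_transformation T" "T ` W = W" "T v = v'"
proof (cases "v = v'")
  case True
  then show ?thesis using that[of "\<lambda>x. x"] by simp
next
  case False
  define w where "w = v - v'"
  define q where "q = w \<bullet> w"
  define T where "T = (\<lambda>x. x - (2 * (x \<bullet> w) / q) *\<^sub>R w)"
  have q: "q \<noteq> 0" using False by (simp add: q_def w_def)
  have T: "orthogonal_transformation T"
    unfolding orthogonal_transformation_def
  proof (intro conjI allI)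
    show "linear T" by (auto intro!: linearI simp: T_def algebra_simps add_divide_distrib)
    fix x y
    have "T x \<bullet> T y = x \<bullet> y - 2 * (y \<bullet> w) / q * (x \<bullet> w) - 2 * (x \<bullet> w) / q * (w \<bullet> y) + (2 * (x \<bullet> w) / q) * (2 * (y \<bullet> w) / q) * q"
      by (simp add: T_def inner_diff_left inner_diff_right q_def)
    also have "\<dots> = x \<bullet> y" using q by (simp add: inner_commute[of w] field_simps)
    finally show "T x \<bullet> T y = x \<bullet> y" .
  qed
  have TT: "T (T x) = x" for x
  proof -
    have "T x \<bullet> w = - (x \<bullet> w)" using q by (simp add: T_def inner_diff_left q_def)
    then show ?thesis by (simp add: T_def)
  qed
  have TW: "T x \<in> W" if "x \<in> W" for x
    using that W by (auto simp: T_def w_def intro!: subspace_diff subspace_scale)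
  have "T ` W = W" using TT TW by (metis image_eqI image_subsetI subsetI subset_antisym)
  moreover have "T v = v'"
  proof -
    have "v \<bullet> v = v' \<bullet> v'" using n by (simp add: norm_eq_sqrt_inner)
    then have "2 * (v \<bullet> w) = q" by (simp add: w_def q_def inner_diff_left inner_diff_right inner_commute)
    then show ?thesis using q by (simp add: T_def w_def)
  qed
  ultimately show ?thesis using that T by blast
qed

lemma onb_sub_Un:
  fixes \<xi> W :: "'a::euclidean_space set"
  assumes W: "subspace W" and \<xi>: "\<xi> \<subseteq> W" and B: "onb B \<xi>" and C: "onb C (W \<inter> \<xi>\<^sup>\<bottom>)"
  shows "onb (C \<union> B) W" "C \<inter> B = {}"
proof -
  have s\<xi>: "subspace \<xi>" using B by (rule onb_subspace)
  have BW: "B \<subseteq> W" "C \<subseteq> W" "C \<subseteq> \<xi>\<^sup>\<bottom>" "B \<subseteq> \<xi>" using B C \<xi> by (auto simp: onb_def)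
  have orth: "orthogonal x y" "orthogonal y x" if "x \<in> B" "y \<in> C" for x y
  proof -
    have "x \<in> \<xi>" "y \<in> \<xi>\<^sup>\<bottom>" using that BW by auto
    then show "orthogonal x y" "orthogonal y x" by (auto simp: orthogonal_comp_def orthogonal_commute)
  qed
  show "C \<inter> B = {}"
  proof (rule ccontr)
    assume "C \<inter> B \<noteq> {}"
    then obtain b where b: "b \<in> B" "b \<in> C" by auto
    then have "b \<bullet> b = 0" using orth[of b b] by (simp add: orthogonal_def)
    moreover have "norm b = 1" using b B by (simp add: onb_def)
    ultimately show False by simp
  qed
  have "span (C \<union> B) = W"
  proof (rule antisym)
    show "span (C \<union> B) \<subseteq> W" using BW W by (intro span_minimal) auto
    show "W \<subseteq> span (C \<union> B)"
    proof
      fix x assume x: "x \<in> W"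
      obtain y z where yz: "y \<in> \<xi>" "z \<in> \<xi>\<^sup>\<bottom>" "x = y + z" using orthogonal_decomp[OF s\<xi>] .
      have "z = x - y" using yz by simp
      then have "z \<in> W" using x yz(1) \<xi> W by (auto intro: subspace_diff)
      then have "z \<in> span C" using yz C by (auto simp: onb_def)
      moreover have "y \<in> span B" using yz B by (auto simp: onb_def)
      ultimately show "x \<in> span (C \<union> B)"
        using span_mono[of B "C \<union> B"] span_mono[of C "C \<union> B"] span_add[of y "C \<union> B" z] yz(3) by auto
    qed
  qed
  moreover have "pairwise orthogonal (C \<union> B)"
  proof (rule pairwiseI)
    fix x y assume xy: "x \<in> C \<union> B" "y \<in> C \<union> B" "x \<noteq> y"
    have "pairwise orthogonal B" "pairwise orthogonal C" using B C by (auto simp: onb_def)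
    then have "orthogonal x y" if "x \<in> B \<and> y \<in> B \<or> x \<in> C \<and> y \<in> C"
      using that xy(3) by (auto simp: pairwise_def)
    then show "orthogonal x y" using xy orth by blast
  qed
  ultimately show "onb (C \<union> B) W" using B C BW by (auto simp: onb_def)
qed

lemma dim_orthogonal_in:
  fixes \<xi> W :: "'a::euclidean_space set"
  assumes "subspace W" "subspace \<xi>" "\<xi> \<subseteq> W"
  shows "dim (W \<inter> \<xi>\<^sup>\<bottom>) + dim \<xi> = dim W"
  using dim_subspace_orthogonal_to_vectors[OF assms(2,1,3)]
  by (simp add: orthogonal_comp_def Int_def Collect_conj_eq[symmetric] conj_commute)

lemma nn_integral_lam_norm:
  fixes B :: "'a::euclidean_space set"
  assumes B: "onb B W" and d: "0 < dim W" and x: "0 \<le> x" and h[measurable]: "h \<in> borel_measurable borel"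
  shows "(\<integral>\<^sup>+u. h (sqrt ((norm u)\<^sup>2 + x\<^sup>2)) \<partial>lam B) = (\<integral>\<^sup>+r. ennreal (pi powr (real (dim W) / 2) * ekm (real (dim W) / 2) x r) * h r \<partial>lborel)"
proof -
  have "(\<integral>\<^sup>+u. h (sqrt ((norm u)\<^sup>2 + x\<^sup>2)) \<partial>lam B) = (\<integral>\<^sup>+r. h r \<partial>distr (lam B) borel (\<lambda>u. sqrt ((norm u)\<^sup>2 + x\<^sup>2)))"
    by (rule nn_integral_distr[symmetric]) measurable
  also have "\<dots> = (\<integral>\<^sup>+r. ennreal (pi powr (real (dim W) / 2) * ekm (real (dim W) / 2) x r) * h r \<partial>lborel)"
    unfolding distr_lam_norm[OF B d x] by (rule nn_integral_density) measurable
  finally show ?thesis .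
qed

text \<open>Homogeneity: with b = r t the product of the two radial densities separates into a power
  of r and a function of t. Hence the ratio t = b / r is independent of the radius r.\<close>

lemma ekm_ekm_scaled:
  assumes r: "0 < r"
  shows "r * ekm a 0 (r * t) * ekm b (r * t) r = 2 / Gamma a * r powr (2 * (a + b) - 1) * (ekp b 1 t * t powr (2 * a - 2))"
proof (cases "0 < t \<and> t < 1")
  case False
  then have "ekm a 0 (r * t) = 0 \<or> ekm b (r * t) r = 0" "ekp b 1 t = 0"
    using r by (auto simp: ekm_def ekp_def zero_less_mult_iff not_less)
  then show ?thesis by auto
next
  case True
  then have rt: "0 < r * t" "r * t < r" using r by auto
  have t1: "0 < 1 - t\<^sup>2" using True by (simp add: power_strict_mono[of t 1 2, simplified])
  have "((r * t)\<^sup>2) powr (a - 1) = r powr (2 * a - 2) * t powr (2 * a - 2)"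
    using power2_powr[OF rt(1), of "a - 1"] r True by (simp add: powr_mult algebra_simps)
  then have e1: "ekm a 0 (r * t) = 2 / Gamma a * (r powr (2 * a - 2) * t powr (2 * a - 2)) * (r * t)"
    using rt by (simp add: ekm_def)
  have "r\<^sup>2 - (r * t)\<^sup>2 = r\<^sup>2 * (1 - t\<^sup>2)" by (simp add: power_mult_distrib algebra_simps)
  then have "(r\<^sup>2 - (r * t)\<^sup>2) powr (b - 1) = (r\<^sup>2) powr (b - 1) * (1 - t\<^sup>2) powr (b - 1)"
    using t1 by (simp add: powr_mult)
  also have "(r\<^sup>2) powr (b - 1) = r powr (2 * b - 2)" using power2_powr[OF r, of "b - 1"] by (simp add: algebra_simps)
  finally have e2: "ekm b (r * t) r = 2 / Gamma b * (r powr (2 * b - 2) * (1 - t\<^sup>2) powr (b - 1)) * r"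
    using rt by (simp add: ekm_def)
  have e3: "ekp b 1 t = 2 / Gamma b * (1 - t\<^sup>2) powr (b - 1) * t"
    using True by (simp add: ekp_def)
  have "r powr 1 * r powr 1 * r powr 1 * r powr (2 * a - 2) * r powr (2 * b - 2) = r powr (2 * (a + b) - 1)"
    unfolding powr_add[symmetric] by (rule arg_cong[of _ _ "\<lambda>z. r powr z"]) simp
  then have ra: "r * r * r * r powr (2 * a - 2) * r powr (2 * b - 2) = r powr (2 * (a + b) - 1)"
    using r by simp
  show ?thesis unfolding e1 e2 e3 ra[symmetric] by (simp only: mult_ac)
qed

section \<open>Law of the distance under an arbitrary invariant probability\<close>

context
  fixes W :: "(real^'n) set" and j :: nat and \<mu> :: "(real^'n) set measure"
  assumes W: "subspace W" and j: "0 < j" "j < dim W" and inv: "invariant_prob W j \<mu>"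
begin

lemma mu_prob: "prob_space \<mu>" and mu_space: "space \<mu> = grassmannian W j"
  and mu_sets[measurable_cong]: "sets \<mu> = sets (plane_borel (grassmannian W j))"
  using inv by (auto simp: invariant_prob_def)

lemma mu_rotation_invariant:
  assumes v: "v \<in> W" "v' \<in> W" "norm v = norm v'" and F[measurable]: "F \<in> borel_measurable borel"
  shows "(\<integral>\<^sup>+\<xi>. F (infdist v \<xi>) \<partial>\<mu>) = (\<integral>\<^sup>+\<xi>. F (infdist v' \<xi>) \<partial>\<mu>)"
proof -
  obtain T where T: "orthogonal_transformation T" "T ` W = W" "T v = v'"
    using reflection_between[OF W v] .
  have Tm: "(\<lambda>\<xi>. T ` \<xi>) \<in> \<mu> \<rightarrow>\<^sub>M \<mu>"
    using measurable_image_plane[OF T(1,2), of j] by (simp add: measurable_cong_sets[OF mu_sets mu_sets])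
  have m: "(\<lambda>\<xi>. F (infdist v' \<xi>)) \<in> borel_measurable \<mu>" by measurable
  have "(\<integral>\<^sup>+\<xi>. F (infdist v' \<xi>) \<partial>\<mu>) = (\<integral>\<^sup>+\<xi>. F (infdist v' \<xi>) \<partial>distr \<mu> \<mu> (\<lambda>\<xi>. T ` \<xi>))"
    using inv T by (simp add: invariant_prob_def)
  also have "\<dots> = (\<integral>\<^sup>+\<xi>. F (infdist v' (T ` \<xi>)) \<partial>\<mu>)" by (rule nn_integral_distr[OF Tm]) (use m in simp)
  also have "\<dots> = (\<integral>\<^sup>+\<xi>. F (infdist v \<xi>) \<partial>\<mu>)"
    using infdist_orthogonal_image[OF T(1), of v] T(3) by simp
  finally show ?thesis ..
qed

text \<open>Subspaces are invariant under scaling, which reduces the ratio to unit vectors; rotation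
  invariance identifies these.\<close>

lemma mu_ratio_const:
  assumes v: "v \<in> W" "v \<noteq> 0" and v': "v' \<in> W" "v' \<noteq> 0" and F[measurable]: "F \<in> borel_measurable borel"
  shows "(\<integral>\<^sup>+\<xi>. F (infdist v \<xi> / norm v) \<partial>\<mu>) = (\<integral>\<^sup>+\<xi>. F (infdist v' \<xi> / norm v') \<partial>\<mu>)"
proof -
  have "(\<integral>\<^sup>+\<xi>. F (infdist u \<xi> / norm u) \<partial>\<mu>) = (\<integral>\<^sup>+\<xi>. F (infdist (u /\<^sub>R norm u) \<xi>) \<partial>\<mu>)" for u
  proof (rule nn_integral_cong)
    fix \<xi> assume "\<xi> \<in> space \<mu>"
    then have "subspace \<xi>" by (simp add: mu_space grassmannian_def)
    then show "F (infdist u \<xi> / norm u) = F (infdist (u /\<^sub>R norm u) \<xi>)" by (simp add: infdist_scale divide_inverse mult.commute)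
  qed
  moreover have "(\<integral>\<^sup>+\<xi>. F (infdist (v /\<^sub>R norm v) \<xi>) \<partial>\<mu>) = (\<integral>\<^sup>+\<xi>. F (infdist (v' /\<^sub>R norm v') \<xi>) \<partial>\<mu>)"
    by (rule mu_rotation_invariant) (use v v' W in \<open>auto intro: subspace_scale\<close>)
  ultimately show ?thesis by simp
qed

text \<open>Polar coordinates in W relate the radial integral to the volume of the unit ball. The
  radial integral is cancelled later, hence the claims that it is nonzero and finite.\<close>

lemma nn_integral_powr_fin:
  defines "d \<equiv> dim W"
  defines "R \<equiv> (\<integral>\<^sup>+r. ennreal (indicator {0<..1} r * r powr (real d - 1)) \<partial>lborel)"
  shows "ennreal (pi powr (real d / 2) * (2 / Gamma (real d / 2))) * R = ennreal (unit_ball_vol (real d))" "R \<noteq> 0" "R \<noteq> top"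
proof -
  have d: "0 < d" using j by (simp add: d_def)
  have G: "Gamma (real d / 2) > 0" using d by (intro Gamma_real_pos) auto
  obtain B where B: "onb B W" using onb_exists[OF W] by blast
  have "ennreal (unit_ball_vol (real d)) = (\<integral>\<^sup>+u. indicator {..1::real} (sqrt ((norm u)\<^sup>2 + 0\<^sup>2)) \<partial>lam B)"
  proof -
    have "(\<integral>\<^sup>+u. indicator {..1::real} (sqrt ((norm u)\<^sup>2 + 0\<^sup>2)) \<partial>lam B) = (\<integral>\<^sup>+u. indicator (cball 0 1) u \<partial>lam B)"
      by (intro nn_integral_cong) (simp add: indicator_def)
    also have "\<dots> = emeasure (lam B) (cball 0 1)" by simp
    also have "\<dots> = ennreal (unit_ball_vol (real d))" by (subst emeasure_lam_cball[OF B]) (auto simp: d_def)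
    finally show ?thesis ..
  qed
  also have "\<dots> = (\<integral>\<^sup>+r. ennreal (pi powr (real d / 2) * ekm (real d / 2) 0 r) * indicator {..1} r \<partial>lborel)"
    unfolding d_def by (rule nn_integral_lam_norm[OF B]) (use d in \<open>auto simp: d_def\<close>)
  also have "\<dots> = (\<integral>\<^sup>+r. ennreal (pi powr (real d / 2) * (2 / Gamma (real d / 2))) * ennreal (indicator {0<..1} r * r powr (real d - 1)) \<partial>lborel)"
  proof (rule nn_integral_cong)
    fix r :: real
    show "ennreal (pi powr (real d / 2) * ekm (real d / 2) 0 r) * indicator {..1} r = ennreal (pi powr (real d / 2) * (2 / Gamma (real d / 2))) * ennreal (indicator {0<..1} r * r powr (real d - 1))"
    proof (cases "0 < r \<and> r \<le> 1")
      case True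
      have "(r\<^sup>2) powr (real d / 2 - 1) * r = r powr (2 * (real d / 2 - 1)) * r powr 1"
        using True by (simp add: power2_powr)
      also have "\<dots> = r powr (real d - 1)"
        unfolding powr_add[symmetric] by (rule arg_cong[of _ _ "\<lambda>z. r powr z"]) simp
      finally have "pi powr (real d / 2) * ekm (real d / 2) 0 r = pi powr (real d / 2) * (2 / Gamma (real d / 2)) * r powr (real d - 1)"
        using True by (simp add: ekm_def)
      then show ?thesis using True G by (simp add: ennreal_mult'[symmetric])
    next
      case False
      then show ?thesis by (auto simp: ekm_def indicator_def)
    qed
  qed
  also have "\<dots> = ennreal (pi powr (real d / 2) * (2 / Gamma (real d / 2))) * R"
    unfolding R_def by (rule nn_integral_cmult) measurable
  finally show eq: "ennreal (pi powr (real d / 2) * (2 / Gamma (real d / 2))) * R = ennreal (unit_ball_vol (real d))" ..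
  have vp: "unit_ball_vol (real d) > 0" by simp
  then show "R \<noteq> 0" using eq by (metis ennreal_eq_zero_iff less_eq_real_def mult_zero_right not_less)
  show "R \<noteq> top"
  proof
    assume "R = top"
    moreover have "ennreal (pi powr (real d / 2) * (2 / Gamma (real d / 2))) \<noteq> 0" using G by (simp add: ennreal_eq_0_iff not_le)
    ultimately show False using eq by (simp add: ennreal_mult_top)
  qed
qed

text \<open>For fixed \<xi> a vector of W splits as y + x with y orthogonal to \<xi> and x in \<xi>,
  and the ratio is |y| / |y + x|. The density of |y|, in dimension dim W - j, and that of the full
  norm given |y| are kernels of right-sided integrals; taking the ratio as variable separates
  them.\<close>

lemma mu_ratio_integral:
  assumes v: "v \<in> W" "v \<noteq> 0" and F[measurable]: "F \<in> borel_measurable borel"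
  shows "(\<integral>\<^sup>+\<xi>. F (infdist v \<xi> / norm v) \<partial>\<mu>) =
    (\<integral>\<^sup>+t. ennreal (Gamma (real (dim W) / 2) / Gamma ((real (dim W) - real j) / 2) * ekp (real j / 2) 1 t * t powr (real (dim W) - real j - 2)) * F t \<partial>lborel)"
proof -
  interpret mu: prob_space \<mu> by (rule mu_prob)
  define d where "d = dim W"
  define e where "e = d - j"
  have de: "0 < e" "0 < d" "real e = real d - real j" using j by (auto simp: d_def e_def)
  have G: "Gamma (real d / 2) > 0" "Gamma (real e / 2) > 0" "Gamma (real j / 2) > 0" using de j by (auto intro!: Gamma_real_pos)
  let ?P = "\<lambda>b. ennreal (pi powr (real e / 2) * ekm (real e / 2) 0 b)"
  let ?Q = "\<lambda>b r. ennreal (pi powr (real j / 2) * ekm (real j / 2) b r)"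
  let ?I = "\<lambda>r::real. ennreal (indicator {0<..1} r * r powr (real d - 1))"
  let ?G = "\<lambda>t. Gamma (real d / 2) / Gamma ((real d - real j) / 2) * ekp (real j / 2) 1 t * t powr (real d - real j - 2)"
  let ?h = "\<lambda>x y :: real^'n. sqrt ((norm x)\<^sup>2 + (norm y)\<^sup>2)"
  obtain B where B: "onb B W" using onb_exists[OF W] by blast
  interpret l: sigma_finite_measure "lam B" by (rule sigma_finite_lam[OF B])
  interpret p: pair_sigma_finite "lam B" \<mu> by standard
  have [measurable]: "cball (0::real^'n) 1 \<in> sets borel" by simp
  define K where "K = (\<integral>\<^sup>+\<xi>. F (infdist v \<xi> / norm v) \<partial>\<mu>)"
  define R where "R = (\<integral>\<^sup>+r. ?I r \<partial>lborel)"
  define D where "D = (\<lambda>t. 2 / Gamma (real e / 2) * ekp (real j / 2) 1 t * t powr (real e - 2))"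
  define A where "A = pi powr (real d / 2)"
  have A: "A > 0" by (simp add: A_def)
  have D0: "0 \<le> D t" for t using G j by (simp add: D_def)
  have [measurable]: "D \<in> borel_measurable borel" unfolding D_def by measurable
  let ?J = "\<integral>\<^sup>+t. ennreal (D t) * F t \<partial>lborel"
  \<comment> \<open>At the origin the ratio is 0/0, so constancy of the \<mu>-integral is available
    for nonzero vectors.\<close>
  have AE0: "AE u in lam B. u \<noteq> 0"
  proof -
    have "emeasure (lam B) {0} \<le> 0"
    proof (rule ennreal_le_epsilon)
      fix c :: real assume c: "0 < c"
      define V where "V = unit_ball_vol (real d)"
      have V: "V > 0" by (simp add: V_def)
      define r where "r = min 1 (c / V)"
      have r: "0 < r" "r \<le> 1" "V * r \<le> c" using c V by (auto simp: r_def min_def field_simps)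
      have "emeasure (lam B) {0} \<le> emeasure (lam B) (cball 0 r)" using r by (intro emeasure_mono) auto
      also have "\<dots> = ennreal (V * r ^ d)" using emeasure_lam_cball[OF B r(1)] by (simp add: V_def d_def)
      also have "\<dots> \<le> ennreal (V * r)"
        using V r de power_decreasing[of 1 d r] by (intro ennreal_leI mult_left_mono) auto
      also have "\<dots> \<le> ennreal c" using r by (intro ennreal_leI)
      finally show "emeasure (lam B) {0} \<le> 0 + ennreal c" by simp
    qed
    then have "{0} \<in> null_sets (lam B)" by (simp add: null_sets_def)
    then show ?thesis by (rule AE_not_in[THEN eventually_mono]) simp
  qed
  have "K * ennreal (unit_ball_vol (real d)) = (\<integral>\<^sup>+u. K * indicator (cball 0 1) u \<partial>lam B)"
    using emeasure_lam_cball[OF B, of 1] by (simp add: nn_integral_cmult_indicator d_def)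
  also have "\<dots> = (\<integral>\<^sup>+u. (\<integral>\<^sup>+\<xi>. F (infdist u \<xi> / norm u) * indicator (cball 0 1) u \<partial>\<mu>) \<partial>lam B)"
  proof (rule nn_integral_cong_AE)
    show "AE u in lam B. K * indicator (cball 0 1) u = (\<integral>\<^sup>+\<xi>. F (infdist u \<xi> / norm u) * indicator (cball 0 1) u \<partial>\<mu>)"
      using AE0 AE_lam_mem[OF B]
    proof eventually_elim
      case (elim u)
      have "(\<integral>\<^sup>+\<xi>. F (infdist u \<xi> / norm u) * indicator (cball 0 1) u \<partial>\<mu>) = (\<integral>\<^sup>+\<xi>. F (infdist u \<xi> / norm u) \<partial>\<mu>) * indicator (cball 0 1) u"
        by (rule nn_integral_multc) measurable
      then show ?case using mu_ratio_const[OF v elim(2,1) F] by (simp add: K_def)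
    qed
  qed
  also have "\<dots> = (\<integral>\<^sup>+\<xi>. (\<integral>\<^sup>+u. F (infdist u \<xi> / norm u) * indicator (cball 0 1) u \<partial>lam B) \<partial>\<mu>)"
    by (rule p.Fubini'[symmetric]) measurable
  also have "\<dots> = (\<integral>\<^sup>+\<xi>. ennreal A * R * ?J \<partial>\<mu>)"
  proof (rule nn_integral_cong)
    fix \<xi> assume "\<xi> \<in> space \<mu>"
    then have \<xi>: "subspace \<xi>" "dim \<xi> = j" "\<xi> \<subseteq> W" by (auto simp: mu_space grassmannian_def)
    obtain B1 where B1: "onb B1 \<xi>" using onb_exists[OF \<xi>(1)] by blast
    have "subspace (W \<inter> \<xi>\<^sup>\<bottom>)" using W subspace_orthogonal_comp by (intro subspace_inter)
    then obtain B2 where B2: "onb B2 (W \<inter> \<xi>\<^sup>\<bottom>)" using onb_exists by blast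
    have dim2: "dim (W \<inter> \<xi>\<^sup>\<bottom>) = e" using dim_orthogonal_in[OF W \<xi>(1,3)] \<xi>(2) by (simp add: e_def d_def)
    have lamB: "lam B = lam (B2 \<union> B1)" using lam_cong[OF B onb_sub_Un(1)[OF W \<xi>(3) B1 B2]] .
    have [measurable]: "{u. norm u \<le> 1} \<in> sets borel" by measurable
    have "(\<integral>\<^sup>+u. F (infdist u \<xi> / norm u) * indicator (cball 0 1) u \<partial>lam B)
      = (\<integral>\<^sup>+y. \<integral>\<^sup>+x. F (infdist (y + x) \<xi> / norm (y + x)) * indicator (cball 0 1) (y + x) \<partial>lam B1 \<partial>lam B2)"
      unfolding lamB by (rule nn_integral_lam_Un) (use onb_finite[OF B1] onb_finite[OF B2] onb_sub_Un(2)[OF W \<xi>(3) B1 B2] in measurable)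
    also have "\<dots> = (\<integral>\<^sup>+y. \<integral>\<^sup>+x. F (norm y / ?h x y) * indicator {..1} (?h x y) \<partial>lam B1 \<partial>lam B2)"
    proof (rule nn_integral_cong_AE)
      show "AE y in lam B2. (\<integral>\<^sup>+x. F (infdist (y + x) \<xi> / norm (y + x)) * indicator (cball 0 1) (y + x) \<partial>lam B1) =
        (\<integral>\<^sup>+x. F (norm y / ?h x y) * indicator {..1} (?h x y) \<partial>lam B1)"
        using AE_lam_mem[OF B2]
      proof eventually_elim
        case (elim y)
        show ?case
        proof (rule nn_integral_cong_AE)
          show "AE x in lam B1. F (infdist (y + x) \<xi> / norm (y + x)) * indicator (cball 0 1) (y + x) =
            F (norm y / ?h x y) * indicator {..1} (?h x y)"
            using AE_lam_mem[OF B1]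
          proof eventually_elim
            case (elim x)
            have y: "y \<in> \<xi>\<^sup>\<bottom>" using \<open>y \<in> W \<inter> \<xi>\<^sup>\<bottom>\<close> by simp
            have "orthogonal x y" using elim y by (auto simp: orthogonal_comp_def)
            then have "(norm (x + y))\<^sup>2 = (norm x)\<^sup>2 + (norm y)\<^sup>2" by (rule norm_add_Pythagorean)
            then have n: "norm (y + x) = ?h x y" by (metis add.commute norm_ge_zero real_sqrt_unique)
            have "infdist (y + x) \<xi> = norm y" using infdist_orthogonal_sum[OF \<xi>(1) elim y] by (simp add: add.commute)
            then show ?case by (simp add: n[symmetric] indicator_def)
          qed
        qed
      qed
    qed
    also have "\<dots> = (\<integral>\<^sup>+y. (\<integral>\<^sup>+r. ?Q (norm y) r * (F (norm y / r) * indicator {..1} r) \<partial>lborel) \<partial>lam B2)"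
    proof (rule nn_integral_cong)
      fix y :: "real^'n"
      have "(\<lambda>r. F (norm y / r) * indicator {..1} r) \<in> borel_measurable borel" by measurable
      from nn_integral_lam_norm[OF B1 _ _ this, of "norm y"] j \<xi>(2)
      show "(\<integral>\<^sup>+x. F (norm y / ?h x y) * indicator {..1} (?h x y) \<partial>lam B1) =
        (\<integral>\<^sup>+r. ?Q (norm y) r * (F (norm y / r) * indicator {..1} r) \<partial>lborel)" by simp
    qed
    also have "\<dots> = (\<integral>\<^sup>+y. (\<lambda>b. \<integral>\<^sup>+r. ?Q b r * (F (b / r) * indicator {..1} r) \<partial>lborel) (sqrt ((norm y)\<^sup>2 + 0\<^sup>2)) \<partial>lam B2)"
      by simp
    also have "\<dots> = (\<integral>\<^sup>+b. ?P b * (\<integral>\<^sup>+r. ?Q b r * (F (b / r) * indicator {..1} r) \<partial>lborel) \<partial>lborel)"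
      by (subst nn_integral_lam_norm[OF B2]) (use dim2 de in auto)
    also have "\<dots> = (\<integral>\<^sup>+b. \<integral>\<^sup>+r. ?P b * (?Q b r * (F (b / r) * indicator {..1} r)) \<partial>lborel \<partial>lborel)"
      by (intro nn_integral_cong nn_integral_cmult[symmetric]) measurable
    also have "\<dots> = (\<integral>\<^sup>+r. \<integral>\<^sup>+b. ?P b * (?Q b r * (F (b / r) * indicator {..1} r)) \<partial>lborel \<partial>lborel)"
      by (rule lborel_pair.Fubini') measurable
    also have "\<dots> = (\<integral>\<^sup>+r. ennreal A * ?I r * ?J \<partial>lborel)"
    proof (rule nn_integral_cong)
      fix r :: real
      show "(\<integral>\<^sup>+b. ?P b * (?Q b r * (F (b / r) * indicator {..1} r)) \<partial>lborel)
        = ennreal A * ?I r * ?J"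
      proof (cases "0 < r \<and> r \<le> 1")
        case False
        have z: "?P b * (?Q b r * (F (b / r) * indicator {..1} r)) = 0" for b
          using False by (auto simp: ekm_def indicator_def)
        have "?I r = 0" using False by (auto simp: indicator_def)
        then show ?thesis by (simp only: z) simp
      next
        case True
        then have r: "0 < r" by simp
        \<comment> \<open>The substitution b = r t at fixed r, after which
          \<open>ekm_ekm_scaled\<close> splits the product of densities.\<close>
        have "(\<integral>\<^sup>+b. ?P b * (?Q b r * (F (b / r) * indicator {..1} r)) \<partial>lborel)
          = ennreal \<bar>r\<bar> * (\<integral>\<^sup>+t. ?P (0 + r * t) * (?Q (0 + r * t) r * (F ((0 + r * t) / r) * indicator {..1} r)) \<partial>lborel)"
          by (rule nn_integral_real_affine) (use r in auto)
        also have "\<dots> = (\<integral>\<^sup>+t. ennreal \<bar>r\<bar> * (?P (0 + r * t) * (?Q (0 + r * t) r * (F ((0 + r * t) / r) * indicator {..1} r))) \<partial>lborel)"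
          by (rule nn_integral_cmult[symmetric]) measurable
        also have "\<dots> = (\<integral>\<^sup>+t. ennreal A * ?I r * (ennreal (D t) * F t) \<partial>lborel)"
        proof (rule nn_integral_cong)
          fix t :: real
          have nn: "0 \<le> pi powr (real e / 2) * ekm (real e / 2) 0 (r * t)" "0 \<le> pi powr (real j / 2) * ekm (real j / 2) (r * t) r"
            using de j by (simp_all add: zero_le_mult_iff)
          have pa: "pi powr (real e / 2) * pi powr (real j / 2) = A"
            using de(3) by (simp add: A_def powr_add[symmetric] field_simps)
          have ea: "2 * (real e / 2 + real j / 2) - 1 = real d - 1" "2 * (real e / 2) - 2 = real e - 2"
            using de(3) by argo+
          have "r * (pi powr (real e / 2) * ekm (real e / 2) 0 (r * t)) * (pi powr (real j / 2) * ekm (real j / 2) (r * t) r)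
            = (pi powr (real e / 2) * pi powr (real j / 2)) * (r * ekm (real e / 2) 0 (r * t) * ekm (real j / 2) (r * t) r)"
            by (simp only: mult_ac)
          also have "\<dots> = A * r powr (real d - 1) * D t"
            unfolding pa ekm_ekm_scaled[OF r] ea D_def by (simp only: mult_ac)
          finally have "r * (pi powr (real e / 2) * ekm (real e / 2) 0 (r * t)) * (pi powr (real j / 2) * ekm (real j / 2) (r * t) r) = A * r powr (real d - 1) * D t" .
          then have eq: "ennreal r * ?P (r * t) * ?Q (r * t) r
            = ennreal A * ennreal (r powr (real d - 1)) * ennreal (D t)"
            using r nn A D0[of t] by (simp only: ennreal_mult'[symmetric] mult_nonneg_nonneg less_imp_le powr_ge_zero)
          have "ennreal \<bar>r\<bar> * (?P (0 + r * t) * (?Q (0 + r * t) r * (F ((0 + r * t) / r) * indicator {..1} r)))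
            = (ennreal r * ?P (r * t) * ?Q (r * t) r) * F t"
            using True by (simp add: mult.assoc)
          also have "\<dots> = ennreal A * ?I r * (ennreal (D t) * F t)"
            unfolding eq using True by (simp add: mult.assoc)
          finally show "ennreal \<bar>r\<bar> * (?P (0 + r * t) * (?Q (0 + r * t) r * (F ((0 + r * t) / r) * indicator {..1} r)))
            = ennreal A * ?I r * (ennreal (D t) * F t)" .
        qed
        also have "\<dots> = ennreal A * ?I r * ?J"
          by (rule nn_integral_cmult) measurable
        finally show ?thesis .
      qed
    qed
    also have "\<dots> = (\<integral>\<^sup>+r. ennreal A * ?I r \<partial>lborel) * ?J"
      by (rule nn_integral_multc) measurable
    also have "(\<integral>\<^sup>+r. ennreal A * ?I r \<partial>lborel) = ennreal A * R"
      unfolding R_def by (rule nn_integral_cmult) measurable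
    finally show "(\<integral>\<^sup>+u. F (infdist u \<xi> / norm u) * indicator (cball 0 1) u \<partial>lam B) = ennreal A * R * ?J" .
  qed
  also have "\<dots> = ennreal A * R * ?J" by (simp add: mu.emeasure_space_1)
  finally have *: "K * ennreal (unit_ball_vol (real d)) = ennreal A * R * ?J" .
  \<comment> \<open>The ball volume is A R g, so A R cancels from both sides and K g remains.
    Dividing by g turns the factor 2 / Gamma(e/2) in \<open>D\<close> into Gamma(d/2) /
    Gamma(e/2).\<close>
  define g where "g = 2 / Gamma (real d / 2)"
  have g: "g > 0" using G by (simp add: g_def)
  have vol: "ennreal (unit_ball_vol (real d)) = ennreal A * R * ennreal g"
    using nn_integral_powr_fin(1) A g unfolding d_def[symmetric] R_def[symmetric] A_def[symmetric] g_def[symmetric]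
    by (simp add: ennreal_mult' mult_ac)
  have R: "R \<noteq> 0" "R \<noteq> top" using nn_integral_powr_fin(2,3) unfolding d_def[symmetric] R_def[symmetric] .
  have "(ennreal A * R) * (K * ennreal g) = (ennreal A * R) * ?J"
    using * unfolding vol by (simp only: mult_ac)
  moreover have "ennreal A * R \<noteq> 0" "ennreal A * R \<noteq> top" using R A by (auto simp: ennreal_mult_eq_top_iff)
  ultimately have "K * ennreal g = ?J" by (simp add: ennreal_mult_cancel_left)
  then have "ennreal (1 / g) * ?J = ennreal (1 / g) * (K * ennreal g)" by simp
  also have "\<dots> = K * (ennreal (1 / g) * ennreal g)" by (simp only: mult_ac)
  also have "ennreal (1 / g) * ennreal g = 1" using g by (simp add: ennreal_mult''[symmetric])
  finally have "K = ennreal (1 / g) * ?J" by simp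
  also have "\<dots> = (\<integral>\<^sup>+t. ennreal (1 / g) * (ennreal (D t) * F t) \<partial>lborel)"
    by (rule nn_integral_cmult[symmetric]) measurable
  also have "\<dots> = (\<integral>\<^sup>+t. ennreal (?G t) * F t \<partial>lborel)"
  proof (rule nn_integral_cong)
    fix t
    have "1 / g * D t = ?G t"
      by (simp add: g_def D_def de(3))
    then have "ennreal (1 / g) * ennreal (D t) = ennreal (?G t)"
      using D0[of t] by (simp only: ennreal_mult''[symmetric])
    then show "ennreal (1 / g) * (ennreal (D t) * F t) = ennreal (?G t) * F t"
      by (simp only: mult.assoc[symmetric])
  qed
  finally show ?thesis by (simp add: K_def d_def)
qed

text \<open>The law of the ratio dilated by s. The powers of s from the kernel, from the weight and
  from the Jacobian are balanced by s^(2 - dim W).\<close>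

theorem distr_infdist_invariant:
  assumes v: "v \<in> W" "norm v = s" "0 < s"
  shows "distr \<mu> borel (\<lambda>\<xi>. infdist v \<xi>) = density lborel (\<lambda>x. ennreal (Gamma (real (dim W) / 2) / Gamma ((real (dim W) - real j) / 2) *
    (s powi (2 - int (dim W)) * (ekp (real j / 2) s x * x powi (int (dim W) - int j - 2)))))"
    (is "_ = density lborel (\<lambda>x. ennreal (?D x))")
proof (rule measure_eqI)
  fix X assume "X \<in> sets (distr \<mu> borel (\<lambda>\<xi>. infdist v \<xi>))"
  then have X[measurable]: "X \<in> sets borel" by simp
  define C where "C = Gamma (real (dim W) / 2) / Gamma ((real (dim W) - real j) / 2)"
  have "emeasure (distr \<mu> borel (\<lambda>\<xi>. infdist v \<xi>)) X = (\<integral>\<^sup>+x. indicator X x \<partial>distr \<mu> borel (\<lambda>\<xi>. infdist v \<xi>))" by simp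
  also have "\<dots> = (\<integral>\<^sup>+\<xi>. indicator X (infdist v \<xi>) \<partial>\<mu>)" by (rule nn_integral_distr) measurable
  also have "\<dots> = (\<integral>\<^sup>+\<xi>. (\<lambda>t. indicator X (s * t)) (infdist v \<xi> / norm v) \<partial>\<mu>)" using v by simp
  also have "\<dots> = (\<integral>\<^sup>+t. ennreal (C * ekp (real j / 2) 1 t * t powr (real (dim W) - real j - 2)) * indicator X (s * t) \<partial>lborel)"
    unfolding C_def by (rule mu_ratio_integral) (use v in auto)
  also have "\<dots> = (\<integral>\<^sup>+t. ennreal \<bar>s\<bar> * (ennreal (?D (0 + s * t)) * indicator X (0 + s * t)) \<partial>lborel)"
  proof (rule nn_integral_cong)
    fix t
    have "C * ekp (real j / 2) 1 t * t powr (real (dim W) - real j - 2) = s * ?D (s * t)"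
    proof (cases "0 < t \<and> t < 1")
      case False
      then have "ekp (real j / 2) 1 t = 0" "ekp (real j / 2) s (s * t) = 0"
        using v by (auto simp: ekp_def zero_less_mult_iff)
      then show ?thesis by simp
    next
      case True
      have st: "0 < s * t" "s * t < s" using True v by auto
      have t1: "0 < 1 - t\<^sup>2" using True by (simp add: power_strict_mono[of t 1 2, simplified])
      have "s\<^sup>2 - (s * t)\<^sup>2 = s\<^sup>2 * (1 - t\<^sup>2)" by (simp add: power_mult_distrib algebra_simps)
      then have "(s\<^sup>2 - (s * t)\<^sup>2) powr (real j / 2 - 1) = (s\<^sup>2) powr (real j / 2 - 1) * (1 - t\<^sup>2) powr (real j / 2 - 1)"
        using t1 by (simp add: powr_mult)
      also have "(s\<^sup>2) powr (real j / 2 - 1) = s powi (int j - 2)" by (rule half_powr[OF v(3)])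
      finally have e1: "ekp (real j / 2) s (s * t) = s powi (int j - 2) * s * ekp (real j / 2) 1 t"
        using st True by (simp add: ekp_def)
      have e2: "(s * t) powi (int (dim W) - int j - 2) = s powi (int (dim W) - int j - 2) * t powi (int (dim W) - int j - 2)"
        by (rule power_int_mult_distrib)
      have e3: "t powr (real (dim W) - real j - 2) = t powi (int (dim W) - int j - 2)"
        using powr_real_of_int'[of t "int (dim W) - int j - 2"] True by simp
      have e4: "s * s powi (2 - int (dim W)) * (s powi (int j - 2) * s) * s powi (int (dim W) - int j - 2) = 1"
      proof -
        have "s * s powi (2 - int (dim W)) * (s powi (int j - 2) * s) * s powi (int (dim W) - int j - 2)
          = s powi 1 * s powi (2 - int (dim W)) * (s powi (int j - 2) * s powi 1) * s powi (int (dim W) - int j - 2)" by simp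
        also have "\<dots> = s powi (1 + (2 - int (dim W)) + ((int j - 2) + 1) + (int (dim W) - int j - 2))"
          using v by (simp only: power_int_add[symmetric] less_imp_neq[symmetric] not_False_eq_True simp_thms)
        finally show ?thesis by simp
      qed
      have "s * ?D (s * t) = C * (s * s powi (2 - int (dim W)) * (s powi (int j - 2) * s) * s powi (int (dim W) - int j - 2)) * ekp (real j / 2) 1 t * t powi (int (dim W) - int j - 2)"
        unfolding e1 e2 C_def by (simp only: mult_ac)
      then show ?thesis unfolding e4 e3 by simp
    qed
    moreover have "0 \<le> ?D (s * t)"
      using j v by (cases "0 < s * t") (auto simp: ekp_def[of _ s] intro!: mult_nonneg_nonneg divide_nonneg_nonneg less_imp_le[OF Gamma_real_pos])
    ultimately have "ennreal (C * ekp (real j / 2) 1 t * t powr (real (dim W) - real j - 2)) = ennreal s * ennreal (?D (s * t))"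
      using v by (simp add: ennreal_mult''[symmetric] del: ennreal_mult)
    then show "ennreal (C * ekp (real j / 2) 1 t * t powr (real (dim W) - real j - 2)) * indicator X (s * t) = ennreal \<bar>s\<bar> * (ennreal (?D (0 + s * t)) * indicator X (0 + s * t))"
      using v by (simp add: mult.assoc)
  qed
  also have "\<dots> = ennreal \<bar>s\<bar> * (\<integral>\<^sup>+t. ennreal (?D (0 + s * t)) * indicator X (0 + s * t) \<partial>lborel)"
    by (rule nn_integral_cmult) measurable
  also have "\<dots> = (\<integral>\<^sup>+x. ennreal (?D x) * indicator X x \<partial>lborel)"
    by (rule nn_integral_real_affine[symmetric]) (use v in auto)
  also have "\<dots> = emeasure (density lborel (\<lambda>x. ennreal (?D x))) X"
    by (rule emeasure_density[symmetric]) auto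
  finally show "emeasure (distr \<mu> borel (\<lambda>\<xi>. infdist v \<xi>)) X = emeasure (density lborel (\<lambda>x. ennreal (?D x))) X" .
qed simp

end

section \<open>Invariant measure on affine planes\<close>

text \<open>F1 may fail to be Borel; equality almost everywhere makes it measurable for the
  completion, with respect to which the transform integrates.\<close>

lemma integral_completion_cong_AE:
  fixes F1 F2 :: "'m \<Rightarrow> real"
  assumes F2: "F2 \<in> borel_measurable M" and eq: "AE x in M. F1 x = F2 x"
  shows "integral\<^sup>L (completion M) F1 = integral\<^sup>L M F2"
proof -
  have m2: "F2 \<in> borel_measurable (completion M)" using F2 by (rule measurable_completion)
  have eq2: "AE x in M. F2 x = F1 x" using eq by eventually_elim simp
  have m1: "F1 \<in> borel_measurable (completion M)"
    by (rule measurable_completion_cong_AE[OF m2 eq2]) simp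
  have "integral\<^sup>L (completion M) F1 = integral\<^sup>L (completion M) F2"
    by (rule integral_cong_AE[OF m1 m2 AE_completion[OF eq]])
  also have "\<dots> = integral\<^sup>L M F2" using F2 by (rule integral_completion)
  finally show ?thesis .
qed

lemma translate_absorb:
  fixes \<xi> :: "'a::euclidean_space set"
  assumes \<xi>: "subspace \<xi>" and y: "y \<in> \<xi>"
  shows "(+) (y + z) ` \<xi> = (+) z ` \<xi>"
proof (intro set_eqI iffI)
  fix x assume "x \<in> (+) (y + z) ` \<xi>"
  then obtain w where w: "w \<in> \<xi>" "x = y + z + w" by auto
  then have "x = z + (y + w)" "y + w \<in> \<xi>" using subspace_add[OF \<xi> y] by (auto simp: algebra_simps)
  then show "x \<in> (+) z ` \<xi>" by auto
next
  fix x assume "x \<in> (+) z ` \<xi>"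
  then obtain w where w: "w \<in> \<xi>" "x = z + w" by auto
  then have "x = y + z + (w - y)" "w - y \<in> \<xi>" using subspace_diff[OF \<xi> _ y] by (auto simp: algebra_simps)
  then show "x \<in> (+) (y + z) ` \<xi>" by blast
qed

lemma infdist_minus:
  fixes \<xi> :: "'a::euclidean_space set"
  shows "subspace \<xi> \<Longrightarrow> infdist (- v) \<xi> = infdist v \<xi>"
  using infdist_scale[of \<xi> "-1" v] by simp

lemma infdist_0_translate:
  fixes \<xi> :: "'a::euclidean_space set"
  assumes "subspace \<xi>"
  shows "infdist 0 ((+) v ` \<xi>) = infdist v \<xi>"
  using infdist_minus[OF assms, of v] by (simp add: infdist_translate)

lemma infdist_orthogonal:
  fixes \<xi> :: "'a::euclidean_space set"
  assumes "subspace \<xi>" "z \<in> \<xi>\<^sup>\<bottom>"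
  shows "infdist z \<xi> = norm z"
  using infdist_orthogonal_sum[OF assms(1) subspace_0[OF assms(1)] assms(2)] by simp

text \<open>Ties foot, direction and distance to \<tau> = \<xi> + u: any point of \<tau> can be
  moved along \<xi> to the one orthogonal to \<xi>, and that one is nearest to the origin.\<close>

lemma affine_plane_decomp:
  fixes \<tau> :: "'a::euclidean_space set"
  assumes \<tau>: "\<tau> \<in> affine_grassmannian j"
  obtains \<xi> u where "\<xi> \<in> grassmannian UNIV j" "u \<in> \<xi>\<^sup>\<bottom>" "\<tau> = (+) u ` \<xi>" "plane_foot \<tau> = u"
    "plane_direction \<tau> = \<xi>" "infdist 0 \<tau> = norm u"
proof -
  have aff: "affine \<tau>" "aff_dim \<tau> = int j" using \<tau> by (auto simp: affine_grassmannian_def)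
  then have "\<tau> \<noteq> {}" by auto
  then obtain a where a: "a \<in> \<tau>" by auto
  define \<xi> where "\<xi> = (\<lambda>x. x - a) ` \<tau>"
  have \<xi>: "subspace \<xi>" unfolding \<xi>_def by (rule affine_diffs_subspace_subtract[OF aff(1) a])
  have \<tau>a: "\<tau> = (+) a ` \<xi>" by (auto simp: \<xi>_def image_image)
  obtain y u where yz: "y \<in> \<xi>" "u \<in> \<xi>\<^sup>\<bottom>" "a = y + u" using orthogonal_decomp[OF \<xi>] .
  have \<tau>u: "\<tau> = (+) u ` \<xi>" unfolding \<tau>a yz(3) by (rule translate_absorb[OF \<xi> yz(1)])
  have "int (dim \<xi>) = aff_dim \<xi>" using \<xi> by (simp add: aff_dim_subspace)
  also have "\<dots> = int j" using aff(2) unfolding \<tau>u by (simp add: aff_dim_translation_eq)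
  finally have "\<xi> \<in> grassmannian UNIV j" using \<xi> by (simp add: grassmannian_def)
  moreover have n: "infdist 0 \<tau> = norm u"
    unfolding \<tau>u using infdist_0_translate[OF \<xi>] infdist_orthogonal[OF \<xi> yz(2)] by simp
  moreover have foot: "plane_foot \<tau> = u"
    unfolding plane_foot_def
  proof (rule closest_point_unique[symmetric])
    show "convex \<tau>" using aff(1) by (rule affine_imp_convex)
    show "closed \<tau>" unfolding \<tau>u by (rule closed_translation[OF closed_subspace[OF \<xi>]])
    show "u \<in> \<tau>" using \<tau>u subspace_0[OF \<xi>] by force
    show "\<forall>z\<in>\<tau>. dist 0 u \<le> dist 0 z" using n infdist_le[of _ \<tau> 0] by simp
  qed
  moreover have "plane_direction \<tau> = \<xi>" by (simp add: plane_direction_def foot) (simp add: \<tau>u image_image)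
  ultimately show ?thesis using that yz(2) \<tau>u by blast
qed

text \<open>Orthonormal bases of V and of its complement are matched with those of V' and its
  complement; equal dimensions make both bijections possible.\<close>

lemma orthogonal_transformation_subspaces:
  fixes V V' :: "'a::euclidean_space set"
  assumes V: "subspace V" "subspace V'" "dim V = dim V'"
  obtains T where "orthogonal_transformation T" "T ` V = V'"
proof -
  obtain B C where BC: "onb B V" "onb C (V\<^sup>\<bottom>)" using onb_exists V(1) subspace_orthogonal_comp by metis
  obtain B' C' where BC': "onb B' V'" "onb C' (V'\<^sup>\<bottom>)" using onb_exists V(2) subspace_orthogonal_comp by metis
  have fin: "finite B" "finite C" "finite B'" "finite C'" using BC BC' onb_finite by auto
  have U: "onb (B \<union> C) UNIV" "B \<inter> C = {}" using onb_Un[OF BC] by auto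
  have U': "onb (B' \<union> C') UNIV" "B' \<inter> C' = {}" using onb_Un[OF BC'] by auto
  have "card B = card B'" using onb_card[OF BC(1)] onb_card[OF BC'(1)] V(3) by simp
  moreover have "card B + card C = card B' + card C'"
    using onb_card[OF U(1)] onb_card[OF U'(1)] card_Un_disjoint[OF fin(1,2) U(2)] card_Un_disjoint[OF fin(3,4) U'(2)] by simp
  ultimately have "card C = card C'" by simp
  obtain f where f: "bij_betw f B B'" using finite_same_card_bij[OF fin(1,3) \<open>card B = card B'\<close>] by blast
  obtain g where g: "bij_betw g C C'" using finite_same_card_bij[OF fin(2,4) \<open>card C = card C'\<close>] by blast
  define \<phi> where "\<phi> = (\<lambda>x. if x \<in> B then f x else g x)"
  have "bij_betw \<phi> B B'" using f by (rule bij_betw_cong[THEN iffD1, rotated]) (simp add: \<phi>_def)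
  moreover have "bij_betw \<phi> C C'" using g by (rule bij_betw_cong[THEN iffD1, rotated]) (use U(2) in \<open>auto simp: \<phi>_def\<close>)
  ultimately have \<phi>: "bij_betw \<phi> (B \<union> C) (B' \<union> C')" using U'(2) by (rule bij_betw_combine)
  define T where "T = (\<lambda>v. \<Sum>b\<in>B \<union> C. (v \<bullet> b) *\<^sub>R \<phi> b)"
  have T: "orthogonal_transformation T" unfolding T_def by (rule orthogonal_transformation_between_bases(1)[OF U(1) U'(1) \<phi>])
  have "T b = \<phi> b" if "b \<in> B" for b
    unfolding T_def by (rule orthogonal_transformation_between_bases(2)[OF U(1) U'(1) \<phi>]) (use that in auto)
  then have "T ` B = B'" using \<open>bij_betw \<phi> B B'\<close> by (auto simp: bij_betw_def)
  moreover have "T ` span B = span (T ` B)" by (rule linear_span_image[OF orthogonal_transformation_linear[OF T], symmetric])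
  ultimately have "T ` V = V'" using BC BC' by (simp add: onb_def)
  then show ?thesis using that T by blast
qed

lemma topspace_plane_topology: "topspace (plane_topology X) = X"
proof (rule antisym)
  show "topspace (plane_topology X) \<subseteq> X"
    using openin_plane_topology_subset[of X] openin_topspace[of "plane_topology X"] by blast
  have "openin (plane_topology X) X"
    unfolding openin_plane_topology by (rule exI[of _ UNIV]) auto
  then show "X \<subseteq> topspace (plane_topology X)" by (rule openin_subset)
qed

lemma compact_orthogonal_matrices: "compact {A::real^'n^'n. orthogonal_matrix A}"
proof -
  have "closed {A::real^'n^'n. transpose A ** A = mat 1}"
  proof -
    have "continuous_on UNIV (\<lambda>A::real^'n^'n. transpose A ** A)"
      unfolding matrix_matrix_mult_def transpose_def by (intro continuous_intros)
    then show ?thesis by (intro closed_Collect_eq continuous_on_const) 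
  qed
  moreover have "bounded {A::real^'n^'n. transpose A ** A = mat 1}"
  proof (rule boundedI)
    fix A :: "real^'n^'n" assume "A \<in> {A. transpose A ** A = mat 1}"
    then have A: "orthogonal_matrix A" by (simp add: orthogonal_matrix)
    have "norm A \<le> (\<Sum>i\<in>UNIV. norm (A $ i))" by (simp add: norm_vec_def L2_set_le_sum)
    also have "\<dots> = real CARD('n)" using A by (simp add: orthogonal_matrix_orthonormal_rows row_def)
    finally show "norm A \<le> real CARD('n)" .
  qed
  ultimately show ?thesis by (simp add: compact_eq_bounded_closed orthogonal_matrix)
qed

text \<open>These planes are the image of the compact set of pairs (A, u), A orthogonal and |u|
  \<le> R, under the continuous map to u + A V. Thereby local integrability gives integrability over
  all planes within a given distance.\<close>

lemma compactin_bounded_planes: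
  assumes j: "j \<le> CARD('n::finite)"
  shows "compactin (plane_topology (affine_grassmannian j)) {\<tau> \<in> (affine_grassmannian j :: (real^'n) set set). infdist 0 \<tau> \<le> R}"
    (is "compactin ?P ?K")
proof -
  have "j \<le> dim (UNIV :: (real^'n) set)" using j by simp
  then obtain V :: "(real^'n) set" where V: "subspace V" "dim V = j"
    using choose_subspace_of_subspace[of j "UNIV :: (real^'n) set"] by auto
  define Og where "Og = {A::real^'n^'n. orthogonal_matrix A}"
  define Q where "Q = Og \<times> cball (0::real^'n) R"
  define \<Theta> :: "(real^'n^'n) \<times> (real^'n) \<Rightarrow> (real^'n) set" where "\<Theta> = (\<lambda>(A, u). (+) u ` ((*v) A ` V))"
  have compact: "compact Q" unfolding Q_def Og_def by (intro compact_Times compact_orthogonal_matrices compact_cball)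
  have orth: "orthogonal_transformation ((*v) A)" if "A \<in> Og" for A
    using that by (simp add: Og_def orthogonal_transformation_matrix matrix_vector_mul_linear)
  have AG: "(*v) A ` V \<in> grassmannian UNIV j" if "A \<in> Og" for A
  proof -
    have "V \<in> grassmannian UNIV j" using V by (simp add: grassmannian_def)
    then show ?thesis
      by (intro grassmannian_image[OF orth[OF that]]) (use orthogonal_transformation_surj[OF orth[OF that]] in auto)
  qed
  have \<Theta>: "\<Theta> p \<in> affine_grassmannian j" if "p \<in> Q" for p
    using that grassmannian_translate[OF AG] by (cases p) (auto simp: \<Theta>_def Q_def)
  \<comment> \<open>The transpose moves the variable plane into the argument of a fixed distance
    function, so continuity in (A, u) can be seen coordinate by coordinate.\<close>
  have inf: "infdist x (\<Theta> (A, u)) = infdist (transpose A *v (x - u)) V" if "A \<in> Og" for x A u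
  proof -
    have "A ** transpose A = mat 1" using that by (simp add: Og_def orthogonal_matrix_def)
    then have "A *v (transpose A *v (x - u)) = x - u"
      by (simp only: matrix_vector_mul_assoc matrix_vector_mul_lid)
    then show ?thesis
      using infdist_orthogonal_image[OF orth[OF that], of "transpose A *v (x - u)" V] by (simp add: \<Theta>_def infdist_translate)
  qed
  have cont: "continuous_on Q (\<lambda>p x. infdist x (\<Theta> p))"
  proof (rule continuous_on_coordinatewise_then_product)
    fix x
    have "continuous_on Q (\<lambda>p. infdist (transpose (fst p) *v (x - snd p)) V)"
      unfolding matrix_vector_mult_def transpose_def by (intro continuous_intros)
    then show "continuous_on Q (\<lambda>p. infdist x (\<Theta> p))"
      by (rule continuous_on_eq) (auto simp: Q_def inf)
  qed
  have "continuous_map (top_of_set Q) ?P \<Theta>"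
    unfolding continuous_map_def
  proof (intro conjI allI impI)
    show "\<Theta> \<in> topspace (top_of_set Q) \<rightarrow> topspace ?P" using \<Theta> by (simp add: topspace_plane_topology)
    fix U assume "openin ?P U"
    then obtain Y where Y: "open Y" "U = (\<lambda>\<tau> x. infdist x \<tau>) -` Y \<inter> affine_grassmannian j"
      unfolding openin_plane_topology by blast
    have "openin (top_of_set Q) (Q \<inter> (\<lambda>p x. infdist x (\<Theta> p)) -` Y)"
      using cont Y(1) by (rule continuous_openin_preimage_gen)
    moreover have "Q \<inter> (\<lambda>p x. infdist x (\<Theta> p)) -` Y = {p \<in> topspace (top_of_set Q). \<Theta> p \<in> U}"
      using \<Theta> Y(2) by auto
    ultimately show "openin (top_of_set Q) {p \<in> topspace (top_of_set Q). \<Theta> p \<in> U}" by simp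
  qed
  moreover have "compactin (top_of_set Q) Q" using compact by (simp add: compactin_subtopology)
  ultimately have "compactin ?P (\<Theta> ` Q)" by (rule image_compactin[rotated])
  moreover have "\<Theta> ` Q = ?K"
  proof (intro set_eqI iffI)
    fix \<tau> assume "\<tau> \<in> \<Theta> ` Q"
    then obtain A u where Au: "A \<in> Og" "norm u \<le> R" "\<tau> = \<Theta> (A, u)" by (auto simp: Q_def)
    have "0 \<in> V" using V(1) by (rule subspace_0)
    then have "u \<in> \<tau>" by (force simp: Au(3) \<Theta>_def image_image)
    then have "infdist 0 \<tau> \<le> R" using infdist_le[of u \<tau> 0] Au(2) by simp
    then show "\<tau> \<in> ?K" using \<Theta>[of "(A, u)"] Au by (simp add: Q_def)
  next
    fix \<tau> assume "\<tau> \<in> ?K"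
    then have \<tau>: "\<tau> \<in> affine_grassmannian j" "infdist 0 \<tau> \<le> R" by auto
    obtain \<xi> u where \<xi>: "\<xi> \<in> grassmannian UNIV j" "\<tau> = (+) u ` \<xi>" "infdist 0 \<tau> = norm u"
      using affine_plane_decomp[OF \<tau>(1)] by metis
    have "subspace \<xi>" "dim V = dim \<xi>" using \<xi>(1) V(2) by (auto simp: grassmannian_def)
    then obtain T where T: "orthogonal_transformation T" "T ` V = \<xi>"
      using orthogonal_transformation_subspaces[OF V(1)] by blast
    have lin: "linear T" using T(1) by (rule orthogonal_transformation_linear)
    have "(*v) (matrix T) = T" using matrix_vector_mul(2)[OF lin] by auto
    moreover have "matrix T \<in> Og" using T(1) by (simp add: Og_def orthogonal_transformation_matrix)
    ultimately have "\<tau> = \<Theta> (matrix T, u)" "(matrix T, u) \<in> Q" using T \<xi> \<tau> by (auto simp: \<Theta>_def Q_def)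
    then show "\<tau> \<in> \<Theta> ` Q" by blast
  qed
  ultimately show ?thesis by simp
qed

text \<open>The measure of the affine planes before completion, as an image of a product. The
  difference of squares is the squared length of the component of v along \<xi>; the weight confines
  it to a unit ball and divides by the volume of that ball. The inner measure no longer varies with
  \<xi>, and Tonelli's theorem applies.\<close>

definition plane_measure :: "nat \<Rightarrow> (real^'n) set measure" where
  "plane_measure j = distr (density (grassmann_measure UNIV j \<Otimes>\<^sub>M lborel)
      (\<lambda>(\<xi>, v). ennreal (1 / unit_ball_vol (real j)) * indicator {..1} ((norm v)\<^sup>2 - (infdist v \<xi>)\<^sup>2)))
    (plane_borel (affine_grassmannian j)) (\<lambda>(\<xi>, v). (+) v ` \<xi>)"

context
  fixes j :: nat and ty :: "'n::finite itself"
  assumes j: "0 < j" "j < CARD('n)"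
begin

abbreviation mu :: "(real^'n) set measure" where "mu \<equiv> grassmann_measure UNIV j"

lemma mu_invariant: "invariant_prob (UNIV :: (real^'n) set) j mu"
  by (rule invariant_grassmann_measure) (use j in auto)

lemma grassmann_measure_prob: "prob_space mu" and space_grassmann_measure: "space mu = grassmannian UNIV j"
  and sets_grassmann_measure[measurable_cong]: "sets mu = sets (plane_borel (grassmannian UNIV j))"
  using mu_invariant by (auto simp: invariant_prob_def)

lemma pair_measurable: "snd \<in> borel_measurable (mu \<Otimes>\<^sub>M (lborel :: (real^'n) measure))"
    "fst \<in> mu \<Otimes>\<^sub>M (lborel :: (real^'n) measure) \<rightarrow>\<^sub>M plane_borel (grassmannian UNIV j)"
proof -
  show "snd \<in> borel_measurable (mu \<Otimes>\<^sub>M (lborel :: (real^'n) measure))"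
    using measurable_snd[of mu "lborel :: (real^'n) measure"] by simp
  show "fst \<in> mu \<Otimes>\<^sub>M (lborel :: (real^'n) measure) \<rightarrow>\<^sub>M plane_borel (grassmannian UNIV j)"
    using measurable_compose[OF measurable_fst measurable_ident_sets[OF sets_grassmann_measure]] .
qed

lemma translate_measurable[measurable]: "(\<lambda>(\<xi>, v). (+) v ` \<xi>) \<in> mu \<Otimes>\<^sub>M (lborel :: (real^'n) measure) \<rightarrow>\<^sub>M plane_borel (affine_grassmannian j)"
  unfolding split_beta by (rule measurable_translate_plane[OF pair_measurable])

lemma translate_measurable'[measurable]: "(\<lambda>u :: real^'n. (+) u ` \<xi>) \<in> borel \<rightarrow>\<^sub>M plane_borel (affine_grassmannian j)" if "\<xi> \<in> grassmannian UNIV j"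
  by (rule measurable_translate_plane[where W = UNIV]) (use that in auto)

text \<open>On each fibre this is the tube formula for the complement of \<xi>. The second claim,
  measurability of the inner integral in \<xi>, is inherited from the product measure.\<close>

lemma nn_integral_plane_measure:
  assumes f[measurable]: "f \<in> borel_measurable (plane_borel (affine_grassmannian j))"
  shows "(\<integral>\<^sup>+\<tau>. f \<tau> \<partial>plane_measure j) = (\<integral>\<^sup>+\<xi>. (\<integral>\<^sup>+u. f ((+) u ` \<xi>) \<partial>lam (orthonormal_basis_of (\<xi>\<^sup>\<bottom>))) \<partial>mu)"
    and "(\<lambda>\<xi>. \<integral>\<^sup>+u. f ((+) u ` \<xi>) \<partial>lam (orthonormal_basis_of (\<xi>\<^sup>\<bottom>))) \<in> borel_measurable mu"
proof -
  interpret mu: prob_space mu by (rule grassmann_measure_prob)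
  interpret p: pair_sigma_finite mu "lborel :: (real^'n) measure" by standard
  define V where "V = unit_ball_vol (real j)"
  have V: "V > 0" by (simp add: V_def)
  define w :: "(real^'n) set \<Rightarrow> real^'n \<Rightarrow> ennreal" where "w = (\<lambda>\<xi> v. ennreal (1 / V) * indicator {..1} ((norm v)\<^sup>2 - (infdist v \<xi>)\<^sup>2 :: real))"
  have [measurable]: "(\<lambda>(\<xi>, v). w \<xi> v) \<in> borel_measurable (mu \<Otimes>\<^sub>M (lborel :: (real^'n) measure))"
  proof -
    note [measurable] = pair_measurable(1) measurable_infdist[OF pair_measurable]
    have "(\<lambda>p. (norm (snd p))\<^sup>2 - (infdist (snd p) (fst p))\<^sup>2) \<in> borel_measurable (mu \<Otimes>\<^sub>M (lborel :: (real^'n) measure))"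
      by (intro borel_measurable_diff borel_measurable_power measurable_infdist[OF pair_measurable]
          measurable_compose[OF pair_measurable(1) borel_measurable_norm])
    from measurable_compose[OF this, of "indicator {..1} :: real \<Rightarrow> ennreal" borel]
    have [measurable]: "(\<lambda>p. indicator {..1} ((norm (snd p))\<^sup>2 - (infdist (snd p) (fst p))\<^sup>2) :: ennreal) \<in> borel_measurable (mu \<Otimes>\<^sub>M (lborel :: (real^'n) measure))"
      by simp
    show ?thesis unfolding w_def split_beta by (rule borel_measurable_times_ennreal[OF borel_measurable_const]) fact
  qed
  have pw: "(\<integral>\<^sup>+v. w \<xi> v * f ((+) v ` \<xi>) \<partial>lborel) = (\<integral>\<^sup>+u. f ((+) u ` \<xi>) \<partial>lam (orthonormal_basis_of (\<xi>\<^sup>\<bottom>)))"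
    if \<xi>S: "\<xi> \<in> space mu" for \<xi>
  proof -
    have \<xi>G: "\<xi> \<in> grassmannian UNIV j" using \<xi>S by (simp add: space_grassmann_measure)
    then have \<xi>: "subspace \<xi>" "dim \<xi> = j" by (auto simp: grassmannian_def)
    have sO: "subspace (\<xi>\<^sup>\<bottom>)" by (rule subspace_orthogonal_comp)
    have comp: "\<xi>\<^sup>\<bottom>\<^sup>\<bottom> = \<xi>" by (rule orthogonal_comp_self[OF \<xi>(1)])
    define B where "B = orthonormal_basis_of (\<xi>\<^sup>\<bottom>)"
    have B: "onb B (\<xi>\<^sup>\<bottom>)" unfolding B_def by (rule orthonormal_basis_of_onb[OF sO])
    have [measurable]: "(\<lambda>u. f ((+) u ` \<xi>)) \<in> borel_measurable borel"
      using translate_measurable'[OF \<xi>G] f by (rule measurable_compose)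
    have "(\<integral>\<^sup>+v. w \<xi> v * f ((+) v ` \<xi>) \<partial>lborel) = (\<integral>\<^sup>+v. ennreal (1 / V) * (f ((+) (closest_point (\<xi>\<^sup>\<bottom>) v) ` \<xi>) * indicator {v. infdist v (\<xi>\<^sup>\<bottom>) \<le> 1} v) \<partial>lborel)"
    proof (rule nn_integral_cong)
      fix v :: "real^'n"
      obtain y z where yz: "y \<in> \<xi>" "z \<in> \<xi>\<^sup>\<bottom>" "v = y + z" using orthogonal_decomp[OF \<xi>(1)] .
      have "orthogonal y z" using yz by (auto simp: orthogonal_comp_def)
      then have n: "(norm v)\<^sup>2 = (norm y)\<^sup>2 + (norm z)\<^sup>2" unfolding yz(3) by (rule norm_add_Pythagorean)
      have z': "closest_point (\<xi>\<^sup>\<bottom>) v = z" "infdist v (\<xi>\<^sup>\<bottom>) = norm y"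
        using closest_point_orthogonal_sum[OF sO yz(2), of y] infdist_orthogonal_sum[OF sO yz(2), of y] yz(1,3)
        by (simp_all add: comp add.commute)
      have "infdist v \<xi> = norm z" unfolding yz(3) by (rule infdist_orthogonal_sum[OF \<xi>(1) yz(1,2)])
      then have "indicator {..1} ((norm v)\<^sup>2 - (infdist v \<xi>)\<^sup>2) = (indicator {v. infdist v (\<xi>\<^sup>\<bottom>) \<le> 1} v :: ennreal)"
        using n z'(2) abs_square_le_1[of "norm y"] by (simp add: indicator_def)
      moreover have "(+) v ` \<xi> = (+) z ` \<xi>" unfolding yz(3) by (rule translate_absorb[OF \<xi>(1) yz(1)])
      ultimately show "w \<xi> v * f ((+) v ` \<xi>) = ennreal (1 / V) * (f ((+) (closest_point (\<xi>\<^sup>\<bottom>) v) ` \<xi>) * indicator {v. infdist v (\<xi>\<^sup>\<bottom>) \<le> 1} v)"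
        by (simp add: w_def z'(1) mult_ac)
    qed
    also have "\<dots> = ennreal (1 / V) * (\<integral>\<^sup>+v. f ((+) (closest_point (\<xi>\<^sup>\<bottom>) v) ` \<xi>) * indicator {v. infdist v (\<xi>\<^sup>\<bottom>) \<le> 1} v \<partial>lborel)"
    proof (rule nn_integral_cmult)
      note [measurable] = closest_point_measurable[OF sO]
      have [measurable]: "{v. infdist v (\<xi>\<^sup>\<bottom>) \<le> 1} \<in> sets borel" by measurable
      have "(\<lambda>v. f ((+) (closest_point (\<xi>\<^sup>\<bottom>) v) ` \<xi>)) \<in> borel_measurable borel"
        by (rule measurable_compose[OF closest_point_measurable[OF sO]]) fact
      then show "(\<lambda>v. f ((+) (closest_point (\<xi>\<^sup>\<bottom>) v) ` \<xi>) * indicator {v. infdist v (\<xi>\<^sup>\<bottom>) \<le> 1} v) \<in> borel_measurable lborel" by measurable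
    qed
    also have "\<dots> = ennreal (1 / V) * (ennreal V * (\<integral>\<^sup>+u. f ((+) u ` \<xi>) \<partial>lam B))"
      by (subst nn_integral_lam_eq_lborel[OF B]) (auto simp: comp \<xi>(2) V_def)
    also have "\<dots> = (\<integral>\<^sup>+u. f ((+) u ` \<xi>) \<partial>lam B)"
    proof -
      have "ennreal (1 / V) * ennreal V = 1" using V by (simp add: ennreal_mult''[symmetric])
      then show ?thesis by (simp only: mult.assoc[symmetric]) simp
    qed
    finally show ?thesis by (simp add: B_def)
  qed
  have "(\<integral>\<^sup>+\<tau>. f \<tau> \<partial>plane_measure j) = (\<integral>\<^sup>+p. f (case p of (\<xi>, v) \<Rightarrow> (+) v ` \<xi>) \<partial>density (mu \<Otimes>\<^sub>M lborel) (\<lambda>(\<xi>, v). w \<xi> v))"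
    unfolding plane_measure_def w_def V_def by (rule nn_integral_distr) auto
  also have "\<dots> = (\<integral>\<^sup>+p. (case p of (\<xi>, v) \<Rightarrow> w \<xi> v) * f (case p of (\<xi>, v) \<Rightarrow> (+) v ` \<xi>) \<partial>(mu \<Otimes>\<^sub>M lborel))"
    by (rule nn_integral_density) measurable
  also have "\<dots> = (\<integral>\<^sup>+\<xi>. \<integral>\<^sup>+v. w \<xi> v * f ((+) v ` \<xi>) \<partial>lborel \<partial>mu)"
    by (subst lborel.nn_integral_fst[symmetric]) auto
  also have "\<dots> = (\<integral>\<^sup>+\<xi>. (\<integral>\<^sup>+u. f ((+) u ` \<xi>) \<partial>lam (orthonormal_basis_of (\<xi>\<^sup>\<bottom>))) \<partial>mu)"
    by (rule nn_integral_cong[OF pw])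
  finally show "(\<integral>\<^sup>+\<tau>. f \<tau> \<partial>plane_measure j) = (\<integral>\<^sup>+\<xi>. (\<integral>\<^sup>+u. f ((+) u ` \<xi>) \<partial>lam (orthonormal_basis_of (\<xi>\<^sup>\<bottom>))) \<partial>mu)" .
  have "(\<lambda>\<xi>. \<integral>\<^sup>+v. w \<xi> v * f ((+) v ` \<xi>) \<partial>lborel) \<in> borel_measurable mu"
    by (rule lborel.borel_measurable_nn_integral[of "\<lambda>\<xi> v. w \<xi> v * f ((+) v ` \<xi>)"]) measurable
  then show "(\<lambda>\<xi>. \<integral>\<^sup>+u. f ((+) u ` \<xi>) \<partial>lam (orthonormal_basis_of (\<xi>\<^sup>\<bottom>))) \<in> borel_measurable mu"
    using pw by (rule measurable_cong[THEN iffD1, rotated])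
qed

lemma space_plane_measure[simp]: "space (plane_measure j :: (real^'n) set measure) = affine_grassmannian j"
  and sets_plane_measure[measurable_cong]: "sets (plane_measure j :: (real^'n) set measure) = sets (plane_borel (affine_grassmannian j))"
  by (simp_all add: plane_measure_def)

text \<open>\<open>measure_of\<close> gives the zero measure unless its set function is countably
  additive; agreement with the values of a genuine measure settles that.\<close>

lemma affine_measure_plane_measure: "affine_measure j = completion (plane_measure j :: (real^'n) set measure)"
proof -
  have "measure_of (affine_grassmannian j) (sets (plane_borel (affine_grassmannian j)))
      (\<lambda>A. \<integral>\<^sup>+\<xi>. (\<integral>\<^sup>+u. indicator A ((+) u ` \<xi>) \<partial>subspace_lebesgue (\<xi>\<^sup>\<bottom>)) \<partial>mu)
    = measure_of (space (plane_measure j)) (sets (plane_measure j)) (emeasure (plane_measure j :: (real^'n) set measure))"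
    unfolding space_plane_measure sets_plane_measure
  proof (rule measure_of_eq)
    show "sets (plane_borel (affine_grassmannian j)) \<subseteq> Pow (affine_grassmannian j)"
      using sets.space_closed[of "plane_borel (affine_grassmannian j)"] by simp
    fix A :: "(real^'n) set set"
    assume A0: "A \<in> sigma_sets (affine_grassmannian j) (sets (plane_borel (affine_grassmannian j)))"
    have A: "A \<in> sets (plane_borel (affine_grassmannian j))"
      using A0 unfolding sets.sigma_sets_eq[of "plane_borel (affine_grassmannian j)", unfolded space_plane_borel] .
    have "emeasure (plane_measure j) A = (\<integral>\<^sup>+\<tau>. indicator A \<tau> \<partial>plane_measure j)" using A by (simp add: sets_plane_measure)
    also have "\<dots> = (\<integral>\<^sup>+\<xi>. (\<integral>\<^sup>+u. indicator A ((+) u ` \<xi>) \<partial>lam (orthonormal_basis_of (\<xi>\<^sup>\<bottom>))) \<partial>mu)"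
      by (rule nn_integral_plane_measure(1)) (use A in simp)
    finally show "(\<integral>\<^sup>+\<xi>. (\<integral>\<^sup>+u. indicator A ((+) u ` \<xi>) \<partial>subspace_lebesgue (\<xi>\<^sup>\<bottom>)) \<partial>mu) = emeasure (plane_measure j) A"
      by (simp add: subspace_lebesgue_lam nn_integral_completion)
  qed
  then show ?thesis unfolding affine_measure_def measure_of_of_measure by simp
qed

lemma dim_comp:
  fixes \<xi> :: "(real^'n) set"
  assumes "subspace \<xi>"
  shows "dim (\<xi>\<^sup>\<bottom>) + dim \<xi> = CARD('n)"
  using dim_orthogonal_in[of UNIV \<xi>] assms by simp

lemma nn_integral_plane_measure_radial:
  assumes h[measurable]: "h \<in> borel_measurable borel"
  shows "(\<integral>\<^sup>+\<tau>. h (infdist 0 \<tau>) \<partial>(plane_measure j :: (real^'n) set measure))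
    = (\<integral>\<^sup>+r. ennreal (pi powr (real (CARD('n) - j) / 2) * ekm (real (CARD('n) - j) / 2) 0 r) * h r \<partial>lborel)" (is "_ = ?I")
proof -
  interpret mu: prob_space mu by (rule grassmann_measure_prob)
  have "(\<integral>\<^sup>+\<tau>. h (infdist 0 \<tau>) \<partial>(plane_measure j :: (real^'n) set measure))
    = (\<integral>\<^sup>+\<xi>. (\<integral>\<^sup>+u. h (infdist 0 ((+) u ` \<xi>)) \<partial>lam (orthonormal_basis_of (\<xi>\<^sup>\<bottom>))) \<partial>mu)"
    by (rule nn_integral_plane_measure(1)) measurable
  also have "\<dots> = (\<integral>\<^sup>+\<xi>. ?I \<partial>mu)"
  proof (rule nn_integral_cong)
    fix \<xi> assume "\<xi> \<in> space mu"
    then have \<xi>: "subspace \<xi>" "dim \<xi> = j" by (auto simp: grassmannian_def space_grassmann_measure)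
    have B: "onb (orthonormal_basis_of (\<xi>\<^sup>\<bottom>)) (\<xi>\<^sup>\<bottom>)" by (rule orthonormal_basis_of_onb[OF subspace_orthogonal_comp])
    have d: "dim (\<xi>\<^sup>\<bottom>) = CARD('n) - j" using dim_comp[OF \<xi>(1)] \<xi>(2) by simp
    have "(\<integral>\<^sup>+u. h (infdist 0 ((+) u ` \<xi>)) \<partial>lam (orthonormal_basis_of (\<xi>\<^sup>\<bottom>))) = (\<integral>\<^sup>+u. h (sqrt ((norm u)\<^sup>2 + 0\<^sup>2)) \<partial>lam (orthonormal_basis_of (\<xi>\<^sup>\<bottom>)))"
      by (rule nn_integral_cong_AE, rule eventually_mono[OF AE_lam_mem[OF B]]) (simp add: infdist_0_translate[OF \<xi>(1)] infdist_orthogonal[OF \<xi>(1)])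
    also have "\<dots> = ?I" by (subst nn_integral_lam_norm[OF B]) (use d j in auto)
    finally show "(\<integral>\<^sup>+u. h (infdist 0 ((+) u ` \<xi>)) \<partial>lam (orthonormal_basis_of (\<xi>\<^sup>\<bottom>))) = ?I" .
  qed
  also have "\<dots> = ?I" by (simp add: mu.emeasure_space_1)
  finally show ?thesis .
qed

end

section \<open>Radial functions\<close>

lemma AE_witness:
  assumes "AE x in M. P x" and "emeasure M (space M) \<noteq> 0"
  shows "\<exists>x\<in>space M. P x"
proof (rule ccontr)
  assume "\<not> ?thesis"
  then have F: "\<not> P x" if "x \<in> space M" for x using that by blast
  have "AE x in M. False"
    using assms(1) AE_space[of M] by eventually_elim (use F in blast)
  then have "ae_filter M = bot" by (simp only: eventually_False)
  then show False using assms(2) by (simp only: ae_filter_eq_bot_iff)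
qed

text \<open>f is a Borel function \<open>gA\<close> off a null set N of planes. For almost every
  \<xi> the translates of \<xi> in N form a null set E of vectors. Dilates of E are null too, so
  along almost every ray the planes avoid N for almost every distance, and there \<open>gA\<close>
  supplies the Borel version of the profile.\<close>

lemma radial_AE_borel:
  fixes f :: "(real^'n) set \<Rightarrow> real" and f0 :: "real \<Rightarrow> real"
  assumes j: "0 < j" "j < CARD('n)"
    and radial: "\<And>\<tau>. \<tau> \<in> affine_grassmannian j \<Longrightarrow> f \<tau> = f0 (infdist 0 \<tau>)"
    and loc: "plane_locally_integrable j f"
  obtains g where "g \<in> borel_measurable borel" "AE t in lborel. 0 < t \<longrightarrow> f0 t = g t"
proof -
  let ?L = "plane_measure j :: (real^'n) set measure"
  interpret mu: prob_space "grassmann_measure UNIV j :: (real^'n) set measure" by (rule grassmann_measure_prob[OF j])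
  define K where "K = (\<lambda>i::nat. {\<tau> \<in> (affine_grassmannian j :: (real^'n) set set). infdist 0 \<tau> \<le> real i})"
  have m: "(\<lambda>\<tau>. indicat_real (K i) \<tau> *\<^sub>R f \<tau>) \<in> borel_measurable (completion ?L)" for i
  proof -
    have "compactin (plane_topology (affine_grassmannian j)) (K i)"
      unfolding K_def by (rule compactin_bounded_planes) (use j in simp)
    then have "set_integrable (affine_measure j) (K i) f" using loc by (simp add: plane_locally_integrable_def)
    then show ?thesis unfolding set_integrable_def affine_measure_plane_measure[OF j] by auto
  qed
  \<comment> \<open>Local integrability makes each truncation to planes within distance i
    measurable; f is their pointwise limit.\<close>
  have fm: "f \<in> borel_measurable (completion ?L)"
  proof (rule borel_measurable_LIMSEQ_real[OF _ m])
    fix \<tau> assume "\<tau> \<in> space (completion ?L)"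
    then have \<tau>: "\<tau> \<in> affine_grassmannian j" by (simp add: space_plane_measure[OF j])
    obtain N :: nat where N: "infdist 0 \<tau> \<le> real N" using real_arch_simple by blast
    have "indicat_real (K i) \<tau> *\<^sub>R f \<tau> = f \<tau>" if "N \<le> i" for i
    proof -
      have "real N \<le> real i" using that by simp
      then have "\<tau> \<in> K i" using \<tau> N unfolding K_def by (simp add: order_trans[of _ "real N"])
      then show ?thesis by simp
    qed
    then show "(\<lambda>i. indicat_real (K i) \<tau> *\<^sub>R f \<tau>) \<longlonglongrightarrow> f \<tau>"
      by (intro tendsto_eventually eventually_sequentiallyI[of N])
  qed
  then obtain gA where gA: "gA \<in> borel_measurable ?L" "AE \<tau> in ?L. f \<tau> = gA \<tau>"
    using completion_ex_borel_measurable_real by blast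
  then obtain N where N: "{\<tau> \<in> space ?L. f \<tau> \<noteq> gA \<tau>} \<subseteq> N" "emeasure ?L N = 0" "N \<in> sets ?L" by (auto elim: AE_E)
  have NP: "N \<in> sets (plane_borel (affine_grassmannian j))" using N(3) by (simp add: sets_plane_measure[OF j])
  have ind: "indicator N \<in> borel_measurable (plane_borel (affine_grassmannian j))" using NP by simp
  have "(\<integral>\<^sup>+\<tau>. indicator N \<tau> \<partial>?L) = 0" using N by simp
  then have "AE \<xi> in (grassmann_measure UNIV j :: (real^'n) set measure). (\<integral>\<^sup>+u. indicator N ((+) u ` \<xi>) \<partial>lam (orthonormal_basis_of (\<xi>\<^sup>\<bottom>))) = 0"
    unfolding nn_integral_plane_measure(1)[OF j ind] by (subst (asm) nn_integral_0_iff_AE[OF nn_integral_plane_measure(2)[OF j ind]])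
  then have "\<exists>\<xi>\<in>space (grassmann_measure UNIV j :: (real^'n) set measure). (\<integral>\<^sup>+u. indicator N ((+) u ` \<xi>) \<partial>lam (orthonormal_basis_of (\<xi>\<^sup>\<bottom>))) = 0"
    by (rule AE_witness) (simp add: mu.emeasure_space_1)
  then obtain \<xi> :: "(real^'n) set" where \<xi>G: "\<xi> \<in> grassmannian UNIV j"
    and z: "(\<integral>\<^sup>+u. indicator N ((+) u ` \<xi>) \<partial>lam (orthonormal_basis_of (\<xi>\<^sup>\<bottom>))) = 0"
    by (auto simp: space_grassmann_measure[OF j])
  have \<xi>: "subspace \<xi>" "dim \<xi> = j" using \<xi>G by (auto simp: grassmannian_def)
  have sO: "subspace (\<xi>\<^sup>\<bottom>)" by (rule subspace_orthogonal_comp)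
  \<comment> \<open>A union of cosets of \<xi>, so nullity in the orthogonal complement becomes
    nullity in the whole space.\<close>
  define E where "E = {v :: real^'n. (+) v ` \<xi> \<in> N}"
  have tr: "(\<lambda>u :: real^'n. (+) u ` \<xi>) \<in> borel \<rightarrow>\<^sub>M plane_borel (affine_grassmannian j)"
    by (rule translate_measurable'[OF j \<xi>G])
  have E[measurable]: "E \<in> sets borel" using measurable_sets[OF tr NP] by (simp add: E_def vimage_def)
  have "emeasure (lam (orthonormal_basis_of (\<xi>\<^sup>\<bottom>))) E = 0"
  proof -
    have "emeasure (lam (orthonormal_basis_of (\<xi>\<^sup>\<bottom>))) E = (\<integral>\<^sup>+u. indicator E u \<partial>lam (orthonormal_basis_of (\<xi>\<^sup>\<bottom>)))" by simp
    also have "\<dots> = (\<integral>\<^sup>+u. indicator N ((+) u ` \<xi>) \<partial>lam (orthonormal_basis_of (\<xi>\<^sup>\<bottom>)))"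
      by (intro nn_integral_cong) (simp add: E_def indicator_def)
    finally show ?thesis using z by simp
  qed
  then have "AE v in lborel. closest_point (\<xi>\<^sup>\<bottom>) v \<notin> E"
    by (rule AE_lam_imp_AE_lborel[OF orthonormal_basis_of_onb[OF sO] E])
  moreover have "closest_point (\<xi>\<^sup>\<bottom>) v \<in> E \<longleftrightarrow> v \<in> E" for v
  proof -
    obtain y u where yu: "y \<in> \<xi>" "u \<in> \<xi>\<^sup>\<bottom>" "v = y + u" using orthogonal_decomp[OF \<xi>(1)] .
    have "closest_point (\<xi>\<^sup>\<bottom>) (u + y) = u"
      by (rule closest_point_orthogonal_sum[OF sO yu(2)]) (use yu(1) orthogonal_comp_self[OF \<xi>(1)] in simp)
    moreover have "(+) v ` \<xi> = (+) u ` \<xi>" unfolding yu(3) by (rule translate_absorb[OF \<xi>(1) yu(1)])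
    ultimately show ?thesis by (simp add: E_def yu(3) add.commute)
  qed
  ultimately have AEv: "AE v in lborel. v \<notin> E" by simp
  \<comment> \<open>Dilations preserve null sets. Exchanging the order of v and t below yields a
    single v that works for almost every t.\<close>
  have scaled: "AE v in lborel. t \<noteq> 0 \<longrightarrow> t *\<^sub>R v \<notin> E" for t :: real
  proof (cases "t = 0")
    case False
    have "AE v in density (distr lborel borel (\<lambda>x::real^'n. 0 + t *\<^sub>R x)) (\<lambda>_. ennreal (\<bar>t\<bar> ^ DIM(real^'n))). v \<notin> E"
      using AEv by (subst (asm) lborel_affine[OF False, of 0])
    then have "AE v in distr lborel borel (\<lambda>x::real^'n. 0 + t *\<^sub>R x). v \<notin> E"
      by (subst (asm) AE_density) (use False in auto)
    then show ?thesis by (subst (asm) AE_distr_iff) auto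
  qed simp
  have "AE v in lborel. AE t in lborel. t \<noteq> 0 \<longrightarrow> t *\<^sub>R v \<notin> E"
  proof (subst lborel_pair.AE_commute)
    show "{x \<in> space (lborel \<Otimes>\<^sub>M lborel). snd x \<noteq> 0 \<longrightarrow> snd x *\<^sub>R fst x \<notin> E} \<in> sets (lborel \<Otimes>\<^sub>M lborel)" by measurable
    show "AE t in lborel. AE v in lborel. t \<noteq> 0 \<longrightarrow> t *\<^sub>R v \<notin> E" using scaled by simp
  qed
  moreover have "AE v in lborel. v \<notin> \<xi>"
  proof -
    have "negligible \<xi>" by (rule negligible_lowdim) (use \<xi>(2) j in simp)
    moreover have "closed \<xi>" using \<xi>(1) by (rule closed_subspace)
    ultimately have "\<xi> \<in> null_sets lborel" by (simp add: negligible_iff_null_sets null_sets_completion_iff)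
    then show ?thesis by (rule AE_not_in)
  qed
  ultimately have "AE v in lborel. (AE t in lborel. t \<noteq> 0 \<longrightarrow> t *\<^sub>R v \<notin> E) \<and> v \<notin> \<xi>" by (rule AE_conjI)
  then have "\<exists>v\<in>space (lborel :: (real^'n) measure). (AE t in lborel. t \<noteq> 0 \<longrightarrow> t *\<^sub>R v \<notin> E) \<and> v \<notin> \<xi>"
    by (rule AE_witness) simp
  then obtain v :: "real^'n" where v: "AE t in lborel. t \<noteq> 0 \<longrightarrow> t *\<^sub>R v \<notin> E" "v \<notin> \<xi>" by blast
  \<comment> \<open>Positive because v is not in \<xi>; with the factor t / c the translate of \<xi>
    lies at distance exactly t.\<close>
  define c where "c = infdist v \<xi>"
  have c: "c > 0"
    unfolding c_def by (rule infdist_pos_not_in_closed) (use \<xi>(1) v(2) subspace_0 in \<open>auto simp: closed_subspace\<close>)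
  define g where "g = (\<lambda>t. gA ((+) ((t / c) *\<^sub>R v) ` \<xi>))"
  have gAm: "gA \<in> borel_measurable (plane_borel (affine_grassmannian j))"
    using gA(1) by (simp add: measurable_cong_sets[OF sets_plane_measure[OF j] refl])
  have "g \<in> borel_measurable borel"
    unfolding g_def by (rule measurable_compose[OF _ gAm], rule measurable_compose[OF _ tr]) measurable
  moreover have "AE t in lborel. 0 < t \<longrightarrow> f0 t = g t"
  proof -
    have "AE t in lborel. 0 + (1 / c) * t \<noteq> 0 \<longrightarrow> (0 + (1 / c) * t) *\<^sub>R v \<notin> E"
      by (rule AE_borel_affine) (use c v(1) in auto)
    then show ?thesis
    proof eventually_elim
      case (elim t)
      show ?case
      proof
        assume t: "0 < t"
        define \<tau> where "\<tau> = (+) ((t / c) *\<^sub>R v) ` \<xi>"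
        have \<tau>: "\<tau> \<in> affine_grassmannian j" unfolding \<tau>_def by (rule grassmannian_translate[OF \<xi>G])
        have "\<tau> \<notin> N" using elim t c by (simp add: E_def \<tau>_def)
        then have "f \<tau> = gA \<tau>" using N(1) \<tau> by (auto simp: space_plane_measure[OF j])
        moreover have "infdist 0 \<tau> = t"
          unfolding \<tau>_def using t c by (simp add: infdist_0_translate[OF \<xi>(1)] infdist_scale[OF \<xi>(1)] c_def[symmetric])
        ultimately show "f0 t = g t" using radial[OF \<tau>] by (simp add: g_def \<tau>_def)
      qed
    qed
  qed
  ultimately show ?thesis by (rule that)
qed

text \<open>The exceptional parameters lie in a Borel null set, which a law with a density does not
  charge. Enclosing them is necessary because f0 composed with q need not be measurable.\<close>

lemma AE_radial_law:
  assumes eq: "AE t in lborel. 0 < t \<longrightarrow> f0 t = (g t :: real)" and M: "M = density lborel (\<lambda>r. ennreal (A * ekm a x r))" and x: "0 \<le> x"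
    and q: "q \<in> P \<rightarrow>\<^sub>M borel" "distr P borel q = M"
  shows "AE u in P. f0 (q u) = g (q u)"
proof -
  obtain Z where Z: "{t \<in> space lborel. \<not> (0 < t \<longrightarrow> f0 t = g t)} \<subseteq> Z" "emeasure lborel Z = 0" "Z \<in> sets (lborel :: real measure)"
    using eq by (auto elim: AE_E)
  have "AE r in lborel. r \<notin> Z" using Z by (intro AE_not_in) (auto simp: null_sets_def)
  then have "AE r in M. r \<notin> Z \<and> 0 < r"
    unfolding M by (subst AE_density) (use x in \<open>auto simp: ekm_def elim!: eventually_mono\<close>)
  then have "AE u in P. q u \<notin> Z \<and> 0 < q u"
    unfolding q(2)[symmetric] by (subst (asm) AE_distr_iff) (use q(1) Z(3) in auto)
  then show ?thesis by eventually_elim (use Z(1) in auto)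
qed

lemma AE_plane_measure_radial:
  fixes f :: "(real^'n) set \<Rightarrow> real" and f0 g :: "real \<Rightarrow> real"
  assumes j: "0 < j" "j < CARD('n)"
    and radial: "\<And>\<tau>. \<tau> \<in> affine_grassmannian j \<Longrightarrow> f \<tau> = f0 (infdist 0 \<tau>)"
    and eq: "AE t in lborel. 0 < t \<longrightarrow> f0 t = g t"
  shows "AE \<tau> in (plane_measure j :: (real^'n) set measure). f \<tau> = g (infdist 0 \<tau>)"
proof -
  let ?L = "plane_measure j :: (real^'n) set measure"
  let ?D = "density lborel (\<lambda>r. ennreal (pi powr (real (CARD('n) - j) / 2) * ekm (real (CARD('n) - j) / 2) 0 r))"
  have m: "(\<lambda>\<tau>. infdist 0 \<tau>) \<in> borel_measurable ?L"
    using infdist_measurable_plane_borel by (simp add: measurable_cong_sets[OF sets_plane_measure[OF j] refl])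
  have law: "distr ?L borel (\<lambda>\<tau>. infdist 0 \<tau>) = ?D"
  proof (rule measure_eqI)
    fix X assume "X \<in> sets (distr ?L borel (\<lambda>\<tau>. infdist 0 \<tau>))"
    then have X[measurable]: "X \<in> sets borel" by simp
    have "emeasure (distr ?L borel (\<lambda>\<tau>. infdist 0 \<tau>)) X = (\<integral>\<^sup>+r. indicator X r \<partial>distr ?L borel (\<lambda>\<tau>. infdist 0 \<tau>))" by simp
    also have "\<dots> = (\<integral>\<^sup>+\<tau>. indicator X (infdist 0 \<tau>) \<partial>?L)" by (rule nn_integral_distr[OF m]) simp
    also have "\<dots> = (\<integral>\<^sup>+r. ennreal (pi powr (real (CARD('n) - j) / 2) * ekm (real (CARD('n) - j) / 2) 0 r) * indicator X r \<partial>lborel)"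
      by (rule nn_integral_plane_measure_radial[OF j]) simp
    also have "\<dots> = emeasure ?D X" by (rule emeasure_density[symmetric]) auto
    finally show "emeasure (distr ?L borel (\<lambda>\<tau>. infdist 0 \<tau>)) X = emeasure ?D X" .
  qed simp
  have "AE \<tau> in ?L. f0 (infdist 0 \<tau>) = g (infdist 0 \<tau>)"
    by (rule AE_radial_law[OF eq refl order_refl m law])
  moreover have "AE \<tau> in ?L. \<tau> \<in> affine_grassmannian j" using AE_space[of ?L] by (simp add: space_plane_measure[OF j])
  ultimately show ?thesis by eventually_elim (simp add: radial)
qed

lemma ekm_0: "0 < r \<Longrightarrow> 0 < m \<Longrightarrow> ekm (real m / 2) 0 r = 2 / Gamma (real m / 2) * r ^ (m - 1)"
proof -
  assume r: "0 < r" and m: "0 < m"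
  have "(r\<^sup>2) powr (real m / 2 - 1) * r = r powr (2 * (real m / 2 - 1)) * r powr 1" using r by (simp add: power2_powr)
  also have "\<dots> = r powr (real (m - 1))"
    unfolding powr_add[symmetric] by (rule arg_cong[of _ _ "\<lambda>z. r powr z"]) (use m in \<open>simp add: of_nat_diff\<close>)
  also have "\<dots> = r ^ (m - 1)" using r by (rule powr_realpow)
  finally show ?thesis using r by (simp add: ekm_def)
qed

text \<open>The weight h becomes an indicator for local integrability and a power beyond a for the
  tail condition.\<close>

lemma plane_measure_radial_finite:
  fixes f :: "(real^'n) set \<Rightarrow> real" and g h :: "real \<Rightarrow> real"
  assumes j: "0 < j" "j < CARD('n)" and g[measurable]: "g \<in> borel_measurable borel" and h[measurable]: "h \<in> borel_measurable borel"
    and fg: "AE \<tau> in (plane_measure j :: (real^'n) set measure). f \<tau> = g (infdist 0 \<tau>)"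
    and fin: "integrable (affine_measure j) (\<lambda>\<tau>. h (infdist 0 \<tau>) * \<bar>f \<tau>\<bar>)" and h0: "\<And>r. 0 \<le> r \<Longrightarrow> 0 \<le> h r"
  shows "(\<integral>\<^sup>+r. ennreal (indicator {0<..} r * r ^ (CARD('n) - j - 1) * h r * \<bar>g r\<bar>) \<partial>lborel) < \<infinity>"
proof -
  define m where "m = CARD('n) - j"
  have m: "0 < m" using j by (simp add: m_def)
  define C where "C = pi powr (real m / 2) * (2 / Gamma (real m / 2))"
  have C: "C > 0" using m by (auto simp: C_def intro!: mult_pos_pos divide_pos_pos Gamma_real_pos)
  have "(\<integral>\<^sup>+\<tau>. ennreal (norm (h (infdist 0 \<tau>) * \<bar>f \<tau>\<bar>)) \<partial>affine_measure j) < \<infinity>"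
    using fin unfolding integrable_iff_bounded by simp
  then have "(\<integral>\<^sup>+\<tau>. ennreal (norm (h (infdist 0 \<tau>) * \<bar>f \<tau>\<bar>)) \<partial>(plane_measure j :: (real^'n) set measure)) < \<infinity>"
    by (simp only: affine_measure_plane_measure[OF j] nn_integral_completion)
  also have "(\<integral>\<^sup>+\<tau>. ennreal (norm (h (infdist 0 \<tau>) * \<bar>f \<tau>\<bar>)) \<partial>(plane_measure j :: (real^'n) set measure)) =
    (\<integral>\<^sup>+\<tau>. (\<lambda>r. ennreal (h r * \<bar>g r\<bar>)) (infdist 0 \<tau>) \<partial>(plane_measure j :: (real^'n) set measure))"
    by (rule nn_integral_cong_AE, rule eventually_mono[OF fg]) (use h0 in \<open>simp add: abs_mult infdist_nonneg\<close>)
  also have "\<dots> = (\<integral>\<^sup>+r. ennreal (pi powr (real m / 2) * ekm (real m / 2) 0 r) * ennreal (h r * \<bar>g r\<bar>) \<partial>lborel)"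
    unfolding m_def by (rule nn_integral_plane_measure_radial[OF j]) measurable
  also have "\<dots> = (\<integral>\<^sup>+r. ennreal C * ennreal (indicator {0<..} r * r ^ (m - 1) * h r * \<bar>g r\<bar>) \<partial>lborel)"
  proof (rule nn_integral_cong)
    fix r :: real
    show "ennreal (pi powr (real m / 2) * ekm (real m / 2) 0 r) * ennreal (h r * \<bar>g r\<bar>) = ennreal C * ennreal (indicator {0<..} r * r ^ (m - 1) * h r * \<bar>g r\<bar>)"
    proof (cases "0 < r")
      case True
      have "pi powr (real m / 2) * ekm (real m / 2) 0 r = C * r ^ (m - 1)" using ekm_0[OF True m] by (simp add: C_def)
      then show ?thesis using True C h0[of r] by (simp add: ennreal_mult'[symmetric] mult_ac)
    next
      case False
      then show ?thesis by (simp add: ekm_def)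
    qed
  qed
  also have "\<dots> = ennreal C * (\<integral>\<^sup>+r. ennreal (indicator {0<..} r * r ^ (m - 1) * h r * \<bar>g r\<bar>) \<partial>lborel)"
    by (rule nn_integral_cmult) measurable
  finally have "ennreal C * (\<integral>\<^sup>+r. ennreal (indicator {0<..} r * r ^ (m - 1) * h r * \<bar>g r\<bar>) \<partial>lborel) < \<infinity>" .
  moreover have "ennreal C \<noteq> 0" using C by simp
  ultimately show ?thesis unfolding m_def[symmetric] by (auto simp: ennreal_mult_less_top)
qed

text \<open>Each step is a change of variables that stays valid with the conventional value 0 of
  divergent integrals, so convergence can be dealt with separately, in the inversion.\<close>

lemma mixed_radon_radial:
  fixes f :: "(real^'n) set \<Rightarrow> real" and f0 g :: "real \<Rightarrow> real"
  assumes jk: "0 < j" "0 < k" "j + k < CARD('n)"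
    and radial: "\<And>\<tau>. \<tau> \<in> affine_grassmannian j \<Longrightarrow> f \<tau> = f0 (infdist 0 \<tau>)"
    and g[measurable]: "g \<in> borel_measurable borel" and eq: "AE t in lborel. 0 < t \<longrightarrow> f0 t = g t"
    and \<zeta>: "\<zeta> \<in> affine_grassmannian k" "infdist 0 \<zeta> = s" "0 < s"
  shows "mixed_radon j f \<zeta> = radon_const (CARD('n)) j k *
    (s powi (int k + 2 - int (CARD('n))) * (LINT x|lborel. ekp (real j / 2) s x * inner_ek (CARD('n)) j k g x))"
proof -
  define n where "n = CARD('n)"
  obtain \<eta> v where \<eta>v: "\<eta> \<in> grassmannian UNIV k" "v \<in> \<eta>\<^sup>\<bottom>" "plane_foot \<zeta> = v" "plane_direction \<zeta> = \<eta>" "infdist 0 \<zeta> = norm v"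
    using affine_plane_decomp[OF \<zeta>(1)] by metis
  have \<eta>: "subspace \<eta>" "dim \<eta> = k" using \<eta>v(1) by (auto simp: grassmannian_def)
  have sO: "subspace (\<eta>\<^sup>\<bottom>)" by (rule subspace_orthogonal_comp)
  have d: "dim (\<eta>\<^sup>\<bottom>) = n - k" using dim_orthogonal_in[of UNIV \<eta>] \<eta> by (simp add: n_def)
  have jd: "0 < j" "j < dim (\<eta>\<^sup>\<bottom>)" using jk d by (auto simp: n_def)
  define M where "M = grassmann_measure (\<eta>\<^sup>\<bottom>) j"
  have inv: "invariant_prob (\<eta>\<^sup>\<bottom>) j M" unfolding M_def by (rule invariant_grassmann_measure[OF sO]) (use jd in simp)
  have spM: "space M = grassmannian (\<eta>\<^sup>\<bottom>) j" using inv by (simp add: invariant_prob_def)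
  have setsM[measurable_cong]: "sets M = sets (plane_borel (grassmannian (\<eta>\<^sup>\<bottom>) j))" using inv by (simp add: invariant_prob_def)
  have vs: "norm v = s" using \<eta>v(5) \<zeta>(2) by simp
  define h where "h = (\<lambda>x. pi powr (real k / 2) * (LINT r|lborel. ekm (real k / 2) x r * g r))"
  have hm[measurable]: "h \<in> borel_measurable borel" unfolding h_def by measurable
  define B where "B = orthonormal_basis_of \<eta>"
  have B: "onb B \<eta>" unfolding B_def by (rule orthonormal_basis_of_onb[OF \<eta>(1)])
  have inner: "(LINT u|subspace_lebesgue \<eta>. f ((+) (u + v) ` \<xi>)) = h (infdist v \<xi>)" if "\<xi> \<in> grassmannian (\<eta>\<^sup>\<bottom>) j" for \<xi>
  proof -
    have \<xi>: "subspace \<xi>" "\<xi> \<subseteq> \<eta>\<^sup>\<bottom>" "\<xi> \<in> grassmannian UNIV j" using that by (auto simp: grassmannian_def)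
    define x where "x = infdist v \<xi>"
    have x: "0 \<le> x" by (simp add: x_def infdist_nonneg)
    define q where "q = (\<lambda>u::real^'n. sqrt ((norm u)\<^sup>2 + x\<^sup>2))"
    have qm: "q \<in> lam B \<rightarrow>\<^sub>M borel" unfolding q_def by measurable
    have law: "distr (lam B) borel q = density lborel (\<lambda>r. ennreal (pi powr (real k / 2) * ekm (real k / 2) x r))"
      using distr_lam_norm[OF B _ x] jk \<eta>(2) by (simp add: q_def)
    \<comment> \<open>The part y of v along \<xi> does not move the plane. The rest z is orthogonal
      to \<eta>, as v and \<xi> are, so u and z are orthogonal and the distance is sqrt(|u|^2 +
      |z|^2).\<close>
    have f_q: "f ((+) (u + v) ` \<xi>) = f0 (q u)" if u: "u \<in> \<eta>" for u
    proof -
      obtain y z where yz: "y \<in> \<xi>" "z \<in> \<xi>\<^sup>\<bottom>" "v = y + z" using orthogonal_decomp[OF \<xi>(1)] .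
      have "z = v - y" using yz by simp
      then have z\<eta>: "z \<in> \<eta>\<^sup>\<bottom>" using \<eta>v(2) yz(1) \<xi>(2) sO by (auto intro: subspace_diff)
      have "u \<in> \<xi>\<^sup>\<bottom>" using u \<xi>(2) unfolding orthogonal_comp_def by (auto simp: orthogonal_def inner_commute)
      then have uz: "u + z \<in> \<xi>\<^sup>\<bottom>" using yz(2) subspace_orthogonal_comp by (intro subspace_add)
      have "orthogonal u z" using u z\<eta> by (auto simp: orthogonal_comp_def)
      then have "(norm (u + z))\<^sup>2 = (norm u)\<^sup>2 + (norm z)\<^sup>2" by (rule norm_add_Pythagorean)
      moreover have "x = norm z" unfolding x_def yz(3) by (rule infdist_orthogonal_sum[OF \<xi>(1) yz(1,2)])
      ultimately have nq: "norm (u + z) = q u" unfolding q_def by (metis norm_ge_zero real_sqrt_unique)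
      have "infdist 0 ((+) (u + v) ` \<xi>) = infdist (u + v) \<xi>" by (rule infdist_0_translate[OF \<xi>(1)])
      also have "\<dots> = infdist (y + (u + z)) \<xi>" by (rule arg_cong[of _ _ "\<lambda>z. infdist z \<xi>"]) (simp add: yz(3))
      also have "\<dots> = norm (u + z)" by (rule infdist_orthogonal_sum[OF \<xi>(1) yz(1) uz])
      finally show ?thesis using radial[OF grassmannian_translate[OF \<xi>(3)], of "u + v"] nq by simp
    qed
    have "AE u in lam B. f0 (q u) = g (q u)"
      by (rule AE_radial_law[OF eq refl x qm law])
    then have "AE u in lam B. f ((+) (u + v) ` \<xi>) = g (q u)"
      using AE_lam_mem[OF B] by eventually_elim (simp add: f_q)
    then have "(LINT u|subspace_lebesgue \<eta>. f ((+) (u + v) ` \<xi>)) = (LINT u|lam B. g (q u))"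
      unfolding subspace_lebesgue_lam B_def[symmetric]
      by (rule integral_completion_cong_AE[rotated]) (use qm in measurable)
    also have "\<dots> = (LINT r|distr (lam B) borel q. g r)" by (rule integral_distr[symmetric, OF qm g])
    also have "\<dots> = (LINT r|lborel. (pi powr (real k / 2) * ekm (real k / 2) x r) *\<^sub>R g r)"
      unfolding law by (rule integral_density) (use jk in \<open>auto intro!: mult_nonneg_nonneg\<close>)
    also have "\<dots> = (LINT r|lborel. pi powr (real k / 2) * (ekm (real k / 2) x r * g r))"
      by (simp add: mult.assoc)
    also have "\<dots> = h x" unfolding h_def by (rule integral_mult_right_zero)
    finally show ?thesis by (simp add: x_def)
  qed
  define C where "C = Gamma (real (n - k) / 2) / Gamma ((real (n - k) - real j) / 2)"
  have im: "(\<lambda>\<xi>. infdist v \<xi>) \<in> borel_measurable M"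
    using infdist_measurable_plane_borel by (simp add: measurable_cong_sets[OF setsM refl])
  have himc: "(\<lambda>\<xi>. h (infdist v \<xi>)) \<in> borel_measurable M" by (rule measurable_compose[OF im hm])
  have "mixed_radon j f \<zeta> = (LINT \<xi>|completion M. (LINT u|subspace_lebesgue \<eta>. f ((+) (u + v) ` \<xi>)))"
    by (simp add: mixed_radon_def \<eta>v Let_def M_def)
  also have "\<dots> = (LINT \<xi>|completion M. h (infdist v \<xi>))"
    by (rule Bochner_Integration.integral_cong[OF refl]) (simp add: spM inner)
  also have "\<dots> = (LINT \<xi>|M. h (infdist v \<xi>))" by (rule integral_completion[OF himc])
  also have "\<dots> = (LINT x|distr M borel (\<lambda>\<xi>. infdist v \<xi>). h x)" by (rule integral_distr[symmetric, OF im hm])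
  also have "\<dots> = (LINT x|lborel. (C * (s powi (2 - int (n - k)) * (ekp (real j / 2) s x * x powi (int (n - k) - int j - 2)))) *\<^sub>R h x)"
    unfolding distr_infdist_invariant[OF sO jd inv \<eta>v(2) vs \<zeta>(3)] d C_def
  proof (rule integral_density)
    have nn: "0 \<le> ekp (real j / 2) s x * x powi (int (n - k) - int j - 2)" for x
      using jk by (cases "0 < x") (auto simp: ekp_def[of _ s x] intro!: mult_nonneg_nonneg divide_nonneg_nonneg less_imp_le[OF Gamma_real_pos])
    have "0 \<le> Gamma (real (n - k) / 2) / Gamma ((real (n - k) - real j) / 2)"
      using jd d by (intro divide_nonneg_nonneg less_imp_le[OF Gamma_real_pos]) auto
    then show "AE x in lborel. 0 \<le> Gamma (real (n - k) / 2) / Gamma ((real (n - k) - real j) / 2) * (s powi (2 - int (n - k)) * (ekp (real j / 2) s x * x powi (int (n - k) - int j - 2)))"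
      using nn \<zeta>(3) by (intro AE_I2 mult_nonneg_nonneg[of "Gamma _ / Gamma _"] mult_nonneg_nonneg[of "s powi _"]) auto
  qed measurable
  also have "\<dots> = (LINT x|lborel. radon_const n j k * (s powi (int k + 2 - int n) * (ekp (real j / 2) s x * inner_ek n j k g x)))"
  proof (rule Bochner_Integration.integral_cong[OF refl])
    fix x
    have i: "2 - int (n - k) = int k + 2 - int n" "int (n - k) - int j - 2 = int n - int j - int k - 2" "real (n - k) = real n - real k"
      using jk by (auto simp: n_def of_nat_diff)
    have rc: "radon_const n j k = C * pi powr (real k / 2)"
      by (simp add: radon_const_def C_def i(3) algebra_simps)
    show "(C * (s powi (2 - int (n - k)) * (ekp (real j / 2) s x * x powi (int (n - k) - int j - 2)))) *\<^sub>R h x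
      = radon_const n j k * (s powi (int k + 2 - int n) * (ekp (real j / 2) s x * inner_ek n j k g x))"
      unfolding rc i(1,2) h_def inner_ek_def real_scaleR_def by (simp only: mult_ac)
  qed
  also have "\<dots> = radon_const n j k * (s powi (int k + 2 - int n) * (LINT x|lborel. ekp (real j / 2) s x * inner_ek n j k g x))"
    by (simp only: integral_mult_right_zero)
  finally show ?thesis by (simp add: n_def)
qed

text \<open>Makes the choice in \<open>radial_profile\<close> meaningful.\<close>

lemma affine_plane_at_distance:
  assumes "k < CARD('n::finite)" "0 \<le> s"
  shows "\<exists>\<zeta> \<in> (affine_grassmannian k :: (real^'n) set set). infdist 0 \<zeta> = s"
proof -
  have "k \<le> dim (UNIV :: (real^'n) set)" using assms by simp
  then obtain \<eta> :: "(real^'n) set" where \<eta>: "subspace \<eta>" "dim \<eta> = k"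
    using choose_subspace_of_subspace[of k "UNIV :: (real^'n) set"] by auto
  have "dim (\<eta>\<^sup>\<bottom>) + k = CARD('n)" using dim_orthogonal_in[of UNIV \<eta>] \<eta> by simp
  then have "dim (\<eta>\<^sup>\<bottom>) \<noteq> 0" using assms(1) by linarith
  then have "\<not> \<eta>\<^sup>\<bottom> \<subseteq> {0}" unfolding dim_eq_0 .
  then obtain w where w: "w \<in> \<eta>\<^sup>\<bottom>" "w \<noteq> 0" by auto
  define v where "v = (s / norm w) *\<^sub>R w"
  have v: "v \<in> \<eta>\<^sup>\<bottom>" "norm v = s" using w assms subspace_scale[OF subspace_orthogonal_comp] by (auto simp: v_def)
  have "\<eta> \<in> grassmannian UNIV k" using \<eta> by (simp add: grassmannian_def)
  then have "(+) v ` \<eta> \<in> affine_grassmannian k" by (rule grassmannian_translate)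
  moreover have "infdist 0 ((+) v ` \<eta>) = s"
    using infdist_0_translate[OF \<eta>(1)] infdist_orthogonal[OF \<eta>(1) v(1)] v(2) by simp
  ultimately show ?thesis by blast
qed

theorem theorem7p1:
  fixes f :: "(real ^ 'n) set \<Rightarrow> real"
    and f0 :: "real \<Rightarrow> real"
    and j k :: nat
    and a :: real
  defines "n \<equiv> CARD('n)"
  defines "Ijk_f0 \<equiv> radial_profile k (mixed_radon j f)"
  defines "\<Phi> \<equiv> (\<lambda>s. s powi (int n - int k - 2) * Ijk_f0 s)"
  defines "\<Psi> \<equiv> (\<lambda>r. r powi (2 - int n + int j + int k) * ek_deriv_plus (real j / 2) \<Phi> r)"
  assumes jk: "0 < j" "0 < k" "j + k < n"
    and radial: "\<And>\<tau>. \<tau> \<in> affine_grassmannian j \<Longrightarrow> f \<tau> = f0 (infdist 0 \<tau>)"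
    and loc: "plane_locally_integrable j f"
    and a: "0 < a"
    and tail: "set_integrable (affine_measure j) {\<tau> \<in> affine_grassmannian j. a < infdist 0 \<tau>}
                 (\<lambda>\<tau>. \<bar>f \<tau>\<bar> * infdist 0 \<tau> powi (int k + int j - int n))"
  shows "(\<forall>\<zeta>\<in>affine_grassmannian k. 0 < infdist 0 \<zeta> \<longrightarrow>
            mixed_radon j f \<zeta> = Ijk_f0 (infdist 0 \<zeta>)) \<and>
         (AE t in lebesgue. 0 < t \<longrightarrow>
            ek_deriv_plus_exists (real j / 2) \<Phi> t \<and>
            ek_deriv_minus_exists k \<Psi> t \<and>
            f0 t = inverse (radon_const n j k) * ek_deriv_minus k \<Psi> t)"
proof -
  have j: "0 < j" "j < CARD('n)" using jk by (auto simp: n_def)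
  have jk': "j + k < CARD('n)" using jk by (simp add: n_def)
  obtain g where g: "g \<in> borel_measurable borel" "AE t in lborel. 0 < t \<longrightarrow> f0 t = g t"
    using radial_AE_borel[OF j radial loc] by blast
  note gm[measurable] = g(1)
  have fg: "AE \<tau> in (plane_measure j :: (real^'n) set measure). f \<tau> = g (infdist 0 \<tau>)"
    by (rule AE_plane_measure_radial[OF j radial g(2)])
  have space: "space (affine_measure j :: (real^'n) set measure) = affine_grassmannian j"
    by (simp add: affine_measure_plane_measure[OF j] space_plane_measure[OF j])
  have locg: "(\<integral>\<^sup>+r. ennreal (indicator {0<..R} r * r ^ (n - j - 1) * \<bar>g r\<bar>) \<partial>lborel) < \<infinity>" for R :: real
  proof -
    have "compactin (plane_topology (affine_grassmannian j)) {\<tau> \<in> (affine_grassmannian j :: (real^'n) set set). infdist 0 \<tau> \<le> R}"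
      by (rule compactin_bounded_planes) (use j in simp)
    then have "set_integrable (affine_measure j) {\<tau> \<in> affine_grassmannian j. infdist 0 \<tau> \<le> R} f"
      using loc by (simp add: plane_locally_integrable_def)
    then have "integrable (affine_measure j) (\<lambda>\<tau>. \<bar>indicat_real {\<tau> \<in> affine_grassmannian j. infdist 0 \<tau> \<le> R} \<tau> *\<^sub>R f \<tau>\<bar>)"
      unfolding set_integrable_def by (rule integrable_abs)
    then have "integrable (affine_measure j) (\<lambda>\<tau>. indicator {..R} (infdist 0 \<tau>) * \<bar>f \<tau>\<bar>)"
      by (rule Bochner_Integration.integrable_cong[THEN iffD1, OF refl, rotated]) (auto simp: space indicator_def)
    from plane_measure_radial_finite[OF j gm _ fg this]
    have "(\<integral>\<^sup>+r. ennreal (indicator {0<..} r * r ^ (CARD('n) - j - 1) * indicator {..R} r * \<bar>g r\<bar>) \<partial>lborel) < \<infinity>" by simp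
    moreover have "indicator {0<..} r * r ^ (CARD('n) - j - 1) * indicator {..R} r * \<bar>g r\<bar> = indicator {0<..R} r * r ^ (n - j - 1) * \<bar>g r\<bar>" for r :: real
      by (simp add: n_def indicator_def)
    ultimately show ?thesis by (simp only:)
  qed
  \<comment> \<open>The radial density r^(n-j-1) times the weight r^(k+j-n) is r^(k-1), the growth
    of the transform's kernel at infinity.\<close>
  have tailg: "(\<integral>\<^sup>+r. ennreal (indicator {a<..} r * r ^ (k - 1) * \<bar>g r\<bar>) \<partial>lborel) < \<infinity>"
  proof -
    define h where "h = (\<lambda>r::real. indicator {a<..} r * r powi (int k + int j - int n))"
    have hm: "h \<in> borel_measurable borel" unfolding h_def by measurable
    have "integrable (affine_measure j) (\<lambda>\<tau>. h (infdist 0 \<tau>) * \<bar>f \<tau>\<bar>)"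
      using tail unfolding set_integrable_def
      by (rule Bochner_Integration.integrable_cong[THEN iffD1, OF refl, rotated]) (auto simp: space indicator_def h_def)
    from plane_measure_radial_finite[OF j gm hm fg this]
    have "(\<integral>\<^sup>+r. ennreal (indicator {0<..} r * r ^ (CARD('n) - j - 1) * h r * \<bar>g r\<bar>) \<partial>lborel) < \<infinity>"
      by (simp add: h_def)
    moreover have "indicator {0<..} r * r ^ (CARD('n) - j - 1) * h r * \<bar>g r\<bar> = indicator {a<..} r * r ^ (k - 1) * \<bar>g r\<bar>" for r
    proof (cases "a < r")
      case True
      then have r: "0 < r" using a by simp
      have "r ^ (n - j - 1) * r powi (int k + int j - int n) = r powi int (n - j - 1) * r powi (int k + int j - int n)"
        by (simp only: power_int_of_nat)
      also have "\<dots> = r powi (int (n - j - 1) + (int k + int j - int n))" using r by (simp add: power_int_add)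
      also have "int (n - j - 1) + (int k + int j - int n) = int (k - 1)" using jk by simp
      finally have "r ^ (n - j - 1) * r powi (int k + int j - int n) = r ^ (k - 1)" by (simp only: power_int_of_nat)
      then show ?thesis using True r by (simp add: h_def n_def)
    next
      case False
      then show ?thesis by (simp add: h_def)
    qed
    ultimately show ?thesis by (simp only:)
  qed
  define J where "J = (\<lambda>s. radon_const n j k * (s powi (int k + 2 - int n) * (LINT x|lborel. ekp (real j / 2) s x * inner_ek n j k g x)))"
  have radon: "mixed_radon j f \<zeta> = J (infdist 0 \<zeta>)" if "\<zeta> \<in> affine_grassmannian k" "0 < infdist 0 \<zeta>" for \<zeta>
    unfolding J_def n_def by (rule mixed_radon_radial[OF jk(1,2) jk' radial gm g(2) that(1) refl that(2)])
  \<comment> \<open>The profile takes its value at a chosen plane; by the preceding formula every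
    choice at distance s gives the same number.\<close>
  have I: "Ijk_f0 s = J s" if s: "0 < s" for s
  proof -
    have "\<exists>\<zeta>. \<zeta> \<in> (affine_grassmannian k :: (real^'n) set set) \<and> infdist 0 \<zeta> = s"
      using affine_plane_at_distance[of k s, where 'n = 'n] jk s by (auto simp: n_def)
    from someI_ex[OF this] show ?thesis
      unfolding Ijk_f0_def radial_profile_def using radon s by simp
  qed
  have "AE t in lebesgue. 0 < t \<longrightarrow>
            ek_deriv_plus_exists (real j / 2) \<Phi> t \<and>
            ek_deriv_minus_exists k \<Psi> t \<and>
            g t = inverse (radon_const n j k) * ek_deriv_minus k \<Psi> t"
    unfolding \<Psi>_def \<Phi>_def
    by (rule ek_inversion[OF gm jk a locg tailg]) (use I in \<open>simp add: J_def\<close>)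
  moreover have "AE t in lebesgue. 0 < t \<longrightarrow> f0 t = g t" using g(2) by (rule AE_completion)
  ultimately have "AE t in lebesgue. 0 < t \<longrightarrow>
            ek_deriv_plus_exists (real j / 2) \<Phi> t \<and>
            ek_deriv_minus_exists k \<Psi> t \<and>
            f0 t = inverse (radon_const n j k) * ek_deriv_minus k \<Psi> t"
    by eventually_elim simp
  moreover have "mixed_radon j f \<zeta> = Ijk_f0 (infdist 0 \<zeta>)" if "\<zeta> \<in> affine_grassmannian k" "0 < infdist 0 \<zeta>" for \<zeta>
    using radon[OF that] I[OF that(2)] by simp
  ultimately show ?thesis by blast
qed

end
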